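(* Let $\mathcal{G}$ be a marked simple graph with countable vertex set $I$. For any $\mathbf m\in \mathbb{Z}_+^{I}$, $$ \mathrm{mult}_{\mathcal{G}}(\mathbf m) = \epsilon(\mathbf m)\sum_{\ell | \mathbf m}\frac{\mu(\ell)}{\ell}\,\epsilon(\mathbf m/\ell)\,(-1)^{|\mathbf m|/\ell-1}\, {_{\mathbf{m}/\ell}\Pi^{\mathrm{mark}}_\mathcal{G}}(q)[q].$$ In particular, if the entries $m_i$ ($i\in\mathrm{supp}(\mathbf m)$) are relatively prime, then $\mathrm{mult}_{\mathcal{G}}(\mathbf m)=|{_{\mathbf{m}}\Pi^{\mathrm{mark}}_\mathcal{G}}(q)[q]|$.
   Context: $\mathcal{G}$ has edge set $E$ and marking $I_1^{\mathrm{it}}\subseteq I_1\subseteq I$ ($I_1$ odd, $I_0=I\setminus I_1$ even, $I_1^{\mathrm{it}}$ odd isotropic vertices). $\mathcal{P}(\mathcal{G})=\mathcal{F}(X_I)/\mathcal{J}$, where $\mathcal{F}(X_I)$ is the free Lie superalgebra over $\mathbb{C}$ on $e_i$ ($i\in I$), $e_i$ odd iff $i\in I_1$, and $\mathcal{J}$ is the ideal generated by $[e_i,e_j]$ ($i\neq j$ non-adjacent) and $[e_i,e_i]$ ($i\in I_1^{\mathrm{it}}$); it is $\mathbb{Z}_+^I$-graded with $\deg e_i$ the $i$-th unit vector, and $\mathrm{mult}_{\mathcal{G}}(\mathbf m)=\dim\mathcal{P}(\mathcal{G})_{\mathbf m}$. For $\mathbf m\in\mathbb{Z}_+^I$, $|\mathbf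 m|=\sum_i m_i$, $\ell\mid\mathbf m$ means $\ell\in\mathbb{N}$ divides every $m_i$, and $\epsilon(\mathbf m)=(-1)^{\sum_{i\in I_1}m_i}$. $\mu$ is the Möbius function. ${_{\mathbf{m}}\Pi^{\mathrm{mark}}_\mathcal{G}}(q)$ is the marked chromatic polynomial: for $q\in\mathbb{N}$ it counts maps $\Gamma$ from $I$ to finite multisubsets of $\{1,\dots,q\}$ with $\Gamma(i)$ a set for $i\notin I_1^{\mathrm{it}}$, $|\Gamma(i)|=m_i$ (with multiplicity), and $\Gamma(i)\cap\Gamma(j)=\emptyset$ for adjacent $i,j$; this is a polynomial in $q$, and $f(q)[q]$ denotes the coefficient of $q$ in a polynomial $f$. *)

theory Defs
  imports
    "HOL-Algebra.QuotRing"
    "HOL-Library.Poly_Mapping"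
    "HOL-Library.Multiset"
    "HOL-Library.Countable_Set"
    "HOL-Computational_Algebra.Computational_Algebra"
    "Jordan_Normal_Form.VS_Connect"
begin

section \<open>Marked graphs\<close>

record 'i marked_graph =
  verts :: "'i set"
  edges :: "'i set set"
  odd_verts :: "'i set"
  iso_verts :: "'i set"

definition marked_simple_graph :: "'i marked_graph \<Rightarrow> bool" where
  "marked_simple_graph G \<longleftrightarrow>
     edges G \<subseteq> {{i, j} | i j. i \<in> verts G \<and> j \<in> verts G \<and> i \<noteq> j} \<and>
     iso_verts G \<subseteq> odd_verts G \<and> odd_verts G \<subseteq> verts G"


section \<open>Superalgebras, ideals and quotients\<close>

text \<open>
  A (not necessarily associative, not necessarily unital) superalgebra over the complex numbers
  is a module record whose multiplication is the bilinear product (later: the Lie bracket); the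
  field \<open>one\<close> of the record plays no role.  The even and the odd part are
  \<open>parity_part A False\<close> and \<open>parity_part A True\<close>, and \<open>degree_part A m\<close> is the component of
  degree \<open>m\<close> of a second grading by multidegrees.
\<close>

record ('i, 'x) superalgebra = "(complex, 'x) module" +
  parity_part :: "bool \<Rightarrow> 'x set"
  degree_part :: "('i \<Rightarrow> nat) \<Rightarrow> 'x set"

definition algebra_ideal :: "'x set \<Rightarrow> ('i, 'x) superalgebra \<Rightarrow> bool" where
  "algebra_ideal J A \<longleftrightarrow>
     Module.submodule J class_ring A \<and>
     (\<forall>x \<in> carrier A. \<forall>y \<in> J. x \<otimes>\<^bsub>A\<^esub> y \<in> J \<and> y \<otimes>\<^bsub>A\<^esub> x \<in> J)"

definition ideal_generated :: "('i, 'x) superalgebra \<Rightarrow> 'x set \<Rightarrow> 'x set" where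
  "ideal_generated A S = \<Inter> {J. algebra_ideal J A \<and> S \<subseteq> J}"

text \<open>
  The ring part of the quotient is that of \<^const>\<open>FactRing\<close> (whose definition does not need
  associativity); the gradings of the quotient are the images of those of \<open>A\<close>.
\<close>

definition quotient_algebra ::
    "('i, 'x) superalgebra \<Rightarrow> 'x set \<Rightarrow> ('i, 'x set) superalgebra" where
  "quotient_algebra A J =
     \<lparr> carrier = carrier (A Quot J), monoid.mult = monoid.mult (A Quot J), one = one (A Quot J),
       zero = zero (A Quot J), add = add (A Quot J),
       smult = (\<lambda>c X. \<Union>x\<in>X. J +>\<^bsub>A\<^esub> (c \<odot>\<^bsub>A\<^esub> x)),
       parity_part = (\<lambda>p. (\<lambda>x. J +>\<^bsub>A\<^esub> x) ` parity_part A p),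
       degree_part = (\<lambda>m. (\<lambda>x. J +>\<^bsub>A\<^esub> x) ` degree_part A m) \<rparr>"


section \<open>Free Lie superalgebras\<close>

text \<open>Nonassociative words: the free magma on the letters \<open>'i\<close>.\<close>

datatype (letters: 'i) magma = Gen 'i | Br "'i magma" "'i magma"

primrec word_degree :: "'i magma \<Rightarrow> 'i \<Rightarrow> nat" where
  "word_degree (Gen i) = (\<lambda>j. if j = i then 1 else 0)"
| "word_degree (Br s t) = (\<lambda>j. word_degree s j + word_degree t j)"

primrec word_odd :: "'i set \<Rightarrow> 'i magma \<Rightarrow> bool" where
  "word_odd I1 (Gen i) \<longleftrightarrow> i \<in> I1"
| "word_odd I1 (Br s t) \<longleftrightarrow> word_odd I1 s \<noteq> word_odd I1 t"

text \<open>
  The free nonassociative superalgebra: formal complex linear combinations of nonassociative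
  words in the letters \<open>I\<close>, with the bilinear extension of the word product.
\<close>

definition free_nonassoc :: "'i set \<Rightarrow> 'i set \<Rightarrow> ('i, 'i magma \<Rightarrow>\<^sub>0 complex) superalgebra" where
  "free_nonassoc I I1 =
     \<lparr> carrier = {x. \<forall>t \<in> Poly_Mapping.keys x. letters t \<subseteq> I},
       monoid.mult = (\<lambda>x y. \<Sum>s \<in> Poly_Mapping.keys x. \<Sum>t \<in> Poly_Mapping.keys y.
                 Poly_Mapping.single (Br s t) (Poly_Mapping.lookup x s * Poly_Mapping.lookup y t)),
       one = 0, zero = 0, add = (+),
       smult = (\<lambda>c. Poly_Mapping.map ((*) c)),
       parity_part = (\<lambda>p. {x. \<forall>t \<in> Poly_Mapping.keys x. letters t \<subseteq> I \<and> word_odd I1 t = p}),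
       degree_part = (\<lambda>m. {x. \<forall>t \<in> Poly_Mapping.keys x. letters t \<subseteq> I \<and> word_degree t = m}) \<rparr>"

text \<open>The sign \<open>(-1)^(p q)\<close> for parities \<open>p\<close> and \<open>q\<close> (\<open>True\<close> being odd).\<close>

definition super_sign :: "bool \<Rightarrow> bool \<Rightarrow> complex" where
  "super_sign p q = (if p \<and> q then -1 else 1)"

text \<open>
  The elements that vanish precisely when the product of \<open>A\<close> is a Lie superbracket:
  \<open>[x,y] + (-1)^(p q) [y,x]\<close> (super skew-symmetry) and
  \<open>[x,[y,z]] - ([[x,y],z] + (-1)^(p q) [y,[x,z]])\<close> (super Jacobi identity) for parity-homogeneous
  \<open>x\<close>, \<open>y\<close>, \<open>z\<close>, where \<open>p\<close> and \<open>q\<close> are the parities of \<open>x\<close> and \<open>y\<close>.  Over the complex numbers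
  these imply \<open>[x,x] = 0\<close> for even and \<open>[x,[x,x]] = 0\<close> for odd \<open>x\<close>.
\<close>

definition lie_relators :: "('i, 'x) superalgebra \<Rightarrow> 'x set" where
  "lie_relators A =
     {x \<otimes>\<^bsub>A\<^esub> y \<oplus>\<^bsub>A\<^esub> super_sign p q \<odot>\<^bsub>A\<^esub> (y \<otimes>\<^bsub>A\<^esub> x) | x y p q.
        x \<in> parity_part A p \<and> y \<in> parity_part A q} \<union>
     {x \<otimes>\<^bsub>A\<^esub> (y \<otimes>\<^bsub>A\<^esub> z)
        \<ominus>\<^bsub>A\<^esub> ((x \<otimes>\<^bsub>A\<^esub> y) \<otimes>\<^bsub>A\<^esub> z \<oplus>\<^bsub>A\<^esub> super_sign p q \<odot>\<^bsub>A\<^esub> (y \<otimes>\<^bsub>A\<^esub> (x \<otimes>\<^bsub>A\<^esub> z))) | x y z p q r.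
        x \<in> parity_part A p \<and> y \<in> parity_part A q \<and> z \<in> parity_part A r}"

definition free_lie ::
    "'i set \<Rightarrow> 'i set \<Rightarrow> ('i, ('i magma \<Rightarrow>\<^sub>0 complex) set) superalgebra" where
  "free_lie I I1 =
     quotient_algebra (free_nonassoc I I1)
       (ideal_generated (free_nonassoc I I1) (lie_relators (free_nonassoc I I1)))"

definition free_lie_gen :: "'i set \<Rightarrow> 'i set \<Rightarrow> 'i \<Rightarrow> ('i magma \<Rightarrow>\<^sub>0 complex) set" where
  "free_lie_gen I I1 i =
     ideal_generated (free_nonassoc I I1) (lie_relators (free_nonassoc I I1))
       +>\<^bsub>free_nonassoc I I1\<^esub> Poly_Mapping.single (Gen i) 1"


section \<open>The partially commutative Lie superalgebra of a marked graph\<close>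

definition graph_relators :: "'i marked_graph \<Rightarrow> ('i magma \<Rightarrow>\<^sub>0 complex) set set" where
  "graph_relators G =
     (let F = free_lie (verts G) (odd_verts G); e = free_lie_gen (verts G) (odd_verts G) in
       {e i \<otimes>\<^bsub>F\<^esub> e j | i j. i \<in> verts G \<and> j \<in> verts G \<and> i \<noteq> j \<and> {i, j} \<notin> edges G} \<union>
       {e i \<otimes>\<^bsub>F\<^esub> e i | i. i \<in> iso_verts G})"

definition partial_comm_lie ::
    "'i marked_graph \<Rightarrow> ('i, ('i magma \<Rightarrow>\<^sub>0 complex) set set) superalgebra" where
  "partial_comm_lie G =
     (let F = free_lie (verts G) (odd_verts G) in
       quotient_algebra F (ideal_generated F (graph_relators G)))"

definition root_mult :: "'i marked_graph \<Rightarrow> ('i \<Rightarrow> nat) \<Rightarrow> nat" where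
  "root_mult G m =
     vectorspace.dim class_ring
       ((partial_comm_lie G) \<lparr> carrier := degree_part (partial_comm_lie G) m \<rparr>)"


section \<open>Multidegrees\<close>

definition supp :: "('i \<Rightarrow> nat) \<Rightarrow> 'i set" where
  "supp m = {i. m i \<noteq> 0}"

text \<open>Elements of \<open>\<int>\<^sub>+\<^sup>I\<close>: finitely supported (so that \<open>|m|\<close> makes sense), zero outside \<open>I\<close>.\<close>

definition multidegrees :: "'i set \<Rightarrow> ('i \<Rightarrow> nat) set" where
  "multidegrees I = {m. finite (supp m) \<and> supp m \<subseteq> I}"

definition total_degree :: "('i \<Rightarrow> nat) \<Rightarrow> nat" where
  "total_degree m = (\<Sum>i\<in>supp m. m i)"

definition eps :: "'i marked_graph \<Rightarrow> ('i \<Rightarrow> nat) \<Rightarrow> real" where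
  "eps G m = (-1) ^ (\<Sum>i\<in>supp m \<inter> odd_verts G. m i)"

text \<open>
  For \<open>m = 0\<close> this set is infinite; the sum over it in the multiplicity formula is then \<open>0\<close> by
  convention, in accordance with all its terms being \<open>0\<close> (the chromatic polynomial is \<open>1\<close>).
\<close>

definition divisors_of :: "('i \<Rightarrow> nat) \<Rightarrow> nat set" where
  "divisors_of m = {l. l > 0 \<and> (\<forall>i. l dvd m i)}"

definition div_deg :: "('i \<Rightarrow> nat) \<Rightarrow> nat \<Rightarrow> 'i \<Rightarrow> nat" where
  "div_deg m l = (\<lambda>i. m i div l)"

definition moebius :: "nat \<Rightarrow> int" where
  "moebius n = (if squarefree n then (-1) ^ card (prime_factors n) else 0)"


section \<open>The marked chromatic polynomial\<close>

text \<open>Colourings are maps on \<open>verts G\<close>, extended by the empty multiset outside \<open>verts G\<close>.\<close>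

definition marked_colourings ::
    "'i marked_graph \<Rightarrow> ('i \<Rightarrow> nat) \<Rightarrow> nat \<Rightarrow> ('i \<Rightarrow> nat multiset) set" where
  "marked_colourings G m q =
     {\<Gamma>. (\<forall>i. i \<notin> verts G \<longrightarrow> \<Gamma> i = {#}) \<and>
         (\<forall>i \<in> verts G. set_mset (\<Gamma> i) \<subseteq> {1..q} \<and> size (\<Gamma> i) = m i) \<and>
         (\<forall>i \<in> verts G - iso_verts G. \<forall>c. count (\<Gamma> i) c \<le> 1) \<and>
         (\<forall>i j. {i, j} \<in> edges G \<longrightarrow> set_mset (\<Gamma> i) \<inter> set_mset (\<Gamma> j) = {})}"

definition marked_chromatic_poly :: "'i marked_graph \<Rightarrow> ('i \<Rightarrow> nat) \<Rightarrow> real poly" where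
  "marked_chromatic_poly G m =
     (THE P. \<forall>q::nat. poly P (real q) = real (card (marked_colourings G m q)))"

end

theory Submission
  imports Defs
begin

text \<open>
  Let \<open>A\<close> be the associative superalgebra with the same generators and relations as the Lie
  superalgebra \<open>P\<close> of the graph. Its monomials are Cartier-Foata traces, so the Hilbert series of
  \<open>A\<close> is \<open>1 / I(-X)\<close>, where \<open>I\<close> enumerates the independent multisets, while the marked chromatic
  polynomial collects the coefficients of \<open>I ^ q\<close>; its linear coefficient is that of \<open>log I\<close>.
  The right-normed bracketing of words is well defined on \<open>A\<close> and, by Dynkin-Specht-Wever, multiplies
  the image of a homogeneous element of \<open>P\<close> by its degree; hence \<open>P\<close> embeds into \<open>A\<close>.
  Ordered monomials in a basis of \<open>P\<close> span \<open>A\<close> by straightening. They are independent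
  because Lie elements are primitive: contracting the coproduct with a functional supported in the
  lowest degree gives a derivation that detects one basis element. Comparing logarithmic
  derivatives of the resulting product formula with that of \<open>1 / I(-X)\<close>, followed by
  Moebius inversion, gives the multiplicities.
\<close>

\<comment> \<open>The algebra \<open>A\<close> is never formed as a quotient: \<open>rho\<close>
  rewrites words into signed normal forms of traces, and its kernel \<open>K\<close> is the ideal of
  relations. A basis of \<open>A\<close> by traces is thus built in, and descent to \<open>A\<close>
  is checked on swaps and isotropic squares alone (\<open>compat_K\<close>). The embedding of P is
  not a consequence of the count of ordered monomials, which only sees the images of Lie words in
  \<open>A\<close>; Dynkin-Specht-Wever supplies it, at the price of dividing by the degree. P may
  be infinite-dimensional, but the coefficient at a fixed degree n involves only letters of n and
  words no longer than n, so one finite list of Lie words serves each n. An even basis element of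
  degree d contributes 1 / (1 - X^d), an odd one 1 + X^d. With s = \<open>psign d\<close> these are
  (1 - s X^d)^(-1) and 1 - s X^d, so all logarithmic derivatives have one shape; this is the origin
  of the signs \<open>eps\<close>. The factor (-1)^(|m|/l - 1) stems from the substitution of -X for
  X in 1 / I(-X). The linear coefficient sees log I because I ^ q = exp (q log I).\<close>
alias single = Poly_Mapping.single
alias keys = Poly_Mapping.keys
alias lookup = Poly_Mapping.lookup

section \<open>Linear extension of maps on words\<close>

text \<open>The same term as the \<open>smult\<close> field of \<open>free_nonassoc\<close>; the
  interpretation below makes vector space theory available for it.\<close>

definition psc :: "complex \<Rightarrow> ('a \<Rightarrow>\<^sub>0 complex) \<Rightarrow> 'a \<Rightarrow>\<^sub>0 complex" where
  "psc c = Poly_Mapping.map ((*) c)"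

lemma lookup_psc [simp]: "lookup (psc c x) k = c * lookup x k"
  by (simp add: psc_def map.rep_eq when_def)

interpretation pm: vector_space "psc :: complex \<Rightarrow> ('a \<Rightarrow>\<^sub>0 complex) \<Rightarrow> 'a \<Rightarrow>\<^sub>0 complex"
  by unfold_locales (auto intro!: poly_mapping_eqI simp: lookup_add algebra_simps)

lemma psc_single [simp]: "psc c (single k d) = single k (c * d)"
  by (auto intro!: poly_mapping_eqI simp: lookup_single when_def)

lemma poly_mapping_decompose:
  "x = (\<Sum>k\<in>keys x. psc (lookup x k) (single k 1))"
proof (rule poly_mapping_eqI)
  fix k
  show "lookup x k = lookup (\<Sum>k\<in>keys x. psc (lookup x k) (single k 1)) k"
    by (simp add: lookup_sum lookup_single when_def sum.delta in_keys_iff if_distrib cong: if_cong)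
qed

definition lin :: "('a \<Rightarrow> 'b \<Rightarrow>\<^sub>0 complex) \<Rightarrow> ('a \<Rightarrow>\<^sub>0 complex) \<Rightarrow> 'b \<Rightarrow>\<^sub>0 complex" where
  "lin f x = (\<Sum>k\<in>keys x. psc (lookup x k) (f k))"

lemma lin_superset:
  assumes "finite S" "keys x \<subseteq> S"
  shows "lin f x = (\<Sum>k\<in>S. psc (lookup x k) (f k))"
  unfolding lin_def by (rule sum.mono_neutral_left) (use assms in \<open>auto simp: in_keys_iff\<close>)

lemma lin_single [simp]: "lin f (single k c) = psc c (f k)"
  by (cases "c = 0") (simp_all add: lin_def)

lemma lin_0 [simp]: "lin f 0 = 0"
  by (simp add: lin_def)

lemma lin_add: "lin f (x + y) = lin f x + lin f y"
proof -
  let ?S = "keys x \<union> keys y"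
  have "lin f (x + y) = (\<Sum>k\<in>?S. psc (lookup (x + y) k) (f k))"
    by (rule lin_superset) (use keys_add[of x y] in auto)
  then show ?thesis
    by (simp add: lin_superset[of ?S] lookup_add pm.scale_left_distrib sum.distrib)
qed

lemma lin_psc: "lin f (psc c x) = psc c (lin f x)"
proof -
  have "lin f (psc c x) = (\<Sum>k\<in>keys x. psc (lookup (psc c x) k) (f k))"
    by (rule lin_superset) (auto simp: in_keys_iff)
  then show ?thesis by (simp add: lin_def pm.scale_sum_right)
qed

lemma lin_minus: "lin f (x - y) = lin f x - lin f y"
  using lin_add[of f "x - y" y] by simp

lemma lin_sum: "lin f (sum g S) = (\<Sum>s\<in>S. lin f (g s))"
  by (induction S rule: infinite_finite_induct) (simp_all add: lin_add)

lemma lin_cong: "(\<And>k. k \<in> keys x \<Longrightarrow> f k = g k) \<Longrightarrow> lin f x = lin g x"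
  by (simp add: lin_def)

lemma lin_fun_add: "lin (\<lambda>k. f k + g k) x = lin f x + lin g x"
  by (simp add: lin_def pm.scale_right_distrib sum.distrib)

lemma lin_fun_psc: "lin (\<lambda>k. psc c (f k)) x = psc c (lin f x)"
  by (simp add: lin_def pm.scale_sum_right mult.commute)

lemma lin_fun_minus: "lin (\<lambda>k. f k - g k) x = lin f x - lin g x"
  by (simp add: lin_def pm.scale_right_diff_distrib sum_subtractf)

lemma lin_lin: "lin f (lin g x) = lin (\<lambda>k. lin f (g k)) x"
  by (simp add: lin_def[of g] lin_def[of "\<lambda>k. lin f (g k)"] lin_sum lin_psc)

lemma lin_id: "lin (\<lambda>k. single k 1) x = x"
  using poly_mapping_decompose[of x] by (simp add: lin_def)

lemma linear_eq_lin:
  assumes "\<And>x y. F (x + y) = F x + F y" "\<And>c x. F (psc c x) = psc c (F x)"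
  shows "F x = lin (\<lambda>k. F (single k 1)) x"
proof -
  have 0: "F 0 = 0" using assms(2)[of 0 0] by simp
  have sum: "F (sum g S) = (\<Sum>s\<in>S. F (g s))" for g and S :: "'a set"
    by (induction S rule: infinite_finite_induct) (simp_all add: 0 assms)
  have "F x = F (\<Sum>k\<in>keys x. psc (lookup x k) (single k 1))"
    using poly_mapping_decompose[of x] by simp
  also have "\<dots> = lin (\<lambda>k. F (single k 1)) x"
    by (simp only: sum lin_def assms(2))
  finally show ?thesis .
qed

text \<open>Words form a basis; identities between linear maps are reduced to single words through
  this rule.\<close>

lemma linear_eqI:
  assumes "\<And>x y. F (x + y) = F x + F y" "\<And>c x. F (psc c x) = psc c (F x)"
    and "\<And>x y. G (x + y) = G x + G y" "\<And>c x. G (psc c x) = psc c (G x)"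
    and "\<And>k. F (single k 1) = G (single k 1)"
  shows "F x = G x"
  using linear_eq_lin[of F x] linear_eq_lin[of G x] assms by simp

lemma subspace_lin:
  assumes "pm.subspace S" "\<And>k. k \<in> keys x \<Longrightarrow> f k \<in> S"
  shows "lin f x \<in> S"
  unfolding lin_def using assms by (intro pm.subspace_sum pm.subspace_scale) auto

lemma subspace_keys: "pm.subspace {x :: 'a \<Rightarrow>\<^sub>0 complex. \<forall>k\<in>keys x. P k}"
proof -
  have "\<forall>k\<in>keys (x + y). P k" if "\<forall>k\<in>keys x. P k" "\<forall>k\<in>keys y. P k" for x y :: "'a \<Rightarrow>\<^sub>0 complex"
    using that Poly_Mapping.keys_add[of x y] by blast
  moreover have "\<forall>k\<in>keys (psc c x). P k" if "\<forall>k\<in>keys x. P k" for c and x :: "'a \<Rightarrow>\<^sub>0 complex"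
    using that by (auto simp: in_keys_iff)
  moreover have "\<forall>k\<in>keys (0 :: 'a \<Rightarrow>\<^sub>0 complex). P k" by simp
  ultimately show ?thesis unfolding pm.subspace_def mem_Collect_eq by blast
qed

text \<open>This turns \<^typ>\<open>'a list \<Rightarrow>\<^sub>0 complex\<close> into the free associative algebra.\<close>

instantiation list :: (type) monoid_add
begin
definition "0 = ([] :: 'a list)"
definition "xs + ys = (xs @ ys :: 'a list)"
instance by intro_classes (simp_all add: zero_list_def plus_list_def)
end

lemma mult_single_list:
  "single (u :: 'a list) c * single v d = single (u @ v) (c * d :: complex)"
  by (simp add: mult_single plus_list_def)

lemma single_Nil_one: "single ([] :: 'a list) (1 :: complex) = 1"
  unfolding zero_list_def[symmetric] by (rule single_one)

text \<open>Scalars act as multiplication by the central elements \<open>single 0 c\<close>, so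
  their compatibility with products becomes associativity.\<close>

lemma psc_eq_mult:
  fixes x :: "'a list \<Rightarrow>\<^sub>0 complex"
  shows "psc c x = single 0 c * x" and "psc c x = x * single 0 c"
proof -
  let ?t = "\<lambda>k. single k (lookup x k)"
  have x: "x = (\<Sum>k\<in>keys x. ?t k)"
    using poly_mapping_decompose[of x] by simp
  have "psc c (\<Sum>k\<in>keys x. ?t k) = single 0 c * (\<Sum>k\<in>keys x. ?t k)"
    by (simp add: pm.scale_sum_right sum_distrib_left mult_single)
  then show "psc c x = single 0 c * x" using x by metis
  have "psc c (\<Sum>k\<in>keys x. ?t k) = (\<Sum>k\<in>keys x. ?t k) * single 0 c"
    by (simp add: pm.scale_sum_right sum_distrib_right mult_single mult.commute)
  then show "psc c x = x * single 0 c" using x by metis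
qed

lemma psc_mult_left: "psc c x * y = psc c (x * (y :: 'a list \<Rightarrow>\<^sub>0 complex))"
  by (simp only: psc_eq_mult(1) mult.assoc)

lemma psc_mult_right: "x * psc c y = psc c (x * (y :: 'a list \<Rightarrow>\<^sub>0 complex))"
  by (simp only: psc_eq_mult(2) mult.assoc)

section \<open>Traces\<close>

locale trace_graph =
  fixes G :: "'i marked_graph"
  assumes simple: "marked_simple_graph G" and countable_verts: "countable (verts G)"
begin

abbreviation odd_letter :: "'i \<Rightarrow> bool" where "odd_letter a \<equiv> a \<in> odd_verts G"

text \<open>Countability of the vertex set provides this injective numbering, against which
  inversions of odd letters are counted. Any other injective numbering would only rescale normal
  forms by signs.\<close>

abbreviation ord :: "'i \<Rightarrow> nat" where "ord \<equiv> to_nat_on (verts G)"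

definition dep :: "'i \<Rightarrow> 'i \<Rightarrow> bool" where
  "dep a b \<longleftrightarrow> a = b \<or> {a, b} \<in> edges G"

definition proj :: "'i \<Rightarrow> 'i \<Rightarrow> 'i list \<Rightarrow> 'i list" where
  "proj a b w = filter (\<lambda>x. x = a \<or> x = b) w"

text \<open>By the projection lemma this is the congruence generated by commuting independent letters.\<close>

definition eqt :: "'i list \<Rightarrow> 'i list \<Rightarrow> bool" where
  "eqt w v \<longleftrightarrow> (\<forall>a b. dep a b \<longrightarrow> proj a b w = proj a b v)"

text \<open>The choice b = a forces an occurrence of a; the other b say that nothing dependent on a
  precedes it. So a can be commuted to the front of w, see \<open>ini_split\<close>.\<close>

definition ini :: "'i \<Rightarrow> 'i list \<Rightarrow> bool" where
  "ini a w \<longleftrightarrow> (\<forall>b. dep a b \<longrightarrow> (\<exists>r. proj a b w = a # r))"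

text \<open>Equivalently, some word in the class of \<open>w\<close> has two adjacent copies of an isotropic letter.\<close>

primrec nil :: "'i list \<Rightarrow> bool" where
  "nil [] \<longleftrightarrow> False"
| "nil (a # w) \<longleftrightarrow> nil w \<or> a \<in> iso_verts G \<and> ini a w"

definition tau :: "'i \<Rightarrow> 'i \<Rightarrow> complex" where
  "tau a b = (if odd_letter a \<and> odd_letter b \<and> ord b < ord a then -1 else 1)"

abbreviation ss :: "'i \<Rightarrow> 'i \<Rightarrow> complex" where
  "ss a b \<equiv> super_sign (odd_letter a) (odd_letter b)"

text \<open>The sign counts inversions of odd letters, so it changes by the Koszul sign
  when two distinct adjacent letters are exchanged.\<close>

primrec inv_sign :: "'i list \<Rightarrow> complex" where
  "inv_sign [] = 1"
| "inv_sign (a # w) = (\<Prod>b\<leftarrow>w. tau a b) * inv_sign w"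

lemma dep_sym: "dep a b \<longleftrightarrow> dep b a"
  by (auto simp: dep_def insert_commute)

lemma dep_refl [simp]: "dep a a"
  by (simp add: dep_def)

lemma odd_letter_verts: "odd_letter a \<Longrightarrow> a \<in> verts G"
  and iso_odd: "a \<in> iso_verts G \<Longrightarrow> odd_letter a"
  using simple by (auto simp: marked_simple_graph_def)

lemma proj_Nil [simp]: "proj a b [] = []"
  and proj_Cons: "proj a b (c # w) = (if c = a \<or> c = b then c # proj a b w else proj a b w)"
  and proj_append [simp]: "proj a b (u @ v) = proj a b u @ proj a b v"
  by (simp_all add: proj_def)

lemma eqt_refl [simp]: "eqt w w"
  and eqt_sym: "eqt w v \<Longrightarrow> eqt v w"
  and eqt_trans: "eqt w v \<Longrightarrow> eqt v u \<Longrightarrow> eqt w u"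
  and eqt_append: "eqt u u' \<Longrightarrow> eqt v v' \<Longrightarrow> eqt (u @ v) (u' @ v')"
  by (simp_all add: eqt_def)

lemma eqt_Cons [simp]: "eqt (a # w) (a # v) \<longleftrightarrow> eqt w v"
  by (auto simp: eqt_def proj_Cons)

lemma eqt_swap: "\<not> dep a b \<Longrightarrow> eqt (u @ a # b # v) (u @ b # a # v)"
  by (auto simp: eqt_def proj_Cons dep_sym)

lemma eqt_mset: "eqt w v \<Longrightarrow> mset w = mset v"
proof (rule multiset_eqI)
  fix a assume "eqt w v"
  then have "proj a a w = proj a a v" by (simp add: eqt_def)
  moreover have "count (mset w) a = length (proj a a w)" for w
    by (induction w) (auto simp: proj_Cons)
  ultimately show "count (mset w) a = count (mset v) a" by metis
qed

lemma ini_eqt: "eqt w v \<Longrightarrow> ini a w = ini a v"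
  by (auto simp: ini_def eqt_def)

lemma ini_Nil [simp]: "\<not> ini a []"
  by (auto simp: ini_def intro: exI[of _ a])

lemma ini_Cons: "ini a (c # w) \<longleftrightarrow> a = c \<or> \<not> dep a c \<and> ini a w"
proof (cases "a = c")
  case False
  show ?thesis
  proof (cases "dep a c")
    case True
    then have "\<not> ini a (c # w)" using False by (auto simp: ini_def proj_Cons intro!: exI[of _ c])
    then show ?thesis using True False by simp
  next
    case nd: False
    have "proj a b (c # w) = proj a b w" if "dep a b" for b
      using that nd False by (auto simp: proj_Cons)
    then show ?thesis using nd False by (auto simp: ini_def)
  qed
qed (simp add: ini_def proj_Cons)

lemma ini_split:
  assumes "ini a w"
  obtains u v where "w = u @ a # v" "\<forall>x\<in>set u. \<not> dep a x"
proof -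
  have "\<exists>u v. w = u @ a # v \<and> (\<forall>x\<in>set u. \<not> dep a x)"
    using assms
  proof (induction w)
    case (Cons c w)
    show ?case
    proof (cases "a = c")
      case True
      then show ?thesis by (intro exI[of _ "[]"] exI[of _ w]) auto
    next
      case False
      with Cons obtain u v where "w = u @ a # v" "\<forall>x\<in>set u. \<not> dep a x" "\<not> dep a c"
        by (auto simp: ini_Cons)
      then show ?thesis by (intro exI[of _ "c # u"] exI[of _ v]) auto
    qed
  qed simp
  then show thesis using that by blast
qed

text \<open>Stated for an arbitrary reflexive and transitive relation that contains the swaps,
  because it serves both \<open>eqt\<close> and, inside \<open>eqt_induct\<close>, the relation
  being established.\<close>

lemma eqt_move_front:
  assumes refl: "\<And>w. R w w" and trans: "\<And>u v w. R u v \<Longrightarrow> R v w \<Longrightarrow> R u w"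
    and swap: "\<And>u v a b. \<not> dep a b \<Longrightarrow> R (u @ a # b # v) (u @ b # a # v)"
    and "\<forall>x\<in>set p. \<not> dep a x"
  shows "R (u @ a # p @ q) (u @ p @ a # q)"
  using assms(4)
proof (induction p arbitrary: u)
  case (Cons c p)
  have "R (u @ a # c # p @ q) (u @ c # a # p @ q)" using Cons by (intro swap) auto
  moreover have "R ((u @ [c]) @ a # p @ q) ((u @ [c]) @ p @ a # q)" using Cons by (intro Cons.IH) auto
  ultimately show ?case using trans by fastforce
qed (simp add: refl)

lemma eqt_move_front': "\<forall>x\<in>set p. \<not> dep a x \<Longrightarrow> eqt (u @ a # p @ q) (u @ p @ a # q)"
  by (rule eqt_move_front[where R = eqt]) (auto intro: eqt_trans eqt_swap)

text \<open>The projection lemma. The first letter of one word is initial in the other, can be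
  commuted to its front by swaps, and is then cancelled by \<open>eqt_Cons\<close>.\<close>

lemma eqt_induct [consumes 1, case_names refl trans swap]:
  assumes "eqt w v"
    and refl: "\<And>w. R w w" and trans: "\<And>u v w. R u v \<Longrightarrow> R v w \<Longrightarrow> R u w"
    and swap: "\<And>u v a b. \<not> dep a b \<Longrightarrow> R (u @ a # b # v) (u @ b # a # v)"
  shows "R w v"
proof -
  \<comment> \<open>The prefix u collects the letters already matched. It is needed because R is not
    assumed to be compatible with concatenation.\<close>
  have "R (u @ w) (u @ v)" for u
    using assms(1)
  proof (induction w arbitrary: u v)
    case Nil
    then show ?case using eqt_mset[OF Nil] refl by simp
  next
    case (Cons a w)
    have "ini a v" using ini_eqt[OF Cons.prems, of a] by (simp add: ini_Cons)
    then obtain p q where v: "v = p @ a # q" and p: "\<forall>x\<in>set p. \<not> dep a x" by (rule ini_split)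
    have mv: "R (u @ a # p @ q) (u @ v)"
      unfolding v by (rule eqt_move_front[where R = R, OF refl trans swap p])
    have "eqt (a # p @ q) v"
      unfolding v using eqt_move_front'[OF p, of "[]" q] by simp
    then have "eqt (a # w) (a # p @ q)" using Cons.prems eqt_sym eqt_trans by blast
    then have "R ((u @ [a]) @ w) ((u @ [a]) @ p @ q)" by (intro Cons.IH) simp
    then show ?case using mv trans by simp
  qed
  from this[of "[]"] show ?thesis by simp
qed

lemma ini_append_cong: "(\<And>x. ini x v = ini x v') \<Longrightarrow> ini a (u @ v) = ini a (u @ v')"
  by (induction u) (auto simp: ini_Cons)

lemma nil_append_cong: "nil v = nil v' \<Longrightarrow> (\<And>x. ini x v = ini x v') \<Longrightarrow> nil (u @ v) = nil (u @ v')"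
proof (induction u)
  case (Cons c u)
  then show ?case using ini_append_cong[of v v' c u] by simp
qed simp

lemma nil_eqt: "eqt w v \<Longrightarrow> nil w = nil v"
proof (induction rule: eqt_induct)
  case (swap u v a b)
  show ?case
  proof (rule nil_append_cong)
    show "nil (a # b # v) = nil (b # a # v)"
      using swap dep_sym[of a b] by (auto simp: ini_Cons)
    show "ini x (a # b # v) = ini x (b # a # v)" for x
      using ini_eqt[OF eqt_swap[of a b "[]" v]] swap by simp
  qed
qed auto

lemma nil_appendI: "nil w \<Longrightarrow> nil (u @ w)"
  by (induction u) auto

lemma tau_swap: "a \<noteq> b \<Longrightarrow> tau a b = ss a b * tau b a"
  using to_nat_on_inj[OF countable_verts, of a b] odd_letter_verts
  by (auto simp: tau_def super_sign_def)

lemma inv_sign_swap: "a \<noteq> b \<Longrightarrow> inv_sign (u @ a # b # v) = ss a b * inv_sign (u @ b # a # v)"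
proof (induction u)
  case Nil
  then show ?case using tau_swap[of a b] by simp
next
  case (Cons c u)
  then show ?case by (simp add: mult_ac)
qed

lemma inv_sign_sq [simp]: "inv_sign w * inv_sign w = 1"
proof (induction w)
  case (Cons a w)
  have "(\<Prod>b\<leftarrow>w. tau a b) * (\<Prod>b\<leftarrow>w. tau a b) = 1"
    by (induction w) (auto simp: tau_def)
  then have "((\<Prod>b\<leftarrow>w. tau a b) * (\<Prod>b\<leftarrow>w. tau a b)) * (inv_sign w * inv_sign w) = 1" using Cons by simp
  then show ?case by (simp add: mult_ac)
qed simp

lemma inv_sign_nz [simp]: "inv_sign w \<noteq> 0"
  using inv_sign_sq[of w] by (metis mult_zero_left zero_neq_one)

lemma ss_sq [simp]: "ss a b * ss a b = 1" "ss a b * (ss a b * x) = x"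
  by (auto simp: super_sign_def)

section \<open>Signed normal forms and the ideal of relations\<close>

definition rep :: "'i list \<Rightarrow> 'i list" where
  "rep w = (SOME v. eqt w v)"

lemma eqt_rep: "eqt w (rep w)"
  unfolding rep_def by (rule someI[of _ w]) simp

text \<open>For equivalent words the predicates \<open>eqt w\<close> and \<open>eqt v\<close>
  coincide, so \<open>SOME\<close> picks the same word.\<close>

lemma rep_eqt: "eqt w v \<Longrightarrow> rep w = rep v"
proof -
  assume "eqt w v"
  then have "eqt w = eqt v" using eqt_sym eqt_trans by blast
  then show ?thesis by (simp add: rep_def)
qed

lemma rep_rep [simp]: "rep (rep w) = rep w"
  using rep_eqt[OF eqt_rep, of w] by simp

lemma mset_rep [simp]: "mset (rep w) = mset w"
  using eqt_mset[OF eqt_rep, of w] by simp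

lemma nil_rep [simp]: "nil (rep w) = nil w"
  using nil_eqt[OF eqt_rep, of w] by simp

text \<open>The class of a word in A, written in the basis of traces. The product of the two
  inversion signs is the Koszul sign of the rearrangement of w into \<open>rep w\<close>.\<close>

definition trace_vec :: "'i list \<Rightarrow> 'i list \<Rightarrow>\<^sub>0 complex" where
  "trace_vec w = (if nil w then 0 else single (rep w) (inv_sign w * inv_sign (rep w)))"

definition rho :: "('i list \<Rightarrow>\<^sub>0 complex) \<Rightarrow> 'i list \<Rightarrow>\<^sub>0 complex" where
  "rho = lin trace_vec"

definition K :: "('i list \<Rightarrow>\<^sub>0 complex) set" where
  "K = {x. rho x = 0}"

text \<open>Modulo \<open>J\<close>, the linear extension of \<open>g\<close> factors through the algebra of the marked graph.\<close>

definition compat :: "('b \<Rightarrow>\<^sub>0 complex) set \<Rightarrow> ('i list \<Rightarrow> 'b \<Rightarrow>\<^sub>0 complex) \<Rightarrow> bool" where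
  "compat J g \<longleftrightarrow>
     (\<forall>u v a b. \<not> dep a b \<longrightarrow> g (u @ a # b # v) - psc (ss a b) (g (u @ b # a # v)) \<in> J) \<and>
     (\<forall>u v a. a \<in> iso_verts G \<longrightarrow> g (u @ a # a # v) \<in> J)"

text \<open>Each swap changes \<open>inv_sign\<close> by exactly its Koszul sign, so modulo J the
  vector \<open>psc (inv_sign w) (g w)\<close> is constant on classes and the signs along a chain of
  swaps need no bookkeeping.\<close>

lemma compat_eqt:
  assumes J: "pm.subspace J" and g: "compat J g" and "eqt w v"
  shows "psc (inv_sign w) (g w) - psc (inv_sign v) (g v) \<in> J"
  using assms(3)
proof (induction rule: eqt_induct)
  case (trans u v w)
  then show ?case using pm.subspace_add[OF J trans.IH] by simp
next
  case (swap u v a b)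
  then have "g (u @ a # b # v) - psc (ss a b) (g (u @ b # a # v)) \<in> J"
    using g by (auto simp: compat_def)
  then have "psc (inv_sign (u @ a # b # v)) (g (u @ a # b # v) - psc (ss a b) (g (u @ b # a # v))) \<in> J"
    by (intro pm.subspace_scale[OF J])
  moreover have "inv_sign (u @ a # b # v) = ss a b * inv_sign (u @ b # a # v)"
    using swap by (intro inv_sign_swap) (auto simp: dep_def)
  ultimately show ?case by (simp add: pm.scale_right_diff_distrib mult_ac)
qed (simp add: pm.subspace_0[OF J])

text \<open>The repeated isotropic letter is commuted next to its copy, where \<open>compat\<close>
  applies; the sign of the rearrangement squares to 1 and is removed by multiplying with it again.
  The prefix u absorbs the head letter in the induction.\<close>

lemma compat_nil:
  assumes J: "pm.subspace J" and g: "compat J g" and "nil w"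
  shows "g (u @ w) \<in> J"
  using assms(3)
proof (induction w arbitrary: u)
  case (Cons a w)
  show ?case
  proof (cases "nil w")
    case True
    then show ?thesis using Cons.IH[of "u @ [a]"] by simp
  next
    case False
    then have a: "a \<in> iso_verts G" "ini a w" using Cons.prems by auto
    obtain p q where w: "w = p @ a # q" and p: "\<forall>x\<in>set p. \<not> dep a x" using a(2) by (rule ini_split)
    have "eqt (a # p @ q) w"
      unfolding w using eqt_move_front'[OF p, of "[]" q] by simp
    then have "eqt (u @ a # w) (u @ a # a # p @ q)" by (intro eqt_append) (simp_all add: eqt_sym)
    then have "psc (inv_sign (u @ a # w)) (g (u @ a # w)) - psc (inv_sign (u @ a # a # p @ q)) (g (u @ a # a # p @ q)) \<in> J"
      by (rule compat_eqt[OF J g])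
    moreover have "psc (inv_sign (u @ a # a # p @ q)) (g (u @ a # a # p @ q)) \<in> J"
      using g a by (intro pm.subspace_scale[OF J]) (auto simp: compat_def)
    ultimately have "psc (inv_sign (u @ a # w)) (g (u @ a # w)) \<in> J"
      using pm.subspace_add[OF J] by fastforce
    then have "psc (inv_sign (u @ a # w)) (psc (inv_sign (u @ a # w)) (g (u @ a # w))) \<in> J"
      by (rule pm.subspace_scale[OF J])
    then show ?thesis by (simp only: pm.scale_scale inv_sign_sq pm.scale_one)
  qed
qed simp

lemma compat_trace_vec:
  assumes J: "pm.subspace J" and g: "compat J g"
  shows "g w - lin g (trace_vec w) \<in> J"
proof (cases "nil w")
  case True
  then show ?thesis using compat_nil[OF J g True, of "[]"] by (simp add: trace_vec_def)
next
  case False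
  have "psc (inv_sign w) (psc (inv_sign w) (g w) - psc (inv_sign (rep w)) (g (rep w))) \<in> J"
    by (intro pm.subspace_scale[OF J] compat_eqt[OF J g] eqt_rep)
  then show ?thesis using False by (simp add: trace_vec_def pm.scale_right_diff_distrib)
qed

lemma compat_rho:
  assumes J: "pm.subspace J" and g: "compat J g"
  shows "lin g x - lin g (rho x) \<in> J"
proof -
  have "lin g x - lin g (rho x) = lin (\<lambda>w. g w - lin g (trace_vec w)) x"
    by (simp add: rho_def lin_fun_minus lin_lin)
  then show ?thesis using compat_trace_vec[OF J g] by (auto intro: subspace_lin[OF J])
qed

text \<open>Universal property of A: a linear map respects all relations once it respects swaps and
  isotropic squares. It yields the ideal property of \<open>K\<close>, the parity automorphism, the
  contraction and the bracketing.\<close>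

lemma compat_K:
  assumes "pm.subspace J" "compat J g" "x \<in> K"
  shows "lin g x \<in> J"
  using compat_rho[OF assms(1,2), of x] assms(3) by (simp add: K_def)

lemma trace_vec_swap: "\<not> dep a b \<Longrightarrow> trace_vec (u @ a # b # v) = psc (ss a b) (trace_vec (u @ b # a # v))"
proof -
  assume d: "\<not> dep a b"
  then have "a \<noteq> b" by auto
  then show ?thesis
    using nil_eqt[OF eqt_swap[OF d]] rep_eqt[OF eqt_swap[OF d]] inv_sign_swap[of a b u v]
    by (simp add: trace_vec_def mult_ac)
qed

lemma trace_vec_square: "a \<in> iso_verts G \<Longrightarrow> trace_vec (u @ a # a # v) = 0"
  using nil_appendI[of "a # a # v" u] by (simp add: trace_vec_def ini_Cons)

lemma trace_vec_compat: "compat {0} (\<lambda>w. trace_vec (u @ w @ v))"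
  using trace_vec_swap[of _ _ "u @ _" "_ @ v"] trace_vec_square[of _ "u @ _" "_ @ v"] by (simp add: compat_def)

lemma rho_add: "rho (x + y) = rho x + rho y"
  and rho_psc: "rho (psc c x) = psc c (rho x)"
  and rho_minus: "rho (x - y) = rho x - rho y"
  and rho_0 [simp]: "rho 0 = 0"
  and rho_sum: "rho (sum f S) = (\<Sum>s\<in>S. rho (f s))"
  and rho_single: "rho (single w c) = psc c (trace_vec w)"
  by (simp_all add: rho_def lin_add lin_psc lin_minus lin_sum)

lemma subspace_K: "pm.subspace K"
  by (auto simp: K_def pm.subspace_def rho_add rho_psc)

lemmas K_0 = pm.subspace_0[OF subspace_K]
lemmas K_add = pm.subspace_add[OF subspace_K]
lemmas K_diff = pm.subspace_diff[OF subspace_K]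
lemmas K_scale = pm.subspace_scale[OF subspace_K]
lemmas K_sum = pm.subspace_sum[OF subspace_K]

text \<open>Swaps and isotropic squares remain such inside any context u _ v, which is what
  \<open>trace_vec_compat\<close> records.\<close>

lemma K_mult_word:
  assumes "x \<in> K" shows "single u 1 * x * single v 1 \<in> K"
proof -
  have "rho (single u 1 * x * single v 1) = lin (\<lambda>w. trace_vec (u @ w @ v)) x"
    by (rule linear_eqI[where F = "\<lambda>x. rho (single u 1 * x * single v 1)"
          and G = "lin (\<lambda>w. trace_vec (u @ w @ v))"])
      (simp_all add: rho_add rho_psc rho_single lin_add lin_psc distrib_left distrib_right
         psc_mult_left psc_mult_right mult_single_list)
  also have "\<dots> = 0"
    using compat_K[OF _ trace_vec_compat assms, of u v] by simp
  finally show ?thesis by (simp add: K_def)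
qed

lemma mult_decompose_left:
  "x * y = lin (\<lambda>w. single w 1 * y) (x :: 'i list \<Rightarrow>\<^sub>0 complex)"
  by (rule linear_eq_lin[of "\<lambda>x. x * y"]) (simp_all add: distrib_right psc_mult_left)

lemma mult_decompose_right:
  "y * x = lin (\<lambda>w. y * single w 1) (x :: 'i list \<Rightarrow>\<^sub>0 complex)"
  by (rule linear_eq_lin[of "\<lambda>x. y * x"]) (simp_all add: distrib_left psc_mult_right)

lemma K_mult_left: "x \<in> K \<Longrightarrow> y * x \<in> K"
  and K_mult_right: "x \<in> K \<Longrightarrow> x * y \<in> K"
proof -
  assume x: "x \<in> K"
  have "single w 1 * x \<in> K" for w
    using K_mult_word[OF x, of w "[]"] by (simp only: single_Nil_one mult_1_right)
  then have "lin (\<lambda>w. single w 1 * x) y \<in> K"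
    by (rule subspace_lin[OF subspace_K])
  then show "y * x \<in> K" by (simp only: mult_decompose_left[symmetric])
  have "x * single w 1 \<in> K" for w
    using K_mult_word[OF x, of "[]" w] by (simp only: single_Nil_one mult_1_left)
  then have "lin (\<lambda>w. x * single w 1) y \<in> K"
    by (rule subspace_lin[OF subspace_K])
  then show "x * y \<in> K" by (simp only: mult_decompose_right[symmetric])
qed

lemma rho_rho [simp]: "rho (rho x) = rho x"
proof -
  have "rho (trace_vec w) = trace_vec w" for w
    by (simp add: trace_vec_def rho_single)
  then show ?thesis by (simp add: rho_def lin_lin)
qed

section \<open>Lie words\<close>

abbreviation odd_word :: "'i magma \<Rightarrow> bool" where "odd_word \<equiv> word_odd (odd_verts G)"

primrec lie :: "'i magma \<Rightarrow> 'i list \<Rightarrow>\<^sub>0 complex" where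
  "lie (Gen i) = single [i] 1"
| "lie (Br s t) = lie s * lie t - psc (super_sign (odd_word s) (odd_word t)) (lie t * lie s)"

primrec mdeg :: "'i magma \<Rightarrow> 'i multiset" where
  "mdeg (Gen i) = {#i#}"
| "mdeg (Br s t) = mdeg s + mdeg t"

definition homog :: "'i multiset \<Rightarrow> ('i list \<Rightarrow>\<^sub>0 complex) set" where
  "homog n = {x. \<forall>w\<in>keys x. mset w = n}"

lemma subspace_homog: "pm.subspace (homog n)"
  unfolding homog_def by (rule subspace_keys)

lemma homog_mult: "x \<in> homog n \<Longrightarrow> y \<in> homog k \<Longrightarrow> x * y \<in> homog (n + k)"
  using keys_mult[of x y] by (force simp: homog_def plus_list_def)

lemma homog_single: "mset w = n \<Longrightarrow> single w c \<in> homog n"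
  by (simp add: homog_def)

lemma homog_lie: "lie t \<in> homog (mdeg t)"
proof (induction t)
  case (Br s t)
  then show ?case
    using homog_mult[of "lie s" "mdeg s" "lie t" "mdeg t"] homog_mult[of "lie t" "mdeg t" "lie s" "mdeg s"]
    by (auto intro!: pm.subspace_diff[OF subspace_homog] pm.subspace_scale[OF subspace_homog] simp: add.commute)
qed (simp add: homog_def)

lemma rho_homog: "x \<in> homog n \<Longrightarrow> rho x \<in> homog n"
  unfolding rho_def
  by (rule subspace_lin[OF subspace_homog])
    (auto simp: trace_vec_def homog_def)

lemma mdeg_nonempty [simp]: "mdeg t \<noteq> {#}"
  by (induction t) auto

lemma odd_word_mdeg: "odd_word t \<longleftrightarrow> odd (size (filter_mset odd_letter (mdeg t)))"
  by (induction t) auto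

section \<open>Parity automorphism\<close>

definition psgn :: "bool \<Rightarrow> 'i multiset \<Rightarrow> complex" where
  "psgn p n = (if p \<and> odd (size (filter_mset odd_letter n)) then -1 else 1)"

text \<open>For p = True the grading automorphism, for p = False the identity. The index lets one
  formula express the Koszul sign of moving an element of parity p past x.\<close>

definition paut :: "bool \<Rightarrow> ('i list \<Rightarrow>\<^sub>0 complex) \<Rightarrow> 'i list \<Rightarrow>\<^sub>0 complex" where
  "paut p = lin (\<lambda>w. single w (psgn p (mset w)))"

lemma psgn_add: "psgn p (n + k) = psgn p n * psgn p k"
  by (auto simp: psgn_def)

lemma paut_add: "paut p (x + y) = paut p x + paut p y"
  and paut_psc: "paut p (psc c x) = psc c (paut p x)"
  and paut_minus: "paut p (x - y) = paut p x - paut p y"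
  and paut_0 [simp]: "paut p 0 = 0"
  and paut_single: "paut p (single w c) = single w (c * psgn p (mset w))"
  by (simp_all add: paut_def lin_add lin_psc lin_minus)

lemma paut_homog: "x \<in> homog n \<Longrightarrow> paut p x = psc (psgn p n) x"
proof -
  assume "x \<in> homog n"
  then have "paut p x = lin (\<lambda>w. psc (psgn p n) (single w 1)) x"
    unfolding paut_def by (intro lin_cong) (auto simp: homog_def)
  also have "\<dots> = psc (psgn p n) x"
    by (simp only: lin_fun_psc lin_id)
  finally show ?thesis .
qed

lemma paut_mult: "paut p (x * y) = paut p x * paut p y"
proof -
  have 1: "paut p (single w 1 * y) = paut p (single w 1) * paut p y" for w y
    by (rule linear_eqI[where F = "\<lambda>y. paut p (single w 1 * y)"
          and G = "\<lambda>y. paut p (single w 1) * paut p y"])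
      (simp_all add: paut_add paut_psc distrib_left psc_mult_right paut_single mult_single_list psgn_add)
  show ?thesis
    by (rule linear_eqI[where F = "\<lambda>x. paut p (x * y)" and G = "\<lambda>x. paut p x * paut p y"])
      (simp_all add: paut_add paut_psc distrib_right psc_mult_left 1)
qed

lemma paut_False [simp]: "paut False x = x"
  by (simp add: paut_def psgn_def lin_id)

lemma paut_paut: "paut p (paut q x) = paut (p \<noteq> q) x"
  by (rule linear_eqI[where F = "\<lambda>x. paut p (paut q x)" and G = "\<lambda>x. paut (p \<noteq> q) x"])
    (auto simp: paut_add paut_psc paut_single psgn_def)

lemma paut_lie_mult: "paut p (lie t * z) = psc (super_sign p (odd_word t)) (lie t * paut p z)"
  by (simp add: paut_mult paut_homog[OF homog_lie] psc_mult_left psgn_def super_sign_def odd_word_mdeg)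

lemma compat_single: "compat K (\<lambda>w. single w 1)"
  unfolding compat_def K_def mem_Collect_eq rho_minus rho_psc rho_single by (simp add: trace_vec_swap trace_vec_square)

text \<open>The relations preserve the content of a word, and \<open>psgn\<close> depends on the
  content only.\<close>

lemma paut_K: "x \<in> K \<Longrightarrow> paut p x \<in> K"
proof -
  have ms: "mset (u @ a # b # v) = mset (u @ b # a # v)" for u v :: "'i list" and a b by simp
  have "compat K (\<lambda>w. psc (psgn p (mset w)) (single w 1))"
    unfolding compat_def
  proof (intro conjI allI impI)
    fix u v a b assume "\<not> dep a b"
    then have "psc (psgn p (mset (u @ a # b # v)))
      (single (u @ a # b # v) 1 - psc (ss a b) (single (u @ b # a # v) 1)) \<in> K"
      using compat_single by (intro K_scale) (simp add: compat_def)
    then show "psc (psgn p (mset (u @ a # b # v))) (single (u @ a # b # v) 1) -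
       psc (ss a b) (psc (psgn p (mset (u @ b # a # v))) (single (u @ b # a # v) 1)) \<in> K"
      unfolding ms[of u a b v] by (simp add: pm.scale_right_diff_distrib mult_ac)
  next
    fix u v a assume "a \<in> iso_verts G"
    then show "psc (psgn p (mset (u @ a # a # v))) (single (u @ a # a # v) 1) \<in> K"
      using compat_single by (intro K_scale) (simp add: compat_def)
  qed
  moreover assume "x \<in> K"
  ultimately show ?thesis
    using compat_K[OF subspace_K] by (fastforce simp: paut_def)
qed

section \<open>Contraction of the coproduct\<close>

text \<open>A functional is encoded as \<open>lin\<close> into the one-dimensional space over
  \<open>unit\<close>, so that its linearity is inherited.\<close>

definition form :: "('a \<Rightarrow> complex) \<Rightarrow> ('a \<Rightarrow>\<^sub>0 complex) \<Rightarrow> complex" where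
  "form f x = lookup (lin (\<lambda>w. single () (f w)) x) ()"

text \<open>The translated functional y \<mapsto> f (x y), given by its values on words; it remains
  after f has absorbed x from the right tensor factor.\<close>

definition shift :: "('i list \<Rightarrow>\<^sub>0 complex) \<Rightarrow> ('i list \<Rightarrow> complex) \<Rightarrow> 'i list \<Rightarrow> complex" where
  "shift x f v = form f (x * single v 1)"

text \<open>\<open>contract_word w f\<close> is \<open>(id \<otimes> f) (\<Delta> w)\<close>, where \<open>\<Delta>\<close> is the superalgebra map making all letters primitive.\<close>

primrec contract_word :: "'i list \<Rightarrow> ('i list \<Rightarrow> complex) \<Rightarrow> 'i list \<Rightarrow>\<^sub>0 complex" where
  "contract_word [] f = single [] (f [])"
| "contract_word (a # w) f = single [a] 1 * contract_word w f + paut (odd_letter a) (contract_word w (\<lambda>v. f (a # v)))"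

definition contract :: "('i list \<Rightarrow> complex) \<Rightarrow> ('i list \<Rightarrow>\<^sub>0 complex) \<Rightarrow> 'i list \<Rightarrow>\<^sub>0 complex" where
  "contract f = lin (\<lambda>w. contract_word w f)"

lemma form_add: "form f (x + y) = form f x + form f y"
  and form_psc: "form f (psc c x) = c * form f x"
  and form_minus: "form f (x - y) = form f x - form f y"
  and form_0 [simp]: "form f 0 = 0"
  and form_single: "form f (single w c) = c * f w"
  by (simp_all add: form_def lin_add lin_psc lin_minus lookup_add lookup_minus)

lemma form_cong: "(\<And>w. w \<in> keys x \<Longrightarrow> f w = g w) \<Longrightarrow> form f x = form g x"
  by (simp add: form_def cong: lin_cong)

lemma form_eqI:
  assumes "\<And>x y. F (x + y) = F x + F y" "\<And>c x. F (psc c x) = c * F x"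
    and "\<And>k. f k = F (single k 1)"
  shows "form f x = F x"
proof -
  let ?e = "\<lambda>c. single () c :: unit \<Rightarrow>\<^sub>0 complex"
  have "lin (\<lambda>w. ?e (f w)) x = ?e (F x)"
    by (rule linear_eqI[where F = "lin (\<lambda>w. ?e (f w))" and G = "\<lambda>x. ?e (F x)"])
      (simp_all add: lin_add lin_psc assms single_add)
  then show ?thesis by (simp add: form_def)
qed

lemma form_shift: "form (shift x f) y = form f (x * y)"
  by (rule form_eqI) (simp_all add: distrib_left psc_mult_right form_add form_psc shift_def)

lemma shift_shift: "shift y (shift x f) = shift (x * y) f"
  by (rule ext) (simp add: shift_def[of y] form_shift, simp add: shift_def mult.assoc)

lemma contract_word_fun_minus: "contract_word w (\<lambda>v. f v - c * g v) = contract_word w f - psc c (contract_word w g)"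
proof (induction w arbitrary: f g)
  case (Cons a w)
  show ?case
    by (simp add: Cons paut_minus paut_psc algebra_simps psc_mult_right pm.scale_right_distrib)
qed (simp add: single_diff)

lemma contract_fun_minus: "contract (\<lambda>v. f v - c * g v) x = contract f x - psc c (contract g x)"
  by (simp add: contract_def contract_word_fun_minus lin_fun_minus lin_fun_psc)

lemma contract_add: "contract f (x + y) = contract f x + contract f y"
  and contract_psc: "contract f (psc c x) = psc c (contract f x)"
  and contract_minus: "contract f (x - y) = contract f x - contract f y"
  and contract_single: "contract f (single w c) = psc c (contract_word w f)"
  by (simp_all add: contract_def lin_add lin_psc lin_minus)

lemma shift_single: "shift (single u 1) f = (\<lambda>v. f (u @ v))"
  by (rule ext) (simp add: shift_def mult_single_list form_single)

lemma shift_minus: "shift (x - psc c y) f = (\<lambda>v. shift x f v - c * shift y f v)"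
  by (rule ext) (simp add: shift_def algebra_simps form_minus form_psc psc_mult_left)

text \<open>Lie words are primitive.\<close>

lemma contract_lie_mult: "contract f (lie t * y) = lie t * contract f y + paut (odd_word t) (contract (shift (lie t) f) y)"
proof (induction t arbitrary: f y)
  case (Gen a)
  show ?case
    by (rule linear_eqI[where F = "\<lambda>y. contract f (lie (Gen a) * y)"
          and G = "\<lambda>y. lie (Gen a) * contract f y + paut (odd_word (Gen a)) (contract (shift (lie (Gen a)) f) y)"])
      (simp_all add: distrib_left contract_add contract_psc psc_mult_right paut_add paut_psc pm.scale_right_distrib
        mult_single_list contract_single shift_single)
next
  case (Br s t)
  let ?x = "lie s" and ?x' = "lie t" and ?P = "odd_word s" and ?P' = "odd_word t"
  let ?c = "super_sign ?P ?P'"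
  have c: "super_sign ?P' ?P = ?c" "?c * ?c = 1" by (auto simp: super_sign_def)
  \<comment> \<open>Besides the terms with both factors kept or both absorbed there are two mixed
    terms. They occur in both orders of the factors, with signs that cancel in the
    supercommutator.\<close>
  have 1: "contract f (?x * (?x' * y)) = ?x * ?x' * contract f y + ?x * paut ?P' (contract (shift ?x' f) y)
      + psc ?c (?x' * paut ?P (contract (shift ?x f) y)) + paut (?P \<noteq> ?P') (contract (shift (?x * ?x') f) y)"
    by (simp add: Br.IH paut_add paut_lie_mult paut_paut shift_shift distrib_left mult.assoc)
  have 2: "contract f (?x' * (?x * y)) = ?x' * ?x * contract f y + ?x' * paut ?P (contract (shift ?x f) y)
      + psc ?c (?x * paut ?P' (contract (shift ?x' f) y)) + paut (?P \<noteq> ?P') (contract (shift (?x' * ?x) f) y)"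
    by (cases "odd_word s"; cases "odd_word t")
      (simp_all add: Br.IH paut_add paut_lie_mult paut_paut shift_shift distrib_left mult.assoc super_sign_def)
  have 3: "paut (?P \<noteq> ?P') (contract (shift (lie (Br s t)) f) y)
     = paut (?P \<noteq> ?P') (contract (shift (?x * ?x') f) y) - psc ?c (paut (?P \<noteq> ?P') (contract (shift (?x' * ?x) f) y))"
    by (simp add: shift_minus contract_fun_minus paut_minus paut_psc)
  have "contract f (lie (Br s t) * y) = contract f (?x * (?x' * y)) - psc ?c (contract f (?x' * (?x * y)))"
    by (simp add: left_diff_distrib contract_minus contract_psc psc_mult_left mult.assoc)
  then show ?case
    unfolding 1 2 using 3 c
    by (simp add: pm.scale_right_distrib left_diff_distrib psc_mult_left)
qed

text \<open>These are the functionals on words that descend to A.\<close>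

definition adm :: "('i list \<Rightarrow> complex) \<Rightarrow> bool" where
  "adm f \<longleftrightarrow>
     (\<forall>u v a b. \<not> dep a b \<longrightarrow> f (u @ a # b # v) = ss a b * f (u @ b # a # v)) \<and>
     (\<forall>u v a. a \<in> iso_verts G \<longrightarrow> f (u @ a # a # v) = 0)"

lemma adm_Cons: "adm f \<Longrightarrow> adm (\<lambda>v. f (a # v))"
  unfolding adm_def by (metis append_Cons)

lemma contract_word_psc: "contract_word w (\<lambda>v. c * f v) = psc c (contract_word w f)"
  by (induction w arbitrary: f) (simp_all add: psc_mult_right paut_psc pm.scale_right_distrib)

lemma contract_word_zero [simp]: "contract_word w (\<lambda>v. 0) = 0"
  using contract_word_psc[of w 0 "\<lambda>v. 0"] by simp

lemma contract_word_uminus: "contract_word w (\<lambda>v. - f v) = - contract_word w f"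
  using contract_word_psc[of w "-1" f] by simp

lemma letters_in_K:
  shows "\<not> dep a b \<Longrightarrow> single [a, b] 1 - psc (ss a b) (single [b, a] 1) \<in> K"
    and "a \<in> iso_verts G \<Longrightarrow> single [a, a] 1 \<in> K"
  using compat_single unfolding compat_def by (metis append_Nil)+

text \<open>The relators are primitive: in the supercommutator of two letters the mixed terms
  cancel, and in the square of an isotropic letter they cancel because that letter is odd. The terms
  in which f absorbs both letters vanish by \<open>adm\<close>, leaving the relator times a
  remainder.\<close>

lemma contract_word_compat: "adm f \<Longrightarrow> compat K (\<lambda>w. contract_word w f)"
proof -
  have al1: "paut p (single [b] 1 * z) = psc (super_sign p (odd_letter b)) (single [b] 1 * paut p z)" for p b z
    using paut_lie_mult[of p "Gen b" z] by simp
  have step: "single [c] 1 * (contract_word w f - psc k (contract_word w' f)) + paut (odd_letter c) (contract_word w (\<lambda>v. f (c # v)) - psc k (contract_word w' (\<lambda>v. f (c # v))))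
     = contract_word (c # w) f - psc k (contract_word (c # w') f)" for c w w' f k
    by (simp add: right_diff_distrib paut_minus paut_psc psc_mult_right pm.scale_right_distrib)
  have swap: "contract_word (u @ a # b # v) f - psc (ss a b) (contract_word (u @ b # a # v) f) \<in> K"
    if "adm f" "\<not> dep a b" for u v a b f
    using that(1)
  proof (induction u arbitrary: f)
    case Nil
    have f: "f (a # b # v) = ss a b * f (b # a # v)" for v
      using Nil that(2) unfolding adm_def by (metis append_Nil)
    have "contract_word (a # b # v) f - psc (ss a b) (contract_word (b # a # v) f)
      = (single [a, b] 1 - psc (ss a b) (single [b, a] 1)) * contract_word v f"
      by (cases "odd_letter a"; cases "odd_letter b")
        (simp_all add: f paut_add al1 paut_paut contract_word_psc paut_psc distrib_left mult.assoc[symmetric] mult_single_list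
          left_diff_distrib psc_mult_left pm.scale_right_distrib super_sign_def contract_word_uminus single_uminus distrib_right)
    then show ?case using K_mult_right[OF letters_in_K(1)[OF that(2)]] by simp
  next
    case (Cons c u)
    show ?case
      unfolding append_Cons step[symmetric]
      by (intro K_add K_mult_left paut_K Cons.IH Cons.prems adm_Cons)
  qed
  have sq: "contract_word (u @ a # a # v) f \<in> K" if "adm f" "a \<in> iso_verts G" for u v a f
    using that(1)
  proof (induction u arbitrary: f)
    case Nil
    have f: "f (a # a # v) = 0" for v
      using Nil that(2) unfolding adm_def by (metis append_Nil)
    have "contract_word (a # a # v) f = single [a, a] 1 * contract_word v f"
      using iso_odd[OF that(2)]
      by (simp add: f paut_add al1 paut_paut distrib_left mult.assoc[symmetric] mult_single_list super_sign_def)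
    then show ?case using K_mult_right[OF letters_in_K(2)[OF that(2)]] by simp
  next
    case (Cons c u)
    show ?case
      unfolding append_Cons contract_word.simps
      by (intro K_add K_mult_left paut_K Cons.IH Cons.prems adm_Cons)
  qed
  assume "adm f"
  then show ?thesis using swap sq by (simp add: compat_def)
qed

lemma contract_K: "adm f \<Longrightarrow> x \<in> K \<Longrightarrow> contract f x \<in> K"
  unfolding contract_def by (rule compat_K[OF subspace_K contract_word_compat])

lemma contract_counit: "contract (\<lambda>v. if v = [] then c else 0) x = psc c x"
proof -
  have "contract_word w (\<lambda>v. if v = [] then c else 0) = single w c" for w
    by (induction w) (simp_all add: mult_single_list)
  then show ?thesis
    using lin_fun_psc[of c "\<lambda>w. single w 1" x] by (simp add: contract_def lin_id)
qed

section \<open>Ordered monomials in Lie words\<close>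

fun mon :: "'i magma list \<Rightarrow> nat list \<Rightarrow> 'i list \<Rightarrow>\<^sub>0 complex" where
  "mon (t # ts) (k # ks) = lie t ^ k * mon ts ks"
| "mon _ _ = 1"

primrec exps :: "'i magma list \<Rightarrow> nat list set" where
  "exps [] = {[]}"
| "exps (t # ts) = {k # ks | k ks. ks \<in> exps ts \<and> (odd_word t \<longrightarrow> k \<le> 1)}"

fun degs :: "'i magma list \<Rightarrow> nat list \<Rightarrow> 'i multiset" where
  "degs (t # ts) (k # ks) = repeat_mset k (mdeg t) + degs ts ks"
| "degs _ _ = {#}"

text \<open>Models the partial derivative by the Lie word t, with the words in S as constants.
  Contracting the right tensor factor places the Koszul sign on y, through \<open>paut\<close>, and
  not on the Lie words in front.\<close>

definition derivation_like :: "'i magma \<Rightarrow> 'i magma set \<Rightarrow> (('i list \<Rightarrow>\<^sub>0 complex) \<Rightarrow> 'i list \<Rightarrow>\<^sub>0 complex) \<Rightarrow> bool" where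
  "derivation_like t S D \<longleftrightarrow>
     (\<forall>x y. D (x + y) = D x + D y) \<and> (\<forall>c x. D (psc c x) = psc c (D x)) \<and>
     (\<forall>x\<in>K. D x \<in> K) \<and> D 1 = 0 \<and>
     (\<forall>y. D (lie t * y) = lie t * D y + paut (odd_word t) y) \<and>
     (\<forall>s\<in>S. \<forall>y. D (lie s * y) = lie s * D y)"

primrec separated :: "'i magma list \<Rightarrow> bool" where
  "separated [] \<longleftrightarrow> True"
| "separated (t # ts) \<longleftrightarrow> separated ts \<and> (\<exists>D. derivation_like t (set ts) D)"

text \<open>Differentiation lowers every exponent by one, and the coefficients are constants for D.
  Induction on d gives all coefficients but the constant one, which is then isolated by subtraction;
  dividing by \<open>Suc k\<close> uses characteristic zero.\<close>

lemma power_independent: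
  fixes D :: "('i list \<Rightarrow>\<^sub>0 complex) \<Rightarrow> 'i list \<Rightarrow>\<^sub>0 complex"
  assumes add: "\<And>x y. D (x + y) = D x + D y" and sc: "\<And>c x. D (psc c x) = psc c (D x)"
    and DK: "\<And>x. x \<in> K \<Longrightarrow> D x \<in> K" and Dx: "\<And>y. D (x * y) = x * D y + y"
    and "\<And>k. k \<le> d \<Longrightarrow> D (b k) = 0" and "(\<Sum>k\<le>d. x ^ k * b k) \<in> K"
  shows "k \<le> d \<Longrightarrow> b k \<in> K"
  using assms(5,6)
proof (induction d arbitrary: b k)
  case 0
  then show ?case by simp
next
  case (Suc d)
  have D0: "D 0 = 0" using sc[of 0 0] by simp
  have Dsum: "D (sum f S) = (\<Sum>s\<in>S. D (f s))" for f and S :: "nat set"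
    by (induction S rule: infinite_finite_induct) (simp_all add: D0 add)
  have Dpow: "D (x ^ Suc n * c) = psc (of_nat (Suc n)) (x ^ n * c)" if "D c = 0" for n c
  proof (induction n)
    case 0
    then show ?case using that by (simp add: Dx)
  next
    case (Suc n)
    have "D (x ^ Suc (Suc n) * c) = x * D (x ^ Suc n * c) + x ^ Suc n * c"
      using Dx[of "x ^ Suc n * c"] by (simp add: mult.assoc)
    also have "\<dots> = psc (of_nat (Suc n)) (x ^ Suc n * c) + psc 1 (x ^ Suc n * c)"
      unfolding Suc by (simp add: psc_mult_right mult.assoc)
    also have "\<dots> = psc (of_nat (Suc (Suc n))) (x ^ Suc n * c)"
      by (simp only: pm.scale_left_distrib[symmetric] of_nat_Suc add.commute)
    finally show ?case .
  qed
  define b' where "b' k = psc (of_nat (Suc k)) (b (Suc k))" for k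
  have "D (\<Sum>k\<le>Suc d. x ^ k * b k) = (\<Sum>k\<le>d. x ^ k * b' k)"
  proof -
    have "D (x ^ Suc k * b (Suc k)) = x ^ k * b' k" if "k \<le> d" for k
      using Dpow[of "b (Suc k)" k] Suc.prems(2)[of "Suc k"] that by (simp only: b'_def psc_mult_right Suc_le_mono)
    moreover have "D (x ^ 0 * b 0) = 0" using Suc.prems(2)[of 0] by simp
    ultimately show ?thesis unfolding sum.atMost_Suc_shift Dsum add by (simp del: power_Suc)
  qed
  then have s': "(\<Sum>k\<le>d. x ^ k * b' k) \<in> K" using DK[OF Suc.prems(3)] by simp
  have "b' k \<in> K" if "k \<le> d" for k
    by (rule Suc.IH[OF that _ s']) (use Suc.prems(2) in \<open>simp add: b'_def sc\<close>)
  then have "psc (1 / of_nat (Suc k)) (b' k) \<in> K" if "k \<le> d" for k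
    using that K_scale by blast
  then have bS: "b (Suc k) \<in> K" if "k \<le> d" for k
    using that by (simp add: b'_def del: of_nat_Suc)
  have "(\<Sum>k\<le>d. x ^ Suc k * b (Suc k)) \<in> K"
    by (intro K_sum K_mult_left bS) simp
  then have "b 0 \<in> K"
    using K_diff[OF Suc.prems(3)] unfolding sum.atMost_Suc_shift by fastforce
  then show ?case using bS Suc.prems(1) by (cases k) auto
qed

lemma one_notin_K: "1 \<notin> K"
proof -
  have "lookup (rho 1) (rep []) \<noteq> 0"
    using rho_single[of "[]" 1] by (simp add: trace_vec_def single_Nil_one)
  then show ?thesis by (auto simp: K_def)
qed

lemma separated_mon:
  assumes "\<And>x y. D (x + y) = D x + D y" "\<And>s y. s \<in> set ts \<Longrightarrow> D (lie s * y) = lie s * D y" "D 1 = 0"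
  shows "D (mon ts ks) = 0"
  using assms(2)
proof (induction ts ks rule: mon.induct)
  case (1 t ts k ks)
  have "D (mon ts ks) = 0" using 1 by simp
  moreover have "D (lie t ^ k * y) = lie t ^ k * D y" for y
    by (induction k arbitrary: y) (use 1 in \<open>simp_all add: mult.assoc\<close>)
  ultimately show ?case by simp
qed (simp_all add: assms(3))

text \<open>The relation is read as a polynomial in the first Lie word whose coefficients are
  combinations of monomials in the later ones. The derivation of the first word kills these
  coefficients, so each of them lies in \<open>K\<close> separately.\<close>

lemma mon_independent:
  assumes "separated ts" "finite F" "F \<subseteq> exps ts" "(\<Sum>ks\<in>F. psc (c ks) (mon ts ks)) \<in> K" "ks \<in> F"
  shows "c ks = 0"
  using assms
proof (induction ts arbitrary: F c ks)
  case Nil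
  then have "F = {[]}" "ks = []" by auto
  then have "psc (c ks) 1 \<in> K" using Nil by simp
  show ?case
  proof (rule ccontr)
    assume "c ks \<noteq> 0"
    moreover have "psc (1 / c ks) (psc (c ks) 1) \<in> K"
      by (rule K_scale[OF \<open>psc (c ks) 1 \<in> K\<close>])
    ultimately show False using one_notin_K by simp
  qed
next
  case (Cons t ts)
  then obtain D where D: "derivation_like t (set ts) D" by auto
  define F' where "F' = tl ` F"
  define d where "d = Max (insert 0 (hd ` F))"
  \<comment> \<open>Extension by zero, so that F may be replaced by the full rectangle of head
    exponents up to d and tails in \<open>F'\<close>.\<close>
  define c' where "c' ks = (if ks \<in> F then c ks else 0)" for ks
  define b where "b k = (\<Sum>ks\<in>F'. psc (c' (k # ks)) (mon ts ks))" for k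
  have F': "finite F'" "F' \<subseteq> exps ts" using Cons.prems by (auto simp: F'_def)
  have d: "hd ks \<le> d" if "ks \<in> F" for ks unfolding d_def using Cons.prems(2) that by (intro Max_ge) auto
  have Fs: "F \<subseteq> (\<lambda>(k, ks). k # ks) ` ({..d} \<times> F')"
  proof
    fix ks assume ks: "ks \<in> F"
    then obtain k r where "ks = k # r" using Cons.prems(3) by auto
    then show "ks \<in> (\<lambda>(k, ks). k # ks) ` ({..d} \<times> F')" using d[OF ks] ks by (force simp: F'_def)
  qed
  have "(\<Sum>ks\<in>F. psc (c ks) (mon (t # ts) ks)) = (\<Sum>ks\<in>F. psc (c' ks) (mon (t # ts) ks))"
    by (simp add: c'_def)
  also have "\<dots> = (\<Sum>ks\<in>(\<lambda>(k, ks). k # ks) ` ({..d} \<times> F'). psc (c' ks) (mon (t # ts) ks))"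
    by (rule sum.mono_neutral_left) (use Fs F' in \<open>auto simp: c'_def\<close>)
  also have "\<dots> = (\<Sum>(k, ks)\<in>{..d} \<times> F'. psc (c' (k # ks)) (mon (t # ts) (k # ks)))"
    by (subst sum.reindex) (auto simp: inj_on_def case_prod_beta intro!: sum.cong)
  also have "\<dots> = (\<Sum>k\<le>d. lie t ^ k * b k)"
    by (simp add: sum.cartesian_product[symmetric] b_def sum_distrib_left psc_mult_right)
  finally have S: "(\<Sum>k\<le>d. lie t ^ k * b k) \<in> K" using Cons.prems(4) by simp
  have Dlin: "D (x + y) = D x + D y" "D (psc c x) = psc c (D x)" for x y c
    using D by (simp_all add: derivation_like_def)
  have DK: "D x \<in> K" if "x \<in> K" for x using D that by (simp add: derivation_like_def)
  have D0: "D 0 = 0" using Dlin(2)[of 0 0] by simp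
  have Dsum: "D (sum f S) = (\<Sum>s\<in>S. D (f s))" for f and S :: "nat list set"
    by (induction S rule: infinite_finite_induct) (simp_all add: D0 Dlin)
  have Dmon: "D (mon ts ks) = 0" for ks
    by (rule separated_mon) (use D in \<open>auto simp: derivation_like_def\<close>)
  have Db: "D (b k) = 0" for k
    unfolding b_def by (simp add: Dsum Dlin Dmon)
  have Dt: "D (lie t * y) = lie t * D y + paut (odd_word t) y" for y
    using D by (simp add: derivation_like_def)
  have bK: "b k \<in> K" if "k \<le> d" for k
  proof (cases "odd_word t")
    case False
    show ?thesis
      by (rule power_independent[OF Dlin DK _ Db S that]) (use Dt False in simp_all)
  next
    case True
    have d1: "d \<le> 1"
    proof -
      have "hd ks \<le> 1" if "ks \<in> F" for ks using Cons.prems(3) that True by auto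
      then show ?thesis unfolding d_def using Cons.prems(2) by simp
    qed
    consider "d = 0" | "d = 1" using d1 by linarith
    then show ?thesis
    proof cases
      case 1
      then show ?thesis using S that by simp
    next
      case 2
      then have "b 0 + lie t * b 1 \<in> K" using S by simp
      \<comment> \<open>For odd t the relation is linear in t and D returns
        \<open>paut True (b 1)\<close>; applying the involution again recovers
        \<open>b 1\<close>.\<close>
      then have "paut True (D (b 0 + lie t * b 1)) \<in> K" by (intro paut_K DK)
      then have b1: "b 1 \<in> K" using Db[of 0] Db[of 1] by (simp add: Dlin Dt True paut_paut)
      then have "b 0 \<in> K"
        using K_diff[OF \<open>b 0 + lie t * b 1 \<in> K\<close> K_mult_left[OF b1, of "lie t"]] by simp
      then show ?thesis using b1 that 2 by (cases k) auto
    qed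
  qed
  obtain k r where ks: "ks = k # r" using Cons.prems(3,5) by auto
  have "c' (k # r) = 0"
  proof (rule Cons.IH[of F' "\<lambda>r. c' (k # r)" r])
    show "separated ts" using Cons.prems by simp
    show "(\<Sum>r\<in>F'. psc (c' (k # r)) (mon ts r)) \<in> K"
      using bK[of k] d[OF Cons.prems(5)] ks by (simp add: b_def)
    show "r \<in> F'" using Cons.prems(5) ks by (force simp: F'_def)
  qed (use F' in auto)
  then show ?case using ks Cons.prems(5) by (simp add: c'_def)
qed

lemma form_homog_0: "x \<in> homog k \<Longrightarrow> k \<noteq> n \<Longrightarrow> form (\<lambda>v. if mset v = n then f v else 0) x = 0"
  by (subst form_cong[of _ _ "\<lambda>v. 0"]) (auto simp: homog_def form_def lin_def)

text \<open>The functional \<open>f\<close> lives in the degree of \<open>t\<close>, which is minimal among the degrees in \<open>S\<close>;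
  hence contraction with \<open>f\<close> sees no product of two Lie words.\<close>

lemma derivation_exists:
  assumes sz: "\<And>s. s \<in> S \<Longrightarrow> size (mdeg t) \<le> size (mdeg s)" and "t \<notin> S"
    and inj: "inj_on (\<lambda>s. rho (lie s)) {s \<in> insert t S. mdeg s = mdeg t}"
    and ind: "pm.independent ((\<lambda>s. rho (lie s)) ` {s \<in> insert t S. mdeg s = mdeg t})"
  shows "\<exists>D. derivation_like t S D"
proof -
  define n where "n = mdeg t"
  \<comment> \<open>A basis of the whole space, so that the coordinate at \<open>rho (lie t)\<close>
    is a functional: 1 on t and 0 on the other listed Lie words of the same degree.\<close>
  define B where "B = pm.extend_basis ((\<lambda>s. rho (lie s)) ` {s \<in> insert t S. mdeg s = mdeg t})"
  have B: "pm.independent B" "pm.span B = UNIV" "(\<lambda>s. rho (lie s)) ` {s \<in> insert t S. mdeg s = mdeg t} \<subseteq> B"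
    using pm.independent_extend_basis[OF ind] pm.span_extend_basis[OF ind] pm.extend_basis_superset[OF ind]
    by (auto simp: B_def)
  define l where "l x = pm.representation B x (rho (lie t))" for x
  have l_add: "l (x + y) = l x + l y" and l_psc: "l (psc c x) = c * l x" and l_0: "l 0 = 0" for x y c
    using B by (simp_all add: l_def pm.representation_add pm.representation_scale pm.representation_zero)
  have l_s: "l (rho (lie s)) = (if s = t then 1 else 0)" if "s \<in> insert t S" "mdeg s = mdeg t" for s
  proof -
    have "rho (lie s) \<in> B" using B(3) that by auto
    moreover have "rho (lie s) = rho (lie t) \<longleftrightarrow> s = t"
      using inj that by (auto simp: inj_on_def)
    ultimately show ?thesis using pm.representation_basis[OF B(1)] by (auto simp: l_def)
  qed
  define f where "f v = (if mset v = n then l (trace_vec v) else 0)" for v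
  have form_f: "form f x = l (rho x)" if "x \<in> homog n" for x
  proof -
    have "form f x = form (\<lambda>v. l (trace_vec v)) x"
      using that by (intro form_cong) (auto simp: f_def homog_def)
    also have "\<dots> = l (rho x)"
      by (rule form_eqI) (simp_all add: rho_add rho_psc rho_single l_add l_psc)
    finally show ?thesis .
  qed
  have "adm f"
    unfolding adm_def f_def by (auto simp: trace_vec_swap trace_vec_square l_psc l_0 add_mset_commute)
  \<comment> \<open>A nonzero value forces \<open>mdeg s + mset v = n\<close>. Since s is no shorter
    than t, v is empty, so the shifted functional is the counit for s = t and zero
    otherwise.\<close>
  have fs: "shift (lie s) f = (\<lambda>v. if v = [] then (if s = t then 1 else 0) else 0)" if s: "s \<in> insert t S" for s
  proof
    fix v
    have h: "lie s * single v 1 \<in> homog (mdeg s + mset v)"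
      by (intro homog_mult homog_lie homog_single refl)
    show "shift (lie s) f v = (if v = [] then (if s = t then 1 else 0) else 0)"
    proof (cases "mdeg s + mset v = n")
      case True
      then have "size (mdeg s) + length v = size (mdeg t)" unfolding n_def by (metis size_mset size_union)
      moreover have "size (mdeg t) \<le> size (mdeg s)" using sz[of s] s by (cases "s = t") auto
      ultimately have "length v = 0" by linarith
      then have v: "v = []" by simp
      then have "mdeg s = mdeg t" using True n_def by simp
      then show ?thesis using v l_s[OF s] form_f[of "lie s"] homog_lie[of s]
        by (simp add: shift_def single_Nil_one n_def)
    next
      case False
      then have "shift (lie s) f v = 0" using form_homog_0[OF h False, of "\<lambda>v. l (trace_vec v)"] by (simp only: shift_def f_def[abs_def])
      moreover have "v \<noteq> [] \<or> s \<noteq> t" using False n_def by auto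
      ultimately show ?thesis by auto
    qed
  qed
  have "derivation_like t S (contract f)"
    unfolding derivation_like_def
  proof (intro conjI allI ballI)
    show "contract f 1 = 0"
      using contract_single[of f "[]" 1] mdeg_nonempty[of t] by (auto simp: single_Nil_one f_def n_def)
    show "contract f (lie t * y) = lie t * contract f y + paut (odd_word t) y" for y
      by (simp add: contract_lie_mult fs contract_counit)
    show "contract f (lie s * y) = lie s * contract f y" if "s \<in> S" for s y
    proof -
      have "s \<noteq> t" using that assms(2) by auto
      then show ?thesis using that by (simp add: contract_lie_mult fs contract_counit)
    qed
  qed (simp_all add: contract_add contract_psc contract_K[OF \<open>adm f\<close>])
  then show ?thesis by blast
qed

section \<open>Straightening\<close>

text \<open>The truncation to words of length at most \<open>N\<close> in a finite set \<open>U\<close> of letters makes the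
  Lie algebra finite-dimensional.\<close>

definition bad :: "'i set \<Rightarrow> nat \<Rightarrow> 'i multiset \<Rightarrow> bool" where
  "bad U N n \<longleftrightarrow> N < size n \<or> \<not> set_mset n \<subseteq> U"

definition Bad :: "'i set \<Rightarrow> nat \<Rightarrow> ('i list \<Rightarrow>\<^sub>0 complex) set" where
  "Bad U N = {x. \<forall>w\<in>keys x. bad U N (mset w)}"

text \<open>A two-sided ideal that contains the relations \<open>K\<close> and all bad words;
  straightening is carried out modulo it.\<close>

definition trunc :: "'i set \<Rightarrow> nat \<Rightarrow> ('i list \<Rightarrow>\<^sub>0 complex) set" where
  "trunc U N = {x. rho x \<in> Bad U N}"

lemma bad_add: "bad U N n \<Longrightarrow> bad U N (n + k)" "bad U N k \<Longrightarrow> bad U N (n + k)"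
  by (auto simp: bad_def)

lemma subspace_Bad: "pm.subspace (Bad U N)"
  unfolding Bad_def by (rule subspace_keys)

lemma subspace_trunc: "pm.subspace (trunc U N)"
  using subspace_Bad[of U N] by (auto simp: pm.subspace_def trunc_def rho_add rho_psc)

lemma Bad_mult:
  assumes "x \<in> Bad U N"
  shows "y * x \<in> Bad U N" and "x * y \<in> Bad U N"
proof -
  have "bad U N (mset w)" if w: "w \<in> keys (y * x)" for w
  proof -
    obtain u v where "w = u @ v" "v \<in> keys x"
      using subsetD[OF keys_mult w] by (auto simp: plus_list_def)
    then show ?thesis using assms bad_add(2) by (simp add: Bad_def)
  qed
  then show "y * x \<in> Bad U N" by (simp add: Bad_def)
  have "bad U N (mset w)" if w: "w \<in> keys (x * y)" for w
  proof -
    obtain u v where "w = u @ v" "u \<in> keys x"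
      using subsetD[OF keys_mult w] by (auto simp: plus_list_def)
    then show ?thesis using assms bad_add(1) by (simp add: Bad_def)
  qed
  then show "x * y \<in> Bad U N" by (simp add: Bad_def)
qed

lemma rho_Bad: "x \<in> Bad U N \<Longrightarrow> rho x \<in> Bad U N"
  unfolding rho_def
  by (rule subspace_lin[OF subspace_Bad]) (auto simp: trace_vec_def Bad_def)

lemma Bad_trunc: "Bad U N \<subseteq> trunc U N"
  using rho_Bad by (auto simp: trunc_def)

lemma K_trunc: "K \<subseteq> trunc U N"
  by (auto simp: K_def trunc_def Bad_def)

lemma rho_diff_K: "x - rho x \<in> K"
  by (simp add: K_def rho_minus)

lemma trunc_mult:
  assumes "x \<in> trunc U N"
  shows trunc_mult_left: "y * x \<in> trunc U N" and trunc_mult_right: "x * y \<in> trunc U N"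
proof -
  have d: "x - rho x \<in> K" by (rule rho_diff_K)
  have r: "rho x \<in> Bad U N" using assms by (simp add: trunc_def)
  have "y * (x - rho x) + y * rho x \<in> trunc U N"
    by (intro pm.subspace_add[OF subspace_trunc] subsetD[OF K_trunc K_mult_left[OF d]] subsetD[OF Bad_trunc Bad_mult(1)[OF r]])
  then show "y * x \<in> trunc U N" by (simp add: right_diff_distrib)
  have "(x - rho x) * y + rho x * y \<in> trunc U N"
    by (intro pm.subspace_add[OF subspace_trunc] subsetD[OF K_trunc K_mult_right[OF d]] subsetD[OF Bad_trunc Bad_mult(2)[OF r]])
  then show "x * y \<in> trunc U N" by (simp add: left_diff_distrib)
qed

definition spK :: "'i set \<Rightarrow> nat \<Rightarrow> ('i list \<Rightarrow>\<^sub>0 complex) set \<Rightarrow> ('i list \<Rightarrow>\<^sub>0 complex) set" where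
  "spK U N X = pm.span (X \<union> trunc U N)"

definition SP :: "'i set \<Rightarrow> nat \<Rightarrow> 'i magma list \<Rightarrow> ('i list \<Rightarrow>\<^sub>0 complex) set" where
  "SP U N ts = spK U N (mon ts ` exps ts)"

lemma subspace_spK: "pm.subspace (spK U N X)"
  and spK_base: "x \<in> X \<Longrightarrow> x \<in> spK U N X"
  and trunc_spK: "x \<in> trunc U N \<Longrightarrow> x \<in> spK U N X"
  by (auto simp: spK_def intro: pm.span_base)

lemma spK_induct:
  assumes "x \<in> spK U N X" "pm.subspace S" "X \<subseteq> S" "trunc U N \<subseteq> S"
  shows "x \<in> S"
  using assms pm.span_minimal[of "X \<union> trunc U N" S] by (auto simp: spK_def)

lemma subspace_mult_left: "pm.subspace S \<Longrightarrow> pm.subspace {x. a * x \<in> S}"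
  and subspace_mult_right: "pm.subspace S \<Longrightarrow> pm.subspace {x. x * a \<in> (S :: ('i list \<Rightarrow>\<^sub>0 complex) set)}"
  by (auto simp: pm.subspace_def distrib_left distrib_right psc_mult_left psc_mult_right)

lemma spK_mult_left:
  assumes "x \<in> spK U N X" "pm.subspace S" "trunc U N \<subseteq> S" "\<And>g. g \<in> X \<Longrightarrow> a * g \<in> S"
  shows "a * x \<in> S"
proof -
  have "x \<in> {x. a * x \<in> S}"
    by (rule spK_induct[OF assms(1) subspace_mult_left[OF assms(2)]])
      (use assms(3,4) trunc_mult_left in auto)
  then show ?thesis by simp
qed

lemma spK_mult_right:
  assumes "x \<in> spK U N X" "pm.subspace S" "trunc U N \<subseteq> S" "\<And>g. g \<in> X \<Longrightarrow> g * a \<in> S"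
  shows "x * a \<in> S"
proof -
  have "x \<in> {x. x * a \<in> S}"
    by (rule spK_induct[OF assms(1) subspace_mult_right[OF assms(2)]])
      (use assms(3,4) trunc_mult_right in auto)
  then show ?thesis by simp
qed

text \<open>A chain of ideals: modulo the truncation, the span of each tail is an ideal in the span
  of the preceding one. The case s = t also puts [t, t] into the tail, as needed for odd
  squares.\<close>

primrec closed_list :: "'i set \<Rightarrow> nat \<Rightarrow> 'i magma list \<Rightarrow> bool" where
  "closed_list U N [] \<longleftrightarrow> True"
| "closed_list U N (t # ts) \<longleftrightarrow> closed_list U N ts \<and>
     (\<forall>s\<in>insert t (set ts). lie (Br s t) \<in> spK U N (lie ` set ts))"

text \<open>The straightening step, by induction along the chain. The head raises its own exponent,
  except that an odd square is half of [t, t], a combination of later words. A later word s is moved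
  past the powers of t, and every bracket [s, t] created on the way lies in the span of the
  tail.\<close>

lemma SP_mult_lie:
  assumes "closed_list U N ts" "s \<in> set ts" "x \<in> SP U N ts"
  shows "lie s * x \<in> SP U N ts"
  using assms
proof (induction ts arbitrary: s x)
  case (Cons t ts)
  let ?S = "SP U N (t # ts)"
  have S: "pm.subspace ?S" "trunc U N \<subseteq> ?S"
    by (auto simp: SP_def subspace_spK trunc_spK)
  have gen: "lie t ^ k * mon ts ks \<in> ?S" if "ks \<in> exps ts" "odd_word t \<longrightarrow> k \<le> 1" for k ks
  proof -
    have "mon (t # ts) (k # ks) \<in> ?S"
      unfolding SP_def using that by (intro spK_base imageI) auto
    then show ?thesis by simp
  qed
  have le: "x \<in> ?S" if "x \<in> SP U N ts" for x
    by (rule spK_induct[OF that[unfolded SP_def] S(1) _ S(2)]) (use gen[of _ 0] in auto)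
  have IH: "lie s * x \<in> SP U N ts" if "s \<in> set ts" "x \<in> SP U N ts" for s x
    using that Cons by simp
  have IH': "y * x \<in> SP U N ts" if "y \<in> spK U N (lie ` set ts)" "x \<in> SP U N ts" for x y
    by (rule spK_mult_right[OF that(1)]) (use IH that(2) in \<open>auto simp: SP_def subspace_spK trunc_spK\<close>)
  have br: "lie (Br s t) \<in> spK U N (lie ` set ts)" if "s \<in> insert t (set ts)" for s
    using Cons.prems(1) that by (auto simp del: lie.simps)
  have mons: "mon ts ks \<in> SP U N ts" if "ks \<in> exps ts" for ks
    using that by (auto simp: SP_def intro: spK_base)
  have A: "lie t * x \<in> ?S" if "x \<in> ?S" for x
  proof (rule spK_mult_left[OF _ S])
    show "x \<in> spK U N (mon (t # ts) ` exps (t # ts))" using that by (simp add: SP_def)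
    fix g assume "g \<in> mon (t # ts) ` exps (t # ts)"
    then obtain k ks where g: "g = lie t ^ k * mon ts ks" "ks \<in> exps ts" "odd_word t \<longrightarrow> k \<le> 1" by auto
    show "lie t * g \<in> ?S"
    proof (cases "odd_word t \<and> k = 1")
      case False
      then have "odd_word t \<longrightarrow> Suc k \<le> 1" using g by auto
      then show ?thesis using gen[OF g(2), of "Suc k"] g by (simp add: mult.assoc)
    next
      case True
      then have "lie (Br t t) = psc 2 (lie t * lie t)"
        using pm.scale_left_distrib[of 1 1 "lie t * lie t"] by (simp add: super_sign_def)
      then have "lie t * g = psc (1 / 2) (lie (Br t t) * mon ts ks)"
        using True g by (simp add: psc_mult_left mult.assoc)
      moreover have "lie (Br t t) * mon ts ks \<in> ?S"
        using le IH'[OF br mons[OF g(2)]] by simp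
      ultimately show ?thesis using pm.subspace_scale[OF S(1)] by simp
    qed
  qed
  have B: "lie s * (lie t ^ k * mon ts ks) \<in> ?S"
    if "ks \<in> exps ts" "odd_word t \<longrightarrow> k \<le> 1" "s \<in> set ts" for s k ks
    using that(2,3)
  proof (induction k arbitrary: s)
    case 0
    then show ?case using le IH[OF _ mons[OF that(1)]] by simp
  next
    case (Suc k)
    let ?y = "lie t ^ k * mon ts ks"
    have "lie (Br s t) * ?y \<in> ?S"
      by (rule spK_mult_right[OF br S]) (use Suc in auto)
    moreover have "psc (super_sign (odd_word s) (odd_word t)) (lie t * (lie s * ?y)) \<in> ?S"
      using Suc by (intro pm.subspace_scale[OF S(1)] A) auto
    moreover have "lie s * (lie t ^ Suc k * mon ts ks)
       = lie (Br s t) * ?y + psc (super_sign (odd_word s) (odd_word t)) (lie t * (lie s * ?y))"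
      by (simp add: left_diff_distrib psc_mult_left mult.assoc)
    ultimately show ?case using pm.subspace_add[OF S(1)] by simp
  qed
  show ?case
  proof (cases "s = t")
    case True
    then show ?thesis using A Cons.prems by simp
  next
    case False
    then have s: "s \<in> set ts" using Cons.prems by simp
    show ?thesis
      by (rule spK_mult_left[OF _ S, of _ "mon (t # ts) ` exps (t # ts)"])
        (use Cons.prems(3) B s in \<open>auto simp: SP_def\<close>)
  qed
qed simp

text \<open>The span contains 1, the monomial with all exponents zero, and is stable under left
  multiplication by letters of U. Words with other letters are bad.\<close>

lemma SP_UNIV:
  assumes cl: "closed_list U N ts" and gens: "\<And>i. i \<in> U \<Longrightarrow> lie (Gen i) \<in> spK U N (lie ` set ts)"
  shows "SP U N ts = UNIV"
proof -
  have S: "pm.subspace (SP U N ts)" "trunc U N \<subseteq> SP U N ts"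
    by (auto simp: SP_def subspace_spK trunc_spK)
  have zero: "replicate (length ts) 0 \<in> exps ts \<and> mon ts (replicate (length ts) 0) = 1" for ts
    by (induction ts) auto
  have one: "1 \<in> SP U N ts"
    using spK_base[OF imageI, of "replicate (length ts) 0" "exps ts" "mon ts" U N] zero[of ts]
    by (simp add: SP_def)
  have w: "single w 1 \<in> SP U N ts" for w
  proof (induction w)
    case (Cons a w)
    show ?case
    proof (cases "a \<in> U")
      case True
      have "lie (Gen a) * single w 1 \<in> SP U N ts"
        by (rule spK_mult_right[OF gens[OF True] S]) (use SP_mult_lie[OF cl _ Cons] in auto)
      then show ?thesis by (simp add: mult_single_list)
    next
      case False
      then have "single (a # w) 1 \<in> Bad U N" by (simp add: Bad_def bad_def)
      then show ?thesis using Bad_trunc S(2) by blast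
    qed
  qed (simp add: single_Nil_one one)
  have "x \<in> SP U N ts" for x
    using subspace_lin[OF S(1), of x "\<lambda>w. single w 1"] w by (simp add: lin_id)
  then show ?thesis by blast
qed

section \<open>Counting ordered monomials\<close>

text \<open>Ordering by length serves two ends: a bracket is longer than its entries and hence
  expands into later words (\<open>lie_basis_closed\<close>), and the head of every suffix has
  minimal degree in it (\<open>lie_basis_separated\<close>).\<close>

definition lie_basis :: "'i set \<Rightarrow> nat \<Rightarrow> 'i magma list \<Rightarrow> bool" where
  "lie_basis U N ts \<longleftrightarrow> distinct ts \<and> sorted_wrt (\<lambda>s t. size (mdeg s) \<le> size (mdeg t)) ts \<and>
     (\<forall>t\<in>set ts. \<not> bad U N (mdeg t)) \<and>
     (\<forall>n. \<not> bad U N n \<longrightarrow>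
       inj_on (\<lambda>t. rho (lie t)) {t \<in> set ts. mdeg t = n} \<and>
       pm.independent ((\<lambda>t. rho (lie t)) ` {t \<in> set ts. mdeg t = n}) \<and>
       (\<forall>t. mdeg t = n \<longrightarrow> rho (lie t) \<in> pm.span ((\<lambda>t. rho (lie t)) ` {t \<in> set ts. mdeg t = n})))"

lemma finite_words: "finite {w. mset w = (n :: 'i multiset)}"
proof (rule finite_subset)
  show "{w. mset w = n} \<subseteq> {w. set w \<subseteq> set_mset n \<and> length w = size n}"
    by (auto simp flip: size_mset)
qed (simp add: finite_lists_length_eq)

lemma homog_span: "homog n \<subseteq> pm.span ((\<lambda>w. single w 1) ` {w. mset w = n})"
proof
  fix x assume "x \<in> homog n"
  then have "lin (\<lambda>w. single w 1) x \<in> pm.span ((\<lambda>w. single w 1) ` {w. mset w = n})"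
    by (intro subspace_lin[OF pm.subspace_span] pm.span_base) (auto simp: homog_def)
  then show "x \<in> pm.span ((\<lambda>w. single w 1) ` {w. mset w = n})" by (simp add: lin_id)
qed

lemma independent_homog_finite:
  assumes "pm.independent B" "B \<subseteq> homog n"
  shows "finite B"
  using pm.independent_span_bound[of "(\<lambda>w. single w 1) ` {w. mset w = n}" B]
    assms homog_span finite_words by blast

lemma degree_basis:
  obtains X where "finite X" "X \<subseteq> {t. mdeg t = n}" "inj_on (\<lambda>t. rho (lie t)) X"
    "pm.independent ((\<lambda>t. rho (lie t)) ` X)"
    "\<And>t. mdeg t = n \<Longrightarrow> rho (lie t) \<in> pm.span ((\<lambda>t. rho (lie t)) ` X)"
proof -
  let ?f = "\<lambda>t. rho (lie t)"
  let ?P = "?f ` {t. mdeg t = n}"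
  obtain B where B: "B \<subseteq> ?P" "pm.independent B" "?P \<subseteq> pm.span B"
    using pm.maximal_independent_subset[of ?P] by blast
  have "finite B"
    using B homog_lie rho_homog by (intro independent_homog_finite[of B n]) auto
  \<comment> \<open>One Lie word per basis vector, so that \<open>rho\<close> of the Lie element is
    injective on the chosen words.\<close>
  let ?X = "inv_into {t. mdeg t = n} ?f ` B"
  have fi: "?f (inv_into {t. mdeg t = n} ?f b) = b" if "b \<in> B" for b
    by (rule f_inv_into_f) (use that B(1) in blast)
  then have fX: "?f ` ?X = B" by (simp add: image_image)
  show thesis
  proof (rule that)
    show "finite ?X" using \<open>finite B\<close> by simp
    show "?X \<subseteq> {t. mdeg t = n}" using B(1) inv_into_into[of _ ?f "{t. mdeg t = n}"] by blast
    show "inj_on ?f ?X"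
      by (rule inj_on_imageI) (auto simp: inj_on_def fi)
    show "pm.independent (?f ` ?X)" using fX B by simp
    show "?f t \<in> pm.span (?f ` ?X)" if "mdeg t = n" for t
      unfolding fX using B(3) that by blast
  qed
qed

lemma finite_not_bad: "finite U \<Longrightarrow> finite {n. \<not> bad U N n}"
proof -
  assume "finite U"
  then have "finite (mset ` {w. set w \<subseteq> U \<and> length w \<le> N})"
    by (intro finite_imageI finite_lists_length_le)
  moreover have "{n. \<not> bad U N n} \<subseteq> mset ` {w. set w \<subseteq> U \<and> length w \<le> N}"
  proof
    fix n assume "n \<in> {n. \<not> bad U N n}"
    moreover obtain w where "n = mset w" by (metis ex_mset)
    ultimately show "n \<in> mset ` {w. set w \<subseteq> U \<and> length w \<le> N}" by (auto simp: bad_def)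
  qed
  ultimately show ?thesis by (rule finite_subset[rotated])
qed

lemma lie_basis_exists:
  assumes "finite U"
  shows "\<exists>ts. lie_basis U N ts"
proof -
  let ?f = "\<lambda>t. rho (lie t)"
  have "\<forall>n. \<exists>X. finite X \<and> X \<subseteq> {t. mdeg t = n} \<and> inj_on ?f X \<and>
     pm.independent (?f ` X) \<and> (\<forall>t. mdeg t = n \<longrightarrow> ?f t \<in> pm.span (?f ` X))"
    using degree_basis by metis
  then obtain X where X: "\<And>n. finite (X n)" "\<And>n. X n \<subseteq> {t. mdeg t = n}" "\<And>n. inj_on ?f (X n)"
     "\<And>n. pm.independent (?f ` X n)" "\<And>n t. mdeg t = n \<Longrightarrow> ?f t \<in> pm.span (?f ` X n)"
    by metis
  define Y where "Y = (\<Union>n\<in>{n. \<not> bad U N n}. X n)"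
  have "finite Y" unfolding Y_def using finite_not_bad[OF assms] X(1) by blast
  then obtain ys where ys: "set ys = Y" "distinct ys" using finite_distinct_list by blast
  define ts where "ts = sort_key (\<lambda>t. size (mdeg t)) ys"
  have ts: "set ts = Y" "distinct ts" using ys by (simp_all add: ts_def)
  have "sorted (map (\<lambda>t. size (mdeg t)) ts)" by (simp add: ts_def)
  then have "sorted_wrt (\<lambda>s t. size (mdeg s) \<le> size (mdeg t)) ts" by (simp add: sorted_wrt_map)
  moreover have "{t \<in> set ts. mdeg t = n} = X n" if "\<not> bad U N n" for n
    using X(2) that by (auto simp: ts Y_def)
  moreover have "\<not> bad U N (mdeg t)" if "t \<in> set ts" for t
    using that X(2) by (auto simp: ts Y_def)
  ultimately have "lie_basis U N ts"
    unfolding lie_basis_def using X ts(2) by auto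
  then show ?thesis by blast
qed

text \<open>A Lie element and its normal form differ by an element of \<open>K\<close>, which the
  truncation contains; in a bad degree the Lie element itself is truncated.\<close>

lemma lie_in_spK:
  assumes "lie_basis U N ts" "{s \<in> set ts. mdeg s = mdeg t} \<subseteq> S"
  shows "lie t \<in> spK U N (lie ` S)"
proof (cases "bad U N (mdeg t)")
  case True
  then have "lie t \<in> Bad U N" using homog_lie[of t] by (auto simp: Bad_def homog_def)
  then show ?thesis using Bad_trunc trunc_spK by blast
next
  case False
  have r: "rho (lie s) \<in> spK U N (lie ` S)" if "s \<in> S" for s
  proof -
    have "lie s - (lie s - rho (lie s)) \<in> spK U N (lie ` S)"
      using that K_trunc rho_diff_K by (intro pm.subspace_diff[OF subspace_spK] spK_base trunc_spK) auto
    then show ?thesis by simp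
  qed
  have "rho (lie t) \<in> pm.span ((\<lambda>t. rho (lie t)) ` {s \<in> set ts. mdeg s = mdeg t})"
    using assms(1) False by (auto simp: lie_basis_def)
  moreover have "pm.span ((\<lambda>t. rho (lie t)) ` {s \<in> set ts. mdeg s = mdeg t}) \<subseteq> spK U N (lie ` S)"
    by (rule pm.span_minimal[OF _ subspace_spK]) (use r assms(2) in auto)
  ultimately have "(lie t - rho (lie t)) + rho (lie t) \<in> spK U N (lie ` S)"
    using trunc_spK[OF subsetD[OF K_trunc rho_diff_K]] by (intro pm.subspace_add[OF subspace_spK]) auto
  then show ?thesis by simp
qed

lemma lie_basis_closed:
  assumes "lie_basis U N ts"
  shows "closed_list U N ts"
proof -
  \<comment> \<open>Induction over suffixes: \<open>lie_basis\<close> speaks about the whole list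
    and is not inherited by tails, so the removed prefix is carried along.\<close>
  have "ts = ts0 @ ts1 \<Longrightarrow> closed_list U N ts1" for ts0 ts1
  proof (induction ts1 arbitrary: ts0)
    case (Cons t ts1)
    have sz: "size (mdeg s) \<le> size (mdeg t)" if "s \<in> set ts0" for s
      using assms Cons.prems that by (auto simp: lie_basis_def sorted_wrt_append)
    have "lie (Br s t) \<in> spK U N (lie ` set ts1)" for s
    proof (rule lie_in_spK[OF assms])
      have "size (mdeg t) < size (mdeg (Br s t))" using mdeg_nonempty[of s] unfolding nonempty_has_size by simp
      then have "s' \<notin> set ts0 \<and> s' \<noteq> t" if "mdeg s' = mdeg (Br s t)" for s'
        using sz[of s'] that by auto
      then show "{s' \<in> set ts. mdeg s' = mdeg (Br s t)} \<subseteq> set ts1" using Cons.prems by auto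
    qed
    then show ?case using Cons.IH[of "ts0 @ [t]"] Cons.prems by simp
  qed simp
  then show ?thesis by simp
qed

lemma lie_basis_separated:
  assumes "lie_basis U N ts"
  shows "separated ts"
proof -
  have "ts = ts0 @ ts1 \<Longrightarrow> separated ts1" for ts0 ts1
  proof (induction ts1 arbitrary: ts0)
    case (Cons t ts1)
    have sub: "{s \<in> insert t (set ts1). mdeg s = mdeg t} \<subseteq> {s \<in> set ts. mdeg s = mdeg t}"
      using Cons.prems by auto
    have nb: "\<not> bad U N (mdeg t)" using assms Cons.prems by (auto simp: lie_basis_def)
    have "\<exists>D. derivation_like t (set ts1) D"
    proof (rule derivation_exists)
      show "size (mdeg t) \<le> size (mdeg s)" if "s \<in> set ts1" for s
        using assms Cons.prems that by (auto simp: lie_basis_def sorted_wrt_append)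
      show "t \<notin> set ts1" using assms Cons.prems by (auto simp: lie_basis_def)
      show "inj_on (\<lambda>s. rho (lie s)) {s \<in> insert t (set ts1). mdeg s = mdeg t}"
        using assms nb inj_on_subset[OF _ sub] by (auto simp: lie_basis_def)
      show "pm.independent ((\<lambda>s. rho (lie s)) ` {s \<in> insert t (set ts1). mdeg s = mdeg t})"
        using assms nb pm.independent_mono[OF _ image_mono[OF sub]] by (auto simp: lie_basis_def)
    qed
    then show ?case using Cons.IH[of "ts0 @ [t]"] Cons.prems by simp
  qed simp
  then show ?thesis by simp
qed

section \<open>Dimensions of the graded pieces of the associative algebra\<close>

definition ntraces :: "'i multiset \<Rightarrow> nat" where
  "ntraces n = card (rep ` {w. mset w = n \<and> \<not> nil w})"

definition nmons :: "'i magma list \<Rightarrow> 'i multiset \<Rightarrow> nat" where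
  "nmons ts n = card {ks \<in> exps ts. degs ts ks = n}"

lemma mon_homog: "ks \<in> exps ts \<Longrightarrow> mon ts ks \<in> homog (degs ts ks)"
proof (induction ts arbitrary: ks)
  case Nil
  then show ?case by (simp add: homog_def zero_list_def)
next
  case (Cons t ts)
  then obtain k r where ks: "ks = k # r" "r \<in> exps ts" by auto
  have "lie t ^ k \<in> homog (repeat_mset k (mdeg t))"
  proof (induction k)
    case 0
    then show ?case by (simp add: homog_def zero_list_def)
  next
    case (Suc k)
    then show ?case using homog_mult[OF homog_lie[of t] Suc] by simp
  qed
  then show ?case using Cons.IH[OF ks(2)] ks by (simp add: homog_mult)
qed

definition hproj :: "'i multiset \<Rightarrow> ('i list \<Rightarrow>\<^sub>0 complex) \<Rightarrow> 'i list \<Rightarrow>\<^sub>0 complex" where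
  "hproj n = lin (\<lambda>w. if mset w = n then single w 1 else 0)"

lemma hproj_homog: "x \<in> homog k \<Longrightarrow> hproj n x = (if k = n then x else 0)"
proof -
  assume "x \<in> homog k"
  then have "hproj n x = lin (\<lambda>w. if k = n then single w 1 else 0) x"
    unfolding hproj_def by (intro lin_cong) (auto simp: homog_def)
  then show ?thesis by (auto simp: lin_id lin_def[of "\<lambda>w. 0"])
qed

lemma hproj_rho: "rho (hproj n x) = hproj n (rho x)"
proof -
  have "rho (if mset w = n then single w 1 else 0) = hproj n (trace_vec w)" for w
    by (simp add: rho_single trace_vec_def hproj_def)
  then show ?thesis by (simp add: rho_def hproj_def lin_lin)
qed

lemma hproj_Bad: "x \<in> Bad U N \<Longrightarrow> \<not> bad U N n \<Longrightarrow> hproj n x = 0"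
  unfolding hproj_def lin_def by (intro sum.neutral) (auto simp: Bad_def)

lemma single_one_inj [simp]:
  "single x (1 :: complex) = single y 1 \<longleftrightarrow> x = y"
  by (metis keys_single singleton_inject one_neq_zero)

lemma single_independent:
  fixes S :: "'x set"
  shows "pm.independent ((\<lambda>w. single w 1) ` S)"
proof -
  have "False" if f: "finite t" "t \<subseteq> S" and z: "(\<Sum>w\<in>t. psc (u w) (single w 1)) = 0" and w: "w \<in> t" "u w \<noteq> 0"
    for t u and w :: 'x
  proof -
    have "lookup (\<Sum>w\<in>t. psc (u w) (single w 1)) w = u w"
      using f(1) w(1) by (simp add: lookup_sum lookup_single when_def sum.delta' if_distrib cong: if_cong)
    then show False using z w(2) by simp
  qed
  note ind = this
  have inj: "inj_on (\<lambda>w. single w (1 :: complex)) T" for T :: "'x set"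
    by (auto simp: inj_on_def)
  show ?thesis
    unfolding pm.dependent_explicit
  proof clarify
    fix t u v
    assume t: "finite t" "t \<subseteq> (\<lambda>w. single w (1 :: complex)) ` S"
      and z: "(\<Sum>v\<in>t. psc (u v) v) = 0" and v: "v \<in> t" "u v \<noteq> 0"
    obtain T where T: "T \<subseteq> S" "finite T" "t = (\<lambda>w. single w (1 :: complex)) ` T"
      using finite_subset_image[OF t] by blast
    obtain w where w: "w \<in> T" "v = single w 1" using T v by blast
    have "(\<Sum>w\<in>T. psc (u (single w 1)) (single w 1)) = 0"
      using z unfolding T(3) by (subst (asm) sum.reindex[OF inj]) simp
    then show False using ind[OF T(2,1), of "\<lambda>w. u (single w 1)" w] w v(2) by blast
  qed
qed

lemma dim_rho_homog: "pm.dim (rho ` homog n) = ntraces n"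
proof -
  let ?s = "\<lambda>w. single w (1 :: complex)"
  let ?R = "rep ` {w. mset w = n \<and> \<not> nil w}"
  have "card (?s ` ?R) = pm.dim (rho ` homog n)"
  proof (rule pm.basis_card_eq_dim)
    show "pm.independent (?s ` ?R)" by (rule single_independent)
    show "?s ` ?R \<subseteq> rho ` homog n"
    proof clarify
      fix w assume "\<not> nil w" "n = mset w"
      then have "?s (rep w) = rho (?s (rep w))" "?s (rep w) \<in> homog n"
        by (simp_all add: rho_single trace_vec_def homog_single)
      then show "?s (rep w) \<in> rho ` homog (mset w)" using \<open>n = mset w\<close> by blast
    qed
    show "rho ` homog n \<subseteq> pm.span (?s ` ?R)"
    proof clarify
      fix x assume x: "x \<in> homog n"
      have "trace_vec w \<in> pm.span (?s ` ?R)" if "mset w = n" for w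
      proof (cases "nil w")
        case False
        have "psc (inv_sign w * inv_sign (rep w)) (?s (rep w)) \<in> pm.span (?s ` ?R)"
          using that False by (intro pm.span_scale pm.span_base) auto
        then show ?thesis using False by (simp add: trace_vec_def)
      qed (simp add: trace_vec_def pm.span_zero)
      then show "rho x \<in> pm.span (?s ` ?R)"
        using x unfolding rho_def by (intro subspace_lin[OF pm.subspace_span]) (auto simp: homog_def)
    qed
  qed
  moreover have "card (?s ` ?R) = card ?R" by (rule card_image) (auto simp: inj_on_def)
  ultimately show ?thesis by (simp add: ntraces_def)
qed

text \<open>The Poincare-Birkhoff-Witt theorem, as a count.\<close>

theorem nmons_eq_ntraces:
  assumes ts: "lie_basis U N ts" and n: "\<not> bad U N n"
  shows "nmons ts n = ntraces n"
proof -
  let ?E = "{ks \<in> exps ts. degs ts ks = n}"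
  let ?f = "\<lambda>ks. rho (mon ts ks)"
  note sep = lie_basis_separated[OF ts]
  have ind: "c ks = 0" if "finite F" "F \<subseteq> exps ts" "(\<Sum>ks\<in>F. psc (c ks) (?f ks)) = 0" "ks \<in> F" for F c ks
  proof (rule mon_independent[OF sep that(1,2) _ that(4)])
    show "(\<Sum>ks\<in>F. psc (c ks) (mon ts ks)) \<in> K"
      using that(3) by (simp add: K_def rho_sum rho_psc)
  qed
  have inj: "inj_on ?f (exps ts)"
  proof (rule inj_onI, rule ccontr)
    fix a b assume ab: "a \<in> exps ts" "b \<in> exps ts" "?f a = ?f b" "a \<noteq> b"
    \<comment> \<open>Two monomials with equal images would give a linear relation with coefficients
      1 and -1.\<close>
    have "(\<Sum>ks\<in>{a, b}. psc (if ks = a then 1 else -1) (?f ks)) = 0"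
      using ab by simp
    then have "(if a = a then 1 else -1 :: complex) = 0"
      using ab by (intro ind[of "{a, b}" "\<lambda>ks. if ks = a then 1 else -1" a]) auto
    then show False by simp
  qed
  have "card (?f ` ?E) = pm.dim (rho ` homog n)"
  proof (rule pm.basis_card_eq_dim)
    show "?f ` ?E \<subseteq> rho ` homog n" using mon_homog by auto
    show "pm.independent (?f ` ?E)"
      unfolding pm.dependent_explicit
    proof clarify
      fix t u v
      assume t: "finite t" "t \<subseteq> ?f ` ?E" and z: "(\<Sum>v\<in>t. psc (u v) v) = 0" and v: "v \<in> t" "u v \<noteq> 0"
      obtain T where T: "T \<subseteq> ?E" "finite T" "t = ?f ` T"
        using finite_subset_image[OF t] by blast
      obtain w where w: "w \<in> T" "v = ?f w" using T v by blast
      have "inj_on ?f T" using inj T(1) by (auto intro: inj_on_subset)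
      then have "(\<Sum>w\<in>T. psc (u (?f w)) (?f w)) = 0"
        using z unfolding T(3) by (subst (asm) sum.reindex) simp_all
      then have "u (?f w) = 0" using T w(1) by (intro ind[of T "\<lambda>w. u (?f w)"]) auto
      then show False using w v by simp
    qed
    show "rho ` homog n \<subseteq> pm.span (?f ` ?E)"
    proof clarify
      fix x assume x: "x \<in> homog n"
      have "lie (Gen i) \<in> spK U N (lie ` set ts)" for i
        by (rule lie_in_spK[OF ts]) auto
      then have "x \<in> SP U N ts" using SP_UNIV[OF lie_basis_closed[OF ts]] by blast
      then obtain y k where xyk: "x = y + k" "y \<in> pm.span (mon ts ` exps ts)" "k \<in> pm.span (trunc U N)"
        unfolding SP_def spK_def pm.span_Un by blast
      have k: "k \<in> trunc U N" using xyk(3) subspace_trunc by (simp add: pm.span_eq_iff[THEN iffD2])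
      \<comment> \<open>Passing to the component of degree n removes the truncated part, since n is
        not bad, and retains exactly the monomials of degree n.\<close>
      have "x = hproj n x" using hproj_homog[OF x, of n] by simp
      also have "\<dots> = hproj n y + hproj n k" by (simp add: xyk hproj_def lin_add)
      finally have "rho x = rho (hproj n y) + hproj n (rho k)" by (simp add: rho_add hproj_rho)
      moreover have "hproj n (rho k) = 0" using k n hproj_Bad by (simp add: trunc_def)
      moreover have "y \<in> {y. rho (hproj n y) \<in> pm.span (?f ` ?E)}"
      proof (rule subsetD[OF pm.span_minimal xyk(2)])
        show "pm.subspace {y. rho (hproj n y) \<in> pm.span (?f ` ?E)}"
          by (auto simp: pm.subspace_def hproj_def lin_add lin_psc rho_add rho_psc
              intro: pm.span_add pm.span_scale pm.span_zero)
        show "mon ts ` exps ts \<subseteq> {y. rho (hproj n y) \<in> pm.span (?f ` ?E)}"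
        proof clarify
          fix ks assume ks: "ks \<in> exps ts"
          show "rho (hproj n (mon ts ks)) \<in> pm.span (?f ` ?E)"
          proof (cases "degs ts ks = n")
            case True
            have "?f ks \<in> pm.span (?f ` ?E)" by (rule pm.span_base[OF imageI]) (use ks True in simp)
            then show ?thesis using True ks by (simp add: hproj_homog[OF mon_homog])
          qed (simp add: hproj_homog[OF mon_homog[OF ks]] pm.span_zero)
        qed
      qed
      ultimately show "rho x \<in> pm.span (?f ` ?E)" by simp
    qed
  qed
  moreover have "card (?f ` ?E) = card ?E" by (rule card_image) (use inj in \<open>auto intro: inj_on_subset\<close>)
  ultimately show ?thesis by (simp add: nmons_def dim_rho_homog)
qed

end

section \<open>Quotients of bilinear algebras\<close>

text \<open>The product is neither associative nor unital, so ring quotients do not apply; a module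
  with a biadditive product is what the two successive quotients require.\<close>

locale bilinear_algebra =
  fixes A :: "('i, 'x) superalgebra" (structure)
  assumes is_module: "Module.module class_ring A"
    and mult_closed [simp, intro]: "x \<in> carrier A \<Longrightarrow> y \<in> carrier A \<Longrightarrow> x \<otimes> y \<in> carrier A"
    and mult_distl: "x \<in> carrier A \<Longrightarrow> y \<in> carrier A \<Longrightarrow> z \<in> carrier A \<Longrightarrow> (x \<oplus> y) \<otimes> z = x \<otimes> z \<oplus> y \<otimes> z"
    and mult_distr: "x \<in> carrier A \<Longrightarrow> y \<in> carrier A \<Longrightarrow> z \<in> carrier A \<Longrightarrow> z \<otimes> (x \<oplus> y) = z \<otimes> x \<oplus> z \<otimes> y"
begin

sublocale Module.module class_ring A
  by (rule is_module)

lemma algebra_idealI: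
  assumes "J \<subseteq> carrier A" "\<zero> \<in> J" "\<And>x y. x \<in> J \<Longrightarrow> y \<in> J \<Longrightarrow> x \<oplus> y \<in> J"
    "\<And>c x. x \<in> J \<Longrightarrow> c \<odot> x \<in> J" "\<And>x y. x \<in> carrier A \<Longrightarrow> y \<in> J \<Longrightarrow> x \<otimes> y \<in> J \<and> y \<otimes> x \<in> J"
  shows "algebra_ideal J A"
proof -
  have "\<ominus> x \<in> J" if "x \<in> J" for x
  proof -
    have "\<ominus> x = (-1) \<odot> x"
      using smult_l_minus[of 1 x] that assms(1) smult_one[of x] by (auto simp: class_ring_simps)
    then show ?thesis using assms(4)[OF that] by simp
  qed
  then have "Module.submodule J class_ring A"
    using assms by (intro submoduleI) (auto simp: class_ring_simps)
  then show ?thesis using assms by (simp add: algebra_ideal_def)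
qed

lemma algebra_idealD:
  assumes "algebra_ideal J A"
  shows "J \<subseteq> carrier A" "\<zero> \<in> J" "x \<in> J \<Longrightarrow> y \<in> J \<Longrightarrow> x \<oplus> y \<in> J" "x \<in> J \<Longrightarrow> c \<odot> x \<in> J"
    "x \<in> J \<Longrightarrow> \<ominus> x \<in> J"
    "x \<in> carrier A \<Longrightarrow> y \<in> J \<Longrightarrow> x \<otimes> y \<in> J" "x \<in> carrier A \<Longrightarrow> y \<in> J \<Longrightarrow> y \<otimes> x \<in> J"
proof -
  have s: "Module.submodule J class_ring A" using assms by (simp add: algebra_ideal_def)
  note e = submoduleE[OF s]
  show 1: "J \<subseteq> carrier A" "x \<in> J \<Longrightarrow> y \<in> J \<Longrightarrow> x \<oplus> y \<in> J" "x \<in> J \<Longrightarrow> c \<odot> x \<in> J" "x \<in> J \<Longrightarrow> \<ominus> x \<in> J"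
    using e by (auto simp: class_ring_simps)
  obtain z where "z \<in> J" using e(2) by blast
  then have "z \<oplus> \<ominus> z \<in> J" using e(3,5) by blast
  then show "\<zero> \<in> J" using \<open>z \<in> J\<close> 1(1) r_neg[of z] by auto
  show "x \<in> carrier A \<Longrightarrow> y \<in> J \<Longrightarrow> x \<otimes> y \<in> J" "x \<in> carrier A \<Longrightarrow> y \<in> J \<Longrightarrow> y \<otimes> x \<in> J"
    using assms by (auto simp: algebra_ideal_def)
qed

lemma ideal_generated:
  assumes "S \<subseteq> carrier A"
  shows "algebra_ideal (ideal_generated A S) A" "S \<subseteq> ideal_generated A S"
    "algebra_ideal J A \<Longrightarrow> S \<subseteq> J \<Longrightarrow> ideal_generated A S \<subseteq> J"
proof -
  have c: "algebra_ideal (carrier A) A"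
    by (rule algebra_idealI) (auto simp: class_ring_simps)
  show "algebra_ideal (ideal_generated A S) A"
  proof (rule algebra_idealI)
    show "ideal_generated A S \<subseteq> carrier A" using c assms by (auto simp: ideal_generated_def)
  qed (auto simp: ideal_generated_def dest: algebra_idealD)
  show "S \<subseteq> ideal_generated A S" "algebra_ideal J A \<Longrightarrow> S \<subseteq> J \<Longrightarrow> ideal_generated A S \<subseteq> J"
    by (auto simp: ideal_generated_def)
qed

end

locale algebra_quotient = bilinear_algebra A for A :: "('i, 'x) superalgebra" (structure) +
  fixes J :: "'x set"
  assumes ideal: "algebra_ideal J A"
begin

abbreviation Q :: "('i, 'x set) superalgebra" where "Q \<equiv> quotient_algebra A J"

abbreviation pr :: "'x \<Rightarrow> 'x set" where "pr x \<equiv> J +>\<^bsub>A\<^esub> x"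

sublocale abelian_subgroup J A
proof (rule abelian_subgroupI3)
  have "Module.submodule J class_ring A" using ideal by (simp add: algebra_ideal_def)
  then show "additive_subgroup J A"
    by (intro additive_subgroup.intro) (simp add: Module.submodule_def)
qed (rule abelian_group_axioms)

lemmas idealD = algebra_idealD[OF ideal]

lemma pr_eq_iff:
  assumes "x \<in> carrier A" "y \<in> carrier A"
  shows "pr x = pr y \<longleftrightarrow> x \<oplus> \<ominus> y \<in> J"
  using assms a_rcos_module[of y x] a_repr_independence'[of x y] a_rcos_self[of x] by auto

lemma pr_eqI: "x \<in> carrier A \<Longrightarrow> h \<in> J \<Longrightarrow> pr (h \<oplus> x) = pr x"
  using idealD(1) by (subst pr_eq_iff) (auto simp: a_assoc r_neg)

lemma pr_mem: "x \<in> carrier A \<Longrightarrow> y \<in> pr x \<longleftrightarrow> (\<exists>h\<in>J. y = h \<oplus> x)"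
  by (auto simp: a_r_coset_def' )

lemma carrier_Q: "carrier Q = pr ` carrier A"
  by (auto simp: quotient_algebra_def FactRing_def A_RCOSETS_def')

lemma pr_zero: "pr \<zero> = \<zero>\<^bsub>Q\<^esub>" and zero_Q: "\<zero>\<^bsub>Q\<^esub> = J"
  using a_rcos_const[of \<zero>] idealD(2) by (simp_all add: quotient_algebra_def FactRing_def)

lemma pr_add: "x \<in> carrier A \<Longrightarrow> y \<in> carrier A \<Longrightarrow> pr x \<oplus>\<^bsub>Q\<^esub> pr y = pr (x \<oplus> y)"
  by (simp add: quotient_algebra_def FactRing_def a_rcos_sum)

text \<open>All cosets in the union that defines \<open>smult\<close> coincide because J absorbs
  scalar multiples; \<open>pr_mult\<close> treats the product in the same manner.\<close>

lemma pr_smult: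
  assumes x: "x \<in> carrier A"
  shows "c \<odot>\<^bsub>Q\<^esub> pr x = pr (c \<odot> x)"
proof -
  have "pr (c \<odot> y) = pr (c \<odot> x)" if yy: "y \<in> pr x" for y
  proof -
    obtain h where h: "h \<in> J" "y = h \<oplus> x" using yy unfolding pr_mem[OF x] by blast
    have "h \<in> carrier A" using h(1) idealD(1) by (rule subsetD[rotated])
    then have "c \<odot> y = c \<odot> h \<oplus> c \<odot> x"
      unfolding h(2) using x by (intro smult_r_distr) (simp_all only: class_ring_simps UNIV_I)
    moreover have "c \<odot> x \<in> carrier A"
      using x by (intro smult_closed) (simp_all only: class_ring_simps UNIV_I)
    ultimately show ?thesis using pr_eqI[OF _ idealD(4)[OF h(1)]] by (simp only:)
  qed
  then have "(\<Union>y\<in>pr x. pr (c \<odot> y)) = (\<Union>y\<in>pr x. pr (c \<odot> x))" by (intro SUP_cong refl)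
  also have "\<dots> = pr (c \<odot> x)" using a_rcos_self[OF x] by (intro cSUP_const) blast
  finally show ?thesis by (simp only: quotient_algebra_def module.simps)
qed

lemma pr_mult:
  assumes x: "x \<in> carrier A" and y: "y \<in> carrier A"
  shows "pr x \<otimes>\<^bsub>Q\<^esub> pr y = pr (x \<otimes> y)"
proof -
  have "pr (a \<otimes> b) = pr (x \<otimes> y)" if ab: "a \<in> pr x" "b \<in> pr y" for a b
  proof -
    obtain h where h: "h \<in> J" "a = h \<oplus> x" using ab(1) unfolding pr_mem[OF x] by blast
    obtain k where k: "k \<in> J" "b = k \<oplus> y" using ab(2) unfolding pr_mem[OF y] by blast
    have c: "h \<in> carrier A" "k \<in> carrier A" using h(1) k(1) idealD(1) by (blast intro: subsetD)+
    have "a \<otimes> b = (h \<otimes> k \<oplus> h \<otimes> y \<oplus> x \<otimes> k) \<oplus> x \<otimes> y"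
      unfolding h(2) k(2) using c x y by (simp add: mult_distl mult_distr a_ac)
    moreover have "h \<otimes> k \<oplus> h \<otimes> y \<oplus> x \<otimes> k \<in> J"
      by (intro idealD(3) idealD(6) idealD(7) h k c x y)
    ultimately show ?thesis using pr_eqI[OF mult_closed[OF x y]] by (simp only:)
  qed
  then have "(\<Union>a\<in>pr x. \<Union>b\<in>pr y. pr (a \<otimes> b)) = (\<Union>a\<in>pr x. \<Union>b\<in>pr y. pr (x \<otimes> y))"
    by (intro SUP_cong refl)
  also have "\<dots> = pr (x \<otimes> y)" using a_rcos_self[OF x] a_rcos_self[OF y] by blast
  finally show ?thesis
    by (simp add: quotient_algebra_def FactRing_def rcoset_mult_def)
qed

lemma Q_bilinear: "bilinear_algebra Q"
proof -
  have "abelian_group Q"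
  proof (rule abelian_groupI)
    show "\<exists>y\<in>carrier Q. y \<oplus>\<^bsub>Q\<^esub> x = \<zero>\<^bsub>Q\<^esub>" if xc: "x \<in> carrier Q" for x
    proof -
      obtain a where a: "a \<in> carrier A" "x = pr a" using xc carrier_Q by auto
      then have "pr (\<ominus> a) \<oplus>\<^bsub>Q\<^esub> x = \<zero>\<^bsub>Q\<^esub>" by (simp add: pr_add l_neg pr_zero)
      then show ?thesis using a carrier_Q by blast
    qed
    show "\<zero>\<^bsub>Q\<^esub> \<in> carrier Q" by (simp add: pr_zero[symmetric] carrier_Q)
    show "\<zero>\<^bsub>Q\<^esub> \<oplus>\<^bsub>Q\<^esub> x = x" if "x \<in> carrier Q" for x
      using that by (auto simp: pr_zero[symmetric] carrier_Q pr_add)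
  qed (auto simp: carrier_Q pr_add a_ac)
  then have "Module.module class_ring Q"
    using smult_l_distr smult_r_distr smult_assoc1 smult_one
    by (intro moduleI class_cring.is_cring)
      (auto simp: carrier_Q pr_add pr_smult class_ring_simps)
  then show ?thesis
    unfolding bilinear_algebra_def carrier_Q
    by (intro conjI allI impI; (elim imageE)?)
      (simp_all add: pr_add pr_mult mult_distl mult_distr)
qed

lemma ideal_vimage:
  assumes "algebra_ideal I Q"
  shows "algebra_ideal {x \<in> carrier A. pr x \<in> I} A"
proof -
  interpret Q: bilinear_algebra Q by (rule Q_bilinear)
  note d = Q.algebra_idealD[OF assms]
  show ?thesis
    by (rule algebra_idealI)
      (use d carrier_Q in \<open>auto simp: pr_zero pr_add[symmetric] pr_smult[symmetric] pr_mult[symmetric] class_ring_simps\<close>)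
qed

lemma ideal_image:
  assumes "algebra_ideal I A"
  shows "algebra_ideal (pr ` I) Q"
proof -
  interpret Q: bilinear_algebra Q by (rule Q_bilinear)
  note d = algebra_idealD[OF assms]
  have c: "x \<in> I \<Longrightarrow> x \<in> carrier A" for x using d(1) by auto
  show ?thesis
  proof (rule Q.algebra_idealI)
    show "\<zero>\<^bsub>Q\<^esub> \<in> pr ` I" using d(2) pr_zero by force
    show "pr ` I \<subseteq> carrier Q" using d(1) carrier_Q by auto
    show "x \<oplus>\<^bsub>Q\<^esub> y \<in> pr ` I" if "x \<in> pr ` I" "y \<in> pr ` I" for x y
      using that c d(3) by (auto simp: pr_add)
    show "b \<odot>\<^bsub>Q\<^esub> x \<in> pr ` I" if "x \<in> pr ` I" for b x
      using that c d(4) by (auto simp: pr_smult)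
    show "x \<otimes>\<^bsub>Q\<^esub> y \<in> pr ` I \<and> y \<otimes>\<^bsub>Q\<^esub> x \<in> pr ` I" if "x \<in> carrier Q" "y \<in> pr ` I" for x y
      using that c d(6,7) by (auto simp: pr_mult carrier_Q)
  qed
qed

end

context trace_graph begin

section \<open>The Lie superalgebra of a marked graph as a quotient of the free nonassociative algebra\<close>

abbreviation A0 :: "('i, 'i magma \<Rightarrow>\<^sub>0 complex) superalgebra" where
  "A0 \<equiv> free_nonassoc (verts G) (odd_verts G)"

definition Car :: "('i magma \<Rightarrow>\<^sub>0 complex) set" where
  "Car = {x. \<forall>t\<in>keys x. letters t \<subseteq> verts G}"

definition bracket :: "('i magma \<Rightarrow>\<^sub>0 complex) \<Rightarrow> ('i magma \<Rightarrow>\<^sub>0 complex) \<Rightarrow> 'i magma \<Rightarrow>\<^sub>0 complex" where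
  "bracket x y = lin (\<lambda>s. lin (\<lambda>t. single (Br s t) 1) y) x"

lemma A0_carrier: "carrier A0 = Car"
  and A0_zero: "\<zero>\<^bsub>A0\<^esub> = 0"
  and A0_add: "x \<oplus>\<^bsub>A0\<^esub> y = x + y"
  and A0_smult: "c \<odot>\<^bsub>A0\<^esub> x = psc c x"
  by (simp_all add: free_nonassoc_def Car_def psc_def)

lemma A0_mult: "x \<otimes>\<^bsub>A0\<^esub> y = bracket x y"
  by (simp add: free_nonassoc_def bracket_def lin_def pm.scale_sum_right)

lemma bracket_add_left: "bracket (x + y) z = bracket x z + bracket y z"
  and bracket_add_right: "bracket z (x + y) = bracket z x + bracket z y"
  and bracket_psc_left: "bracket (psc c x) z = psc c (bracket x z)"
  and bracket_psc_right: "bracket z (psc c x) = psc c (bracket z x)"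
  and bracket_single: "bracket (single s 1) (single t 1) = single (Br s t) 1"
  by (simp_all add: bracket_def lin_add lin_psc lin_fun_add lin_fun_psc lin_minus lin_fun_minus)

lemma subspace_Car: "pm.subspace Car"
  unfolding Car_def by (rule subspace_keys)

lemmas Car_0 = pm.subspace_0[OF subspace_Car]
lemmas Car_add = pm.subspace_add[OF subspace_Car]
lemmas Car_diff = pm.subspace_diff[OF subspace_Car]
lemmas Car_neg = pm.subspace_neg[OF subspace_Car]
lemmas Car_scale = pm.subspace_scale[OF subspace_Car]

lemma single_Car: "letters t \<subseteq> verts G \<Longrightarrow> single t c \<in> Car"
  by (simp add: Car_def)

lemma bracket_Car:
  assumes "x \<in> Car" "y \<in> Car"
  shows "bracket x y \<in> Car"
proof -
  have "lin (\<lambda>t. single (Br s t) 1) y \<in> Car" if "s \<in> keys x" for s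
    using assms that by (intro subspace_lin[OF subspace_Car] single_Car) (auto simp: Car_def)
  then show ?thesis unfolding bracket_def by (rule subspace_lin[OF subspace_Car])
qed

lemma A0_bilinear: "bilinear_algebra A0"
proof -
  note s = Car_add Car_0 Car_scale
  have "abelian_group A0"
  proof (rule abelian_groupI)
    show "\<exists>y\<in>carrier A0. y \<oplus>\<^bsub>A0\<^esub> x = \<zero>\<^bsub>A0\<^esub>" if "x \<in> carrier A0" for x
      using that pm.subspace_neg[OF subspace_Car, of x]
      by (intro bexI[of _ "- x"]) (simp_all add: A0_carrier A0_zero A0_add)
  qed (simp_all add: A0_carrier A0_zero A0_add s add_ac)
  then have "Module.module class_ring A0"
    by (intro moduleI class_cring.is_cring)
      (simp_all add: class_ring_simps A0_carrier A0_add A0_smult s pm.scale_left_distrib pm.scale_right_distrib)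
  then show ?thesis
    by (simp add: bilinear_algebra_def A0_carrier A0_add A0_mult bracket_Car bracket_add_left bracket_add_right)
qed

interpretation A0: bilinear_algebra A0 by (rule A0_bilinear)

lemma A0_uminus: "x \<in> Car \<Longrightarrow> \<ominus>\<^bsub>A0\<^esub> x = - x"
  using pm.subspace_neg[OF subspace_Car, of x]
  by (intro A0.minus_equality) (simp_all add: A0_carrier A0_add A0_zero)

lemma A0_minus: "y \<in> Car \<Longrightarrow> x \<ominus>\<^bsub>A0\<^esub> y = x - y"
  by (simp add: a_minus_def A0_uminus A0_add)

lemma parity_part_A0: "parity_part A0 p = {x \<in> Car. \<forall>t\<in>keys x. odd_word t = p}"
  by (auto simp: free_nonassoc_def Car_def)

lemma degree_part_A0: "degree_part A0 m = {x \<in> Car. \<forall>t\<in>keys x. word_degree t = m}"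
  by (auto simp: free_nonassoc_def Car_def)

lemma lie_relators_Car: "lie_relators A0 \<subseteq> Car"
proof -
  have p: "x \<in> Car" if "x \<in> parity_part A0 p" for x p using that by (auto simp: parity_part_A0)
  show ?thesis
    by (auto simp: lie_relators_def A0_mult A0_add A0_smult A0_minus p bracket_Car
        Car_add Car_scale Car_diff)
qed

abbreviation J1 :: "('i magma \<Rightarrow>\<^sub>0 complex) set" where
  "J1 \<equiv> ideal_generated A0 (lie_relators A0)"

lemma J1_ideal: "algebra_ideal J1 A0"
  using A0.ideal_generated(1) lie_relators_Car A0_carrier by simp

interpretation q1: algebra_quotient A0 J1
  by (intro algebra_quotient.intro A0_bilinear) (unfold_locales, rule J1_ideal)

abbreviation FL :: "('i, ('i magma \<Rightarrow>\<^sub>0 complex) set) superalgebra" where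
  "FL \<equiv> quotient_algebra A0 J1"

lemma free_lie_FL: "free_lie (verts G) (odd_verts G) = FL"
  by (simp add: free_lie_def)

lemma free_lie_gen_pr: "free_lie_gen (verts G) (odd_verts G) i = q1.pr (single (Gen i) 1)"
  by (simp add: free_lie_gen_def)

interpretation FL: bilinear_algebra FL by (rule q1.Q_bilinear)

lemma graph_relators_eq:
  "graph_relators G =
    q1.pr ` ({single (Br (Gen i) (Gen j)) 1 | i j. i \<in> verts G \<and> j \<in> verts G \<and> \<not> dep i j} \<union>
      {single (Br (Gen i) (Gen i)) 1 | i. i \<in> iso_verts G})"
proof -
  have "iso_verts G \<subseteq> verts G" using simple by (auto simp: marked_simple_graph_def)
  then have e: "q1.pr (single (Gen i) 1) \<otimes>\<^bsub>FL\<^esub> q1.pr (single (Gen j) 1)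
     = q1.pr (single (Br (Gen i) (Gen j)) 1)"
    if "i \<in> verts G \<or> i \<in> iso_verts G" "j \<in> verts G \<or> j \<in> iso_verts G" for i j
    using that by (subst q1.pr_mult) (auto simp: A0_carrier single_Car A0_mult bracket_single)
  show ?thesis
    unfolding graph_relators_def Let_def free_lie_FL free_lie_gen_pr image_Un dep_def
    by (rule arg_cong2[where f = "(\<union>)"]; force simp: e)
qed

lemma graph_relators_carrier: "graph_relators G \<subseteq> carrier FL"
proof -
  have "iso_verts G \<subseteq> verts G" using simple by (auto simp: marked_simple_graph_def)
  then show ?thesis
    unfolding graph_relators_eq q1.carrier_Q A0_carrier by (intro image_mono) (auto simp: single_Car)
qed

abbreviation J2 :: "('i magma \<Rightarrow>\<^sub>0 complex) set set" where
  "J2 \<equiv> ideal_generated FL (graph_relators G)"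

lemma J2_ideal: "algebra_ideal J2 FL"
  using FL.ideal_generated(1) graph_relators_carrier by simp

interpretation q2: algebra_quotient FL J2
  by (intro algebra_quotient.intro q1.Q_bilinear) (unfold_locales, rule J2_ideal)

abbreviation PL :: "('i, ('i magma \<Rightarrow>\<^sub>0 complex) set set) superalgebra" where
  "PL \<equiv> quotient_algebra FL J2"

lemma partial_comm_lie_PL: "partial_comm_lie G = PL"
  by (simp add: partial_comm_lie_def free_lie_FL Let_def)

interpretation PL: bilinear_algebra PL by (rule q2.Q_bilinear)

definition qmap :: "('i magma \<Rightarrow>\<^sub>0 complex) \<Rightarrow> ('i magma \<Rightarrow>\<^sub>0 complex) set set" where
  "qmap x = q2.pr (q1.pr x)"

text \<open>P is a quotient of a quotient. This preimage collapses both steps into one ideal of the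
  free nonassociative algebra (\<open>qmap_eq_iff\<close>), with \<open>rel_ideal_minimal\<close> as
  universal property.\<close>

definition rel_ideal :: "('i magma \<Rightarrow>\<^sub>0 complex) set" where
  "rel_ideal = {x \<in> Car. q1.pr x \<in> J2}"

lemma qmap_add: "x \<in> Car \<Longrightarrow> y \<in> Car \<Longrightarrow> qmap x \<oplus>\<^bsub>PL\<^esub> qmap y = qmap (x + y)"
  by (simp add: qmap_def q2.pr_add q1.pr_add q1.carrier_Q A0_carrier A0_add)

lemma qmap_smult: "x \<in> Car \<Longrightarrow> c \<odot>\<^bsub>PL\<^esub> qmap x = qmap (psc c x)"
  by (simp add: qmap_def q2.pr_smult q1.pr_smult q1.carrier_Q A0_carrier A0_smult)

lemma qmap_zero: "qmap 0 = \<zero>\<^bsub>PL\<^esub>"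
  using q1.pr_zero q2.pr_zero by (simp add: qmap_def A0_zero)

lemma qmap_carrier: "x \<in> Car \<Longrightarrow> qmap x \<in> carrier PL"
  by (simp add: qmap_def q2.carrier_Q q1.carrier_Q A0_carrier)

lemma qmap_eq_iff:
  assumes "x \<in> Car" "y \<in> Car"
  shows "qmap x = qmap y \<longleftrightarrow> x - y \<in> rel_ideal"
proof -
  have c: "q1.pr z \<in> carrier FL" if "z \<in> Car" for z using that by (simp add: q1.carrier_Q A0_carrier)
  have n: "- y \<in> Car" using assms(2) by (rule Car_neg)
  have "q1.pr (- y) \<oplus>\<^bsub>FL\<^esub> q1.pr y = \<zero>\<^bsub>FL\<^esub>"
    using assms n q1.pr_zero by (simp add: q1.pr_add A0_carrier A0_add A0_zero)
  then have "\<ominus>\<^bsub>FL\<^esub> q1.pr y = q1.pr (- y)"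
    using c assms n by (intro FL.minus_equality) auto
  then have "qmap x = qmap y \<longleftrightarrow> q1.pr (x - y) \<in> J2"
    unfolding qmap_def using c assms n by (simp add: q2.pr_eq_iff q1.pr_add A0_carrier A0_add)
  then show ?thesis using Car_diff[OF assms] by (simp add: rel_ideal_def)
qed

lemma rel_ideal_ideal: "algebra_ideal rel_ideal A0"
  using q1.ideal_vimage[OF J2_ideal] by (simp add: rel_ideal_def A0_carrier)

lemma subspace_rel_ideal: "pm.subspace rel_ideal"
  using A0.algebra_idealD(2-4)[OF rel_ideal_ideal]
  by (auto simp: pm.subspace_def A0_zero A0_add A0_smult)

lemmas rel_ideal_0 = pm.subspace_0[OF subspace_rel_ideal]
lemmas rel_ideal_add = pm.subspace_add[OF subspace_rel_ideal]
lemmas rel_ideal_diff = pm.subspace_diff[OF subspace_rel_ideal]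
lemmas rel_ideal_scale = pm.subspace_scale[OF subspace_rel_ideal]

lemma bracket_rel_ideal: "x \<in> Car \<Longrightarrow> y \<in> rel_ideal \<Longrightarrow> bracket x y \<in> rel_ideal" "x \<in> Car \<Longrightarrow> y \<in> rel_ideal \<Longrightarrow> bracket y x \<in> rel_ideal"
  using A0.algebra_idealD(6,7)[OF rel_ideal_ideal] by (auto simp: A0_carrier A0_mult)

lemma rel_ideal_Car: "rel_ideal \<subseteq> Car"
  by (auto simp: rel_ideal_def)

lemma lie_relators_rel_ideal: "lie_relators A0 \<subseteq> rel_ideal"
proof
  fix x assume x: "x \<in> lie_relators A0"
  then have "x \<in> Car" "x \<in> J1" using lie_relators_Car A0.ideal_generated(2) A0_carrier by auto
  then have "q1.pr x = J1" using q1.a_rcos_const by simp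
  then have "q1.pr x = \<zero>\<^bsub>FL\<^esub>" using q1.zero_Q by simp
  then show "x \<in> rel_ideal" using FL.algebra_idealD(2)[OF J2_ideal] \<open>x \<in> Car\<close> by (simp add: rel_ideal_def)
qed

lemma comm_rel_ideal:
  shows "i \<in> verts G \<Longrightarrow> j \<in> verts G \<Longrightarrow> \<not> dep i j \<Longrightarrow> single (Br (Gen i) (Gen j)) 1 \<in> rel_ideal"
    and "i \<in> iso_verts G \<Longrightarrow> single (Br (Gen i) (Gen i)) 1 \<in> rel_ideal"
proof -
  have "graph_relators G \<subseteq> J2" using FL.ideal_generated(2)[OF graph_relators_carrier] .
  then have *: "q1.pr x \<in> J2" if "x \<in> {single (Br (Gen i) (Gen j)) 1 | i j. i \<in> verts G \<and> j \<in> verts G \<and> \<not> dep i j} \<union>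
      {single (Br (Gen i) (Gen i)) 1 | i. i \<in> iso_verts G}" for x
    unfolding graph_relators_eq using that by (blast dest: subsetD)
  show "i \<in> verts G \<Longrightarrow> j \<in> verts G \<Longrightarrow> \<not> dep i j \<Longrightarrow> single (Br (Gen i) (Gen j)) 1 \<in> rel_ideal"
    unfolding rel_ideal_def using * by (auto simp: single_Car)
  show "i \<in> iso_verts G \<Longrightarrow> single (Br (Gen i) (Gen i)) 1 \<in> rel_ideal"
    unfolding rel_ideal_def using * odd_letter_verts iso_odd by (auto simp: single_Car)
qed

text \<open>The image of \<open>J'\<close> in the free Lie superalgebra is an ideal that contains
  the graph relators, hence \<open>J2\<close>. A lift to \<open>J'\<close> may differ from x by an
  element of \<open>J1\<close>, which \<open>J'\<close> also contains.\<close>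

lemma rel_ideal_minimal:
  assumes id: "algebra_ideal J' A0" and lie: "lie_relators A0 \<subseteq> J'"
    and comm: "\<And>i j. i \<in> verts G \<Longrightarrow> j \<in> verts G \<Longrightarrow> \<not> dep i j \<Longrightarrow> single (Br (Gen i) (Gen j)) 1 \<in> J'"
    and iso: "\<And>i. i \<in> iso_verts G \<Longrightarrow> single (Br (Gen i) (Gen i)) 1 \<in> J'"
  shows "rel_ideal \<subseteq> J'"
proof
  fix x assume x: "x \<in> rel_ideal"
  have J1: "J1 \<subseteq> J'" using A0.ideal_generated(3)[OF _ id lie] lie_relators_Car A0_carrier by auto
  have "graph_relators G \<subseteq> q1.pr ` J'"
    unfolding graph_relators_eq using comm iso by (intro image_mono) auto
  then have "J2 \<subseteq> q1.pr ` J'"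
    using FL.ideal_generated(3)[OF graph_relators_carrier q1.ideal_image[OF id]] by simp
  then obtain y where y: "y \<in> J'" "q1.pr x = q1.pr y" using x by (auto simp: rel_ideal_def)
  have c: "x \<in> Car" "y \<in> Car" using x y rel_ideal_Car A0.algebra_idealD(1)[OF id] A0_carrier by auto
  then have "x + - y \<in> J1"
    using y q1.pr_eq_iff[of x y] by (simp add: A0_carrier A0_uminus A0_add)
  then have "(x + - y) + y \<in> J'"
    using J1 A0.algebra_idealD(3)[OF id, of "x + - y" y] y by (auto simp: A0_add)
  then show "x \<in> J'" by simp
qed

section \<open>Embedding into the associative algebra\<close>

definition phi :: "('i magma \<Rightarrow>\<^sub>0 complex) \<Rightarrow> 'i list \<Rightarrow>\<^sub>0 complex" where
  "phi = lin lie"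

lemma phi_add: "phi (x + y) = phi x + phi y"
  and phi_psc: "phi (psc c x) = psc c (phi x)"
  and phi_minus: "phi (x - y) = phi x - phi y"
  and phi_0 [simp]: "phi 0 = 0"
  and phi_single: "phi (single t c) = psc c (lie t)"
  by (simp_all add: phi_def lin_add lin_psc lin_minus)

lemma paut_lie: "paut p (lie t) = psc (super_sign p (odd_word t)) (lie t)"
  using paut_lie_mult[of p t 1] paut_homog[of 1 "{#}" p] by (simp add: homog_def zero_list_def psgn_def)

text \<open>For inhomogeneous elements the sign depends on the parity of each word of x, so x is
  expanded while y is kept whole. The result lies in \<open>K\<close> whenever \<open>phi y\<close>
  does, as \<open>phi_rel_ideal\<close> requires; \<open>phi_bracket_left\<close> is the mirror
  image.\<close>

lemma phi_bracket_right: "phi (bracket x y) = lin (\<lambda>s. lie s * phi y - paut (odd_word s) (phi y) * lie s) x"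
proof -
  have "phi (bracket (single s 1) y) = lie s * phi y - paut (odd_word s) (phi y) * lie s" for s
    by (rule linear_eqI[where F = "\<lambda>y. phi (bracket (single s 1) y)"
          and G = "\<lambda>y. lie s * phi y - paut (odd_word s) (phi y) * lie s"])
      (simp_all add: bracket_add_right bracket_psc_right phi_add phi_psc paut_add paut_psc distrib_left distrib_right
        psc_mult_left psc_mult_right pm.scale_right_diff_distrib bracket_single phi_single paut_lie)
  note * = this
  show ?thesis
    by (rule linear_eqI[where F = "\<lambda>x. phi (bracket x y)"])
      (simp_all add: bracket_add_left bracket_psc_left phi_add phi_psc lin_add lin_psc *)
qed

lemma phi_bracket_left: "phi (bracket x y) = lin (\<lambda>t. phi x * lie t - lie t * paut (odd_word t) (phi x)) y"
proof -
  have "phi (bracket x (single t 1)) = phi x * lie t - lie t * paut (odd_word t) (phi x)" for t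
    by (rule linear_eqI[where F = "\<lambda>x. phi (bracket x (single t 1))"
          and G = "\<lambda>x. phi x * lie t - lie t * paut (odd_word t) (phi x)"])
      (simp_all add: bracket_add_left bracket_psc_left phi_add phi_psc paut_add paut_psc distrib_left distrib_right
        psc_mult_left psc_mult_right pm.scale_right_diff_distrib bracket_single phi_single paut_lie
        super_sign_def conj_commute)
  note * = this
  show ?thesis
    by (rule linear_eqI[where F = "\<lambda>y. phi (bracket x y)"])
      (simp_all add: bracket_add_right bracket_psc_right phi_add phi_psc lin_add lin_psc *)
qed

lemma phi_bracket_parity:
  assumes "x \<in> parity_part A0 p" "y \<in> parity_part A0 q"
  shows "phi (bracket x y) = phi x * phi y - psc (super_sign p q) (phi y * phi x)"
proof -
  have paut: "paut q (phi x) = psc (super_sign p q) (phi x)"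
  proof -
    have "paut q (phi x) = lin (\<lambda>t. paut q (lie t)) x"
      by (rule linear_eqI[where F = "\<lambda>x. paut q (phi x)"]) (simp_all add: phi_add phi_psc paut_add paut_psc lin_add lin_psc phi_single)
    also have "\<dots> = lin (\<lambda>t. psc (super_sign p q) (lie t)) x"
      using assms(1) by (intro lin_cong) (auto simp: paut_lie parity_part_A0 super_sign_def)
    finally show ?thesis by (simp add: lin_fun_psc phi_def)
  qed
  have "phi (bracket x y) = lin (\<lambda>t. phi x * lie t - psc (super_sign p q) (lie t * phi x)) y"
    unfolding phi_bracket_left using assms(2) by (intro lin_cong) (auto simp: parity_part_A0 paut psc_mult_right)
  also have "\<dots> = phi x * phi y - psc (super_sign p q) (phi y * phi x)"
    by (rule linear_eqI[where F = "lin (\<lambda>t. phi x * lie t - psc (super_sign p q) (lie t * phi x))"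
          and G = "\<lambda>y. phi x * phi y - psc (super_sign p q) (phi y * phi x)"])
      (simp_all add: lin_add lin_psc phi_add phi_psc distrib_left distrib_right pm.scale_right_distrib
        psc_mult_left psc_mult_right pm.scale_right_diff_distrib phi_single mult.commute)
  finally show ?thesis .
qed

lemma bracket_parity:
  assumes "x \<in> parity_part A0 p" "y \<in> parity_part A0 q"
  shows "bracket x y \<in> parity_part A0 (p \<noteq> q)"
proof -
  have "pm.subspace (parity_part A0 r)" for r
  proof -
    have "parity_part A0 r = {x. \<forall>t\<in>keys x. letters t \<subseteq> verts G \<and> odd_word t = r}"
      by (auto simp: parity_part_A0 Car_def)
    then show ?thesis by (simp only: subspace_keys)
  qed
  note S = this
  have "lin (\<lambda>t. single (Br s t) 1) y \<in> parity_part A0 (p \<noteq> q)" if "s \<in> keys x" for s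
    using assms that by (intro subspace_lin[OF S]) (auto simp: parity_part_A0 Car_def)
  then show ?thesis unfolding bracket_def by (rule subspace_lin[OF S])
qed

text \<open>Supercommutators in an associative algebra satisfy skew-symmetry and the Jacobi
  identity; expansion over the possible parities confirms the signs.\<close>

lemma phi_lie_relators: "x \<in> lie_relators A0 \<Longrightarrow> phi x = 0"
proof -
  have c: "x \<in> Car" if "x \<in> parity_part A0 p" for x p using that by (simp add: parity_part_A0)
  have 1: "phi (bracket x y + psc (super_sign p q) (bracket y x)) = 0"
    if "x \<in> parity_part A0 p" "y \<in> parity_part A0 q" for x y p q
    using that by (cases p; cases q)
      (simp_all add: phi_add phi_minus phi_psc phi_bracket_parity super_sign_def pm.scale_right_diff_distrib)
  have 2: "phi (bracket x (bracket y z) - (bracket (bracket x y) z + psc (super_sign p q) (bracket y (bracket x z)))) = 0"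
    if x: "x \<in> parity_part A0 p" and y: "y \<in> parity_part A0 q" and z: "z \<in> parity_part A0 r" for x y z p q r
    unfolding phi_minus phi_add phi_psc
      phi_bracket_parity[OF x bracket_parity[OF y z]] phi_bracket_parity[OF bracket_parity[OF x y] z] phi_bracket_parity[OF y bracket_parity[OF x z]]
      phi_bracket_parity[OF x y] phi_bracket_parity[OF x z] phi_bracket_parity[OF y z]
    by (cases p; cases q; cases r) (simp_all add: super_sign_def algebra_simps)
  assume "x \<in> lie_relators A0"
  then consider x' y' p q where "x' \<in> parity_part A0 p" "y' \<in> parity_part A0 q"
      "x = bracket x' y' + psc (super_sign p q) (bracket y' x')"
    | x' y' z' p q r where "x' \<in> parity_part A0 p" "y' \<in> parity_part A0 q" "z' \<in> parity_part A0 r"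
      "x = bracket x' (bracket y' z') - (bracket (bracket x' y') z' + psc (super_sign p q) (bracket y' (bracket x' z')))"
    unfolding lie_relators_def A0_mult A0_add A0_smult
    using A0_minus bracket_Car c Car_add Car_scale by auto
  then show ?thesis using 1 2 by cases auto
qed

lemma phi_rel_ideal: "x \<in> rel_ideal \<Longrightarrow> phi x \<in> K"
proof -
  interpret A0: bilinear_algebra A0 by (rule A0_bilinear)
  let ?J = "{x \<in> Car. phi x \<in> K}"
  have "algebra_ideal ?J A0"
  proof (rule A0.algebra_idealI)
    fix x y assume x: "x \<in> carrier A0" and y: "y \<in> ?J"
    have "phi (bracket x y) \<in> K"
      unfolding phi_bracket_right
      using y by (intro subspace_lin[OF subspace_K] K_diff K_mult_left K_mult_right paut_K) auto
    moreover have "phi (bracket y x) \<in> K"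
      unfolding phi_bracket_left
      using y by (intro subspace_lin[OF subspace_K] K_diff K_mult_left K_mult_right paut_K) auto
    ultimately show "x \<otimes>\<^bsub>A0\<^esub> y \<in> ?J \<and> y \<otimes>\<^bsub>A0\<^esub> x \<in> ?J"
      using x y bracket_Car by (simp add: A0_mult A0_carrier)
  qed (auto simp: A0_carrier A0_zero A0_add A0_smult phi_add phi_psc
      K_add K_scale K_0
      Car_add Car_scale Car_0)
  moreover have "lie_relators A0 \<subseteq> ?J"
    using lie_relators_Car phi_lie_relators K_0 by auto
  moreover have "single (Br (Gen i) (Gen j)) 1 \<in> ?J"
    if "i \<in> verts G" "j \<in> verts G" "\<not> dep i j" for i j
    using letters_in_K(1)[OF that(3)] that by (simp add: phi_single mult_single_list single_Car)
  moreover have "single (Br (Gen i) (Gen i)) 1 \<in> ?J" if "i \<in> iso_verts G" for i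
  proof -
    \<comment> \<open>An isotropic generator is odd, so its bracket with itself is twice its
      square.\<close>
    have "phi (single (Br (Gen i) (Gen i)) 1) = single [i, i] 1 + single [i, i] 1"
      using iso_odd[OF that] by (simp add: phi_single mult_single_list super_sign_def single_uminus)
    moreover have "\<dots> \<in> K" using letters_in_K(2)[OF that] by (intro K_add)
    ultimately show ?thesis using odd_letter_verts[OF iso_odd[OF that]] by (simp add: single_Car)
  qed
  ultimately have "rel_ideal \<subseteq> ?J" by (rule rel_ideal_minimal)
  then show "x \<in> rel_ideal \<Longrightarrow> phi x \<in> K" by blast
qed

section \<open>The Dynkin operator and the theorem of Dynkin, Specht and Wever\<close>

primrec ad_word :: "'i list \<Rightarrow> ('i magma \<Rightarrow>\<^sub>0 complex) \<Rightarrow> 'i magma \<Rightarrow>\<^sub>0 complex" where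
  "ad_word [] y = y"
| "ad_word (a # w) y = bracket (single (Gen a) 1) (ad_word w y)"

text \<open>The right-normed bracketing [a, [b, [c, ...]]]. The value 0 at the empty word is a
  convention; that word occurs in no Lie element (\<open>keys_lie_nonempty\<close>).\<close>

primrec dynkin :: "'i list \<Rightarrow> 'i magma \<Rightarrow>\<^sub>0 complex" where
  "dynkin [] = 0"
| "dynkin (a # w) = (if w = [] then single (Gen a) 1 else bracket (single (Gen a) 1) (dynkin w))"

definition ad :: "('i list \<Rightarrow>\<^sub>0 complex) \<Rightarrow> ('i magma \<Rightarrow>\<^sub>0 complex) \<Rightarrow> 'i magma \<Rightarrow>\<^sub>0 complex" where
  "ad x y = lin (\<lambda>w. ad_word w y) x"

lemma ad_word_add: "ad_word w (x + y) = ad_word w x + ad_word w y"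
  and ad_word_psc: "ad_word w (psc c x) = psc c (ad_word w x)"
  by (induction w) (simp_all add: bracket_add_right bracket_psc_right)

lemma ad_word_append: "ad_word (u @ v) y = ad_word u (ad_word v y)"
  by (induction u) simp_all

lemma dynkin_append: "v \<noteq> [] \<Longrightarrow> dynkin (u @ v) = ad_word u (dynkin v)"
  by (induction u) simp_all

lemma ad_word_rel_ideal: "set w \<subseteq> verts G \<Longrightarrow> y \<in> rel_ideal \<Longrightarrow> ad_word w y \<in> rel_ideal"
  by (induction w) (auto intro!: bracket_rel_ideal(1) single_Car)

lemma dynkin_Car: "set w \<subseteq> verts G \<Longrightarrow> dynkin w \<in> Car"
  by (induction w) (auto intro!: bracket_Car single_Car Car_0)

lemma ad_add: "ad x (y + z) = ad x y + ad x z"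
  and ad_psc: "ad x (psc c y) = psc c (ad x y)"
  by (simp_all add: ad_def ad_word_add ad_word_psc lin_fun_add lin_fun_psc)

lemma ad_minus: "ad x (y - z) = ad x y - ad x z"
  using ad_add[of x "y - z" z] by simp

lemma ad_mult: "ad (x * x') y = ad x (ad x' y)"
proof -
  have 1: "ad (single u 1 * x') y = ad_word u (ad x' y)" for u
    by (rule linear_eqI[where F = "\<lambda>x'. ad (single u 1 * x') y" and G = "\<lambda>x'. ad_word u (ad x' y)"])
      (simp_all add: ad_def distrib_left psc_mult_right lin_add lin_psc ad_word_add ad_word_psc mult_single_list ad_word_append)
  show ?thesis
    by (rule linear_eqI[where F = "\<lambda>x. ad (x * x') y" and G = "\<lambda>x. ad x (ad x' y)"])
      (simp_all add: ad_def[of _ "ad x' y"] lin_add lin_psc 1 distrib_right psc_mult_left, simp_all add: ad_def lin_add lin_psc)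
qed

lemma keys_lie: "w \<in> keys (lie t) \<Longrightarrow> mset w = mdeg t"
  using homog_lie[of t] by (simp add: homog_def)

lemma set_mdeg: "set_mset (mdeg t) = letters t"
  by (induction t) auto

lemma keys_lie_letters: "w \<in> keys (lie t) \<Longrightarrow> set w = letters t"
  using keys_lie[of w t] set_mdeg[of t] by (metis set_mset_mset)

lemma keys_lie_nonempty: "w \<in> keys (lie t) \<Longrightarrow> w \<noteq> []"
  using keys_lie[of w t] by auto

lemma ad_lie_rel_ideal: "letters t \<subseteq> verts G \<Longrightarrow> y \<in> rel_ideal \<Longrightarrow> ad (lie t) y \<in> rel_ideal"
  unfolding ad_def by (intro subspace_lin[OF subspace_rel_ideal] ad_word_rel_ideal) (auto dest: keys_lie_letters)

lemma jacobi_rel_ideal: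
  assumes "letters s \<subseteq> verts G" "letters t \<subseteq> verts G" "z \<in> Car"
  shows "bracket (single s 1) (bracket (single t 1) z)
     - (bracket (single (Br s t) 1) z
        + psc (super_sign (odd_word s) (odd_word t)) (bracket (single t 1) (bracket (single s 1) z))) \<in> rel_ideal"
    (is "?F z \<in> rel_ideal")
proof -
  have par: "single u 1 \<in> parity_part A0 (odd_word u)" if "letters u \<subseteq> verts G" for u
    using that by (simp add: parity_part_A0 single_Car)
  have "?F (single u 1) \<in> rel_ideal" if u: "letters u \<subseteq> verts G" for u
  proof (rule subsetD[OF lie_relators_rel_ideal])
    have eq: "?F (single u 1) = single s 1 \<otimes>\<^bsub>A0\<^esub> (single t 1 \<otimes>\<^bsub>A0\<^esub> single u 1)
      \<ominus>\<^bsub>A0\<^esub> ((single s 1 \<otimes>\<^bsub>A0\<^esub> single t 1) \<otimes>\<^bsub>A0\<^esub> single u 1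
        \<oplus>\<^bsub>A0\<^esub> super_sign (odd_word s) (odd_word t) \<odot>\<^bsub>A0\<^esub> (single t 1 \<otimes>\<^bsub>A0\<^esub> (single s 1 \<otimes>\<^bsub>A0\<^esub> single u 1)))"
      using assms u
      by (subst A0_minus) (auto simp: A0_mult A0_add A0_smult bracket_single single_Car
          intro!: Car_add)
    show "?F (single u 1) \<in> lie_relators A0"
      unfolding eq lie_relators_def
      using par[OF assms(1)] par[OF assms(2)] par[OF u] by blast
  qed
  then have "lin (\<lambda>u. ?F (single u 1)) z \<in> rel_ideal"
    using assms(3) by (intro subspace_lin[OF subspace_rel_ideal]) (auto simp: Car_def)
  moreover have "?F z = lin (\<lambda>u. ?F (single u 1)) z"
    by (rule linear_eq_lin[where F = ?F])
      (simp_all add: bracket_add_right bracket_psc_right pm.scale_right_distrib pm.scale_right_diff_distrib mult.commute)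
  ultimately show ?thesis by simp
qed

text \<open>By the Jacobi identity the adjoint action of a bracket is the supercommutator of the
  adjoint actions. Hence, modulo the relations, nested brackets along \<open>lie t\<close> amount to
  the bracket with t.\<close>

lemma ad_lie:
  assumes "letters t \<subseteq> verts G" "y \<in> Car"
  shows "ad (lie t) y - bracket (single t 1) y \<in> rel_ideal"
  using assms
proof (induction t arbitrary: y)
  case (Gen a)
  then show ?case by (simp add: ad_def rel_ideal_0)
next
  case (Br s t)
  let ?s = "single s 1" and ?t = "single t 1" and ?c = "super_sign (odd_word s) (odd_word t)"
  have l: "letters s \<subseteq> verts G" "letters t \<subseteq> verts G" using Br.prems by auto
  have st: "ad (lie s) (ad (lie t) y) - bracket (single s 1) (bracket (single t 1) y) \<in> rel_ideal"
    if IH: "\<And>y. y \<in> Car \<Longrightarrow> ad (lie s) y - bracket (single s 1) y \<in> rel_ideal"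
      "\<And>y. y \<in> Car \<Longrightarrow> ad (lie t) y - bracket (single t 1) y \<in> rel_ideal"
      and l: "letters s \<subseteq> verts G" "letters t \<subseteq> verts G" and y: "y \<in> Car" for s t y
  proof -
    have "ad (lie s) (ad (lie t) y - bracket (single t 1) y)
      + (ad (lie s) (bracket (single t 1) y) - bracket (single s 1) (bracket (single t 1) y)) \<in> rel_ideal"
      by (intro rel_ideal_add ad_lie_rel_ideal IH bracket_Car single_Car l y)
    then show ?thesis by (simp add: ad_minus)
  qed
  have "(ad (lie s) (ad (lie t) y) - bracket ?s (bracket ?t y)) - psc ?c (ad (lie t) (ad (lie s) y) - bracket ?t (bracket ?s y))
     + (bracket ?s (bracket ?t y) - (bracket (single (Br s t) 1) y + psc ?c (bracket ?t (bracket ?s y)))) \<in> rel_ideal"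
    by (intro rel_ideal_add rel_ideal_diff rel_ideal_scale
        jacobi_rel_ideal st Br.IH l Br.prems(2))
  moreover have eq: "ad (lie (Br s t)) y = ad (lie s) (ad (lie t) y) - psc ?c (ad (lie t) (ad (lie s) y))"
    by (simp add: ad_mult[symmetric]) (simp add: ad_def lin_minus lin_psc)
  ultimately show ?case unfolding eq by (simp add: pm.scale_right_diff_distrib algebra_simps)
qed

text \<open>The innermost letter always comes from \<open>lie t\<close>, which contains no empty
  word, so everything in front of it acts by nested brackets.\<close>

lemma dynkin_mult_lie: "lin dynkin (x * lie t) = ad x (lin dynkin (lie t))"
proof -
  have 1: "lin dynkin (single u 1 * lie t) = ad_word u (lin dynkin (lie t))" for u
  proof -
    have "single u 1 * lie t = lin (\<lambda>w. single (u @ w) 1) (lie t)"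
      by (rule linear_eqI[where F = "\<lambda>y. single u 1 * y"])
        (simp_all add: distrib_left psc_mult_right lin_add lin_psc mult_single_list)
    then have "lin dynkin (single u 1 * lie t) = lin (\<lambda>w. dynkin (u @ w)) (lie t)"
      by (simp add: lin_lin)
    also have "\<dots> = lin (\<lambda>w. ad_word u (dynkin w)) (lie t)"
      by (intro lin_cong dynkin_append) (rule keys_lie_nonempty)
    also have "\<dots> = ad_word u (lin dynkin (lie t))"
      by (rule linear_eqI[where F = "lin (\<lambda>w. ad_word u (dynkin w))" and G = "\<lambda>x. ad_word u (lin dynkin x)"])
        (simp_all add: lin_add lin_psc ad_word_add ad_word_psc)
    finally show ?thesis .
  qed
  show ?thesis
    by (rule linear_eqI[where F = "\<lambda>x. lin dynkin (x * lie t)" and G = "\<lambda>x. ad x (lin dynkin (lie t))"])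
      (simp_all add: ad_def lin_add lin_psc distrib_right psc_mult_left 1)
qed

lemma skew_rel_ideal:
  assumes "letters s \<subseteq> verts G" "letters t \<subseteq> verts G"
  shows "single (Br s t) 1 + psc (super_sign (odd_word s) (odd_word t)) (single (Br t s) 1) \<in> rel_ideal"
proof (rule subsetD[OF lie_relators_rel_ideal])
  have par: "single u 1 \<in> parity_part A0 (odd_word u)" if "letters u \<subseteq> verts G" for u
    using that by (simp add: parity_part_A0 single_Car)
  have eq: "single (Br s t) 1 + psc (super_sign (odd_word s) (odd_word t)) (single (Br t s) 1)
    = single s 1 \<otimes>\<^bsub>A0\<^esub> single t 1
      \<oplus>\<^bsub>A0\<^esub> super_sign (odd_word s) (odd_word t) \<odot>\<^bsub>A0\<^esub> (single t 1 \<otimes>\<^bsub>A0\<^esub> single s 1)"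
    by (simp add: A0_mult A0_add A0_smult bracket_single)
  show "single (Br s t) 1 + psc (super_sign (odd_word s) (odd_word t)) (single (Br t s) 1) \<in> lie_relators A0"
    unfolding eq lie_relators_def using par[OF assms(1)] par[OF assms(2)] by blast
qed

text \<open>With D the bracketing, D (s t) = [s, D t] for Lie elements s and t. So D [s, t] =
  [s, D t] -+ [t, D s], and by induction and skew-symmetry the right side is (|s| + |t|)
  [s, t].\<close>

lemma dynkin_specht_wever:
  assumes "letters t \<subseteq> verts G"
  shows "lin dynkin (lie t) - psc (of_nat (size (mdeg t))) (single t 1) \<in> rel_ideal"
  using assms
proof (induction t)
  case (Gen a)
  then show ?case by (simp add: rel_ideal_0)
next
  case (Br s t)
  let ?n = "\<lambda>t. of_nat (size (mdeg t)) :: complex" and ?c = "super_sign (odd_word s) (odd_word t)"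
  let ?B = "\<lambda>s t. single (Br s t) 1"
  have l: "letters s \<subseteq> verts G" "letters t \<subseteq> verts G" using Br.prems by auto
  have st: "lin dynkin (lie s * lie t) - psc (?n t) (?B s t) \<in> rel_ideal"
    if "lin dynkin (lie t) - psc (?n t) (single t 1) \<in> rel_ideal" "letters s \<subseteq> verts G" "letters t \<subseteq> verts G" for s t
  proof -
    have "ad (lie s) (lin dynkin (lie t) - psc (?n t) (single t 1))
      + psc (?n t) (ad (lie s) (single t 1) - bracket (single s 1) (single t 1)) \<in> rel_ideal"
      by (intro rel_ideal_add rel_ideal_scale ad_lie_rel_ideal ad_lie single_Car that)
    then show ?thesis
      by (simp only: dynkin_mult_lie ad_minus ad_psc bracket_single pm.scale_right_diff_distrib) simp
  qed
  have IH: "lin dynkin (lie s) - psc (?n s) (single s 1) \<in> rel_ideal"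
    "lin dynkin (lie t) - psc (?n t) (single t 1) \<in> rel_ideal"
    using Br.IH l by auto
  have "(lin dynkin (lie s * lie t) - psc (?n t) (?B s t)) - psc ?c (lin dynkin (lie t * lie s) - psc (?n s) (?B t s))
      - psc (?n s) (?B s t + psc ?c (?B t s)) \<in> rel_ideal"
    by (intro rel_ideal_diff rel_ideal_scale st skew_rel_ideal IH l)
  moreover have "psc (?n s) (?B s t + psc ?c (?B t s)) = psc (?n s) (?B s t) + psc ?c (psc (?n s) (?B t s))"
    by (simp add: pm.scale_right_distrib mult.commute)
  moreover have "psc (?n (Br s t)) (?B s t) = psc (?n s) (?B s t) + psc (?n t) (?B s t)"
    by (simp add: single_add distrib_right)
  ultimately show ?case
    by (simp add: lin_minus lin_psc pm.scale_right_diff_distrib algebra_simps)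
qed

text \<open>At the end of a word a relation becomes a defining relator of P. In front of a nonempty
  v it becomes, through \<open>ad_lie\<close>, the bracket of such a relator with
  \<open>dynkin v\<close>. Words with letters outside the graph are sent to 0, since
  \<open>dynkin\<close> would leave the algebra there.\<close>

lemma dynkin_compat: "compat rel_ideal (\<lambda>w. if set w \<subseteq> verts G then dynkin w else 0)"
proof -
  have iv: "iso_verts G \<subseteq> verts G" using odd_letter_verts iso_odd by blast
  have br: "ad (lie (Br (Gen a) (Gen b))) y = ad_word [a, b] y - psc (ss a b) (ad_word [b, a] y)" for a b y
    by (simp add: ad_def mult_single_list lin_minus)
  have k: "ad_word u x \<in> rel_ideal \<Longrightarrow> x = y \<Longrightarrow> ad_word u y \<in> rel_ideal" for u x y by simp
  have swap: "dynkin (u @ a # b # v) - psc (ss a b) (dynkin (u @ b # a # v)) \<in> rel_ideal"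
    if d: "\<not> dep a b" and s: "set (u @ a # b # v) \<subseteq> verts G" for u v a b
  proof -
    have d': "\<not> dep b a" using d dep_sym by blast
    have ab: "a \<in> verts G" "b \<in> verts G" "set u \<subseteq> verts G" "set v \<subseteq> verts G" using s by auto
    have "dynkin (a # b # v) - psc (ss a b) (dynkin (b # a # v)) \<in> rel_ideal"
    proof (cases "v = []")
      case True
      then show ?thesis
        using comm_rel_ideal(1)[OF ab(1,2) d] comm_rel_ideal(1)[OF ab(2,1) d']
        by (auto simp: bracket_single intro!: rel_ideal_diff rel_ideal_scale)
          (metis rel_ideal_scale psc_single mult.right_neutral)
    next
      case False
      have "(ad (lie (Br (Gen a) (Gen b))) (dynkin v) - bracket (single (Br (Gen a) (Gen b)) 1) (dynkin v))
         + bracket (single (Br (Gen a) (Gen b)) 1) (dynkin v) \<in> rel_ideal"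
        using ab d by (intro rel_ideal_add ad_lie bracket_rel_ideal(2) dynkin_Car comm_rel_ideal) auto
      then show ?thesis using False by (simp del: lie.simps add: br)
    qed
    then have "ad_word u (dynkin (a # b # v) + psc (- ss a b) (dynkin (b # a # v))) \<in> rel_ideal"
      using ab by (intro ad_word_rel_ideal) auto
    then show ?thesis by (simp only: ad_word_add ad_word_psc dynkin_append[symmetric] list.distinct not_False_eq_True) simp
  qed
  have sq: "dynkin (u @ a # a # v) \<in> rel_ideal" if a: "a \<in> iso_verts G" and s: "set (u @ a # a # v) \<subseteq> verts G" for u v a
  proof -
    have ab: "a \<in> verts G" "set u \<subseteq> verts G" "set v \<subseteq> verts G" using s by auto
    have "dynkin (a # a # v) \<in> rel_ideal"
    proof (cases "v = []")
      case True
      then show ?thesis using comm_rel_ideal(2)[OF a] by (simp add: bracket_single)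
    next
      case False
      have "(ad (lie (Br (Gen a) (Gen a))) (dynkin v) - bracket (single (Br (Gen a) (Gen a)) 1) (dynkin v))
         + bracket (single (Br (Gen a) (Gen a)) 1) (dynkin v) \<in> rel_ideal"
        using ab a by (intro rel_ideal_add ad_lie bracket_rel_ideal(2) dynkin_Car comm_rel_ideal) auto
      \<comment> \<open>For an odd letter [a, a] = 2 a a, so the relator first yields twice the
        desired element.\<close>
      then have "psc 2 (dynkin (a # a # v)) \<in> rel_ideal"
        using False iso_odd[OF a] pm.scale_left_distrib[of 1 1 "dynkin (a # a # v)"]
        by (simp del: lie.simps add: br super_sign_def)
      then have "psc (1 / 2) (psc 2 (dynkin (a # a # v))) \<in> rel_ideal" by (rule rel_ideal_scale)
      then show ?thesis by simp
    qed
    then have "ad_word u (dynkin (a # a # v)) \<in> rel_ideal" using ab by (intro ad_word_rel_ideal) auto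
    then show ?thesis by (simp add: dynkin_append)
  qed
  show ?thesis
    unfolding compat_def
  proof (intro conjI allI impI)
    fix u v a b assume d: "\<not> dep a b"
    have eq: "set (u @ b # a # v) = set (u @ a # b # v)" by auto
    show "(if set (u @ a # b # v) \<subseteq> verts G then dynkin (u @ a # b # v) else 0) -
       psc (ss a b) (if set (u @ b # a # v) \<subseteq> verts G then dynkin (u @ b # a # v) else 0) \<in> rel_ideal"
      unfolding eq
    proof (cases "set (u @ a # b # v) \<subseteq> verts G")
      case True
      then show "(if set (u @ a # b # v) \<subseteq> verts G then dynkin (u @ a # b # v) else 0) -
        psc (ss a b) (if set (u @ a # b # v) \<subseteq> verts G then dynkin (u @ b # a # v) else 0) \<in> rel_ideal"
        using swap[OF d True] by (simp only: if_True)
    qed (simp_all only: if_False pm.scale_zero_right diff_0_right rel_ideal_0)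
  next
    fix u v a assume "a \<in> iso_verts G"
    then show "(if set (u @ a # a # v) \<subseteq> verts G then dynkin (u @ a # a # v) else 0) \<in> rel_ideal"
      using sq[of a u v] by (simp add: rel_ideal_0)
  qed
qed

text \<open>The kernel of P \<rightarrow> A is trivial in each degree: bracketing maps relations of
  A to relations of P and returns x multiplied by its degree.\<close>

lemma rel_ideal_iff:
  assumes x: "x \<in> Car" and deg: "\<And>t. t \<in> keys x \<Longrightarrow> mdeg t = n"
  shows "x \<in> rel_ideal \<longleftrightarrow> phi x \<in> K"
proof
  assume K: "phi x \<in> K"
  let ?d = "\<lambda>w. if set w \<subseteq> verts G then dynkin w else 0"
  have l: "letters t \<subseteq> verts G" if "t \<in> keys x" for t using x that by (auto simp: Car_def)
  have "lin ?d (phi x) \<in> rel_ideal" by (rule compat_K[OF subspace_rel_ideal dynkin_compat K])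
  moreover have "lin ?d (phi x) = lin (\<lambda>t. lin dynkin (lie t)) x"
    unfolding phi_def lin_lin
    using l by (intro lin_cong) (auto dest: keys_lie_letters)
  moreover have "lin (\<lambda>t. lin dynkin (lie t) - psc (of_nat (size (mdeg t))) (single t 1)) x \<in> rel_ideal"
    using l by (intro subspace_lin[OF subspace_rel_ideal] dynkin_specht_wever) auto
  ultimately have "lin (\<lambda>t. lin dynkin (lie t)) x - lin (\<lambda>t. lin dynkin (lie t) - psc (of_nat (size (mdeg t))) (single t 1)) x \<in> rel_ideal"
    by (intro rel_ideal_diff) simp_all
  then have "lin (\<lambda>t. psc (of_nat (size (mdeg t))) (single t 1)) x \<in> rel_ideal"
    by (simp add: lin_fun_minus)
  \<comment> \<open>Homogeneity enters here: the factors attached to the single words are one common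
    scalar, invertible because the degree of a Lie word is not zero.\<close>
  moreover have "lin (\<lambda>t. psc (of_nat (size (mdeg t))) (single t 1)) x = lin (\<lambda>t. psc (of_nat (size n)) (single t 1)) x"
    by (intro lin_cong) (simp add: deg)
  ultimately have *: "psc (of_nat (size n)) x \<in> rel_ideal"
    by (simp only: lin_fun_psc lin_id)
  show "x \<in> rel_ideal"
  proof (cases "x = 0")
    case False
    then obtain t where "t \<in> keys x" by (metis keys_eq_empty all_not_in_conv)
    then have "n \<noteq> {#}" using deg mdeg_nonempty by metis
    then have "size n \<noteq> 0" by simp
    moreover have "psc (1 / of_nat (size n)) (psc (of_nat (size n)) x) \<in> rel_ideal"
      by (rule rel_ideal_scale[OF *])
    ultimately show ?thesis by simp
  qed (simp add: rel_ideal_0)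
qed (rule phi_rel_ideal)

section \<open>Multiplicities\<close>

lemma word_degree_mdeg: "word_degree t = count (mdeg t)"
  by (induction t) (auto simp: fun_eq_iff)

definition deg_space :: "'i multiset \<Rightarrow> ('i magma \<Rightarrow>\<^sub>0 complex) set" where
  "deg_space n = {x \<in> Car. \<forall>t\<in>keys x. mdeg t = n}"

lemma subspace_deg_space: "pm.subspace (deg_space n)"
proof -
  have "deg_space n = {x. \<forall>t\<in>keys x. letters t \<subseteq> verts G \<and> mdeg t = n}"
    by (auto simp: deg_space_def Car_def)
  then show ?thesis by (simp only: subspace_keys)
qed

lemmas deg_space_0 = pm.subspace_0[OF subspace_deg_space]
lemmas deg_space_add = pm.subspace_add[OF subspace_deg_space]
lemmas deg_space_diff = pm.subspace_diff[OF subspace_deg_space]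
lemmas deg_space_neg = pm.subspace_neg[OF subspace_deg_space]
lemmas deg_space_scale = pm.subspace_scale[OF subspace_deg_space]
lemmas deg_space_sum = pm.subspace_sum[OF subspace_deg_space]

lemma deg_space_Car: "x \<in> deg_space n \<Longrightarrow> x \<in> Car"
  by (simp add: deg_space_def)

lemma degree_part_quotient:
  "degree_part (quotient_algebra A J) m = (\<lambda>x. J +>\<^bsub>A\<^esub> x) ` degree_part A m"
  by (simp add: quotient_algebra_def)

lemma degree_part_PL: "degree_part PL (count n) = qmap ` deg_space n"
proof -
  have "degree_part A0 (count n) = deg_space n"
    by (auto simp: degree_part_A0 deg_space_def word_degree_mdeg count_inject)
  then show ?thesis
    by (simp add: degree_part_quotient qmap_def[abs_def] image_image)
qed

lemma independent_family:
  assumes "inj_on f X" "pm.independent (f ` X)" "finite T" "T \<subseteq> X" "(\<Sum>t\<in>T. psc (c t) (f t)) = 0" "t \<in> T"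
  shows "c t = 0"
proof -
  have inj: "inj_on f T" using assms(1,4) by (rule inj_on_subset)
  have "(\<Sum>v\<in>f ` T. psc (c (the_inv_into X f v)) v) = (\<Sum>t\<in>T. psc (c t) (f t))"
    using assms(1,4) by (subst sum.reindex[OF inj]) (auto intro!: sum.cong simp: the_inv_into_f_f subset_eq)
  then have "c (the_inv_into X f (f t)) = 0"
    using assms by (intro pm.independentD[OF assms(2), of "f ` T" "\<lambda>v. c (the_inv_into X f v)"]) auto
  then show ?thesis using assms by (simp add: the_inv_into_f_f subset_eq)
qed

lemma span_family:
  assumes "inj_on f X" "finite X" "x \<in> pm.span (f ` X)"
  obtains c where "x = (\<Sum>t\<in>X. psc (c t) (f t))"
proof -
  obtain u where "x = (\<Sum>v\<in>f ` X. psc (u v) v)"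
    using assms(3) pm.span_finite[of "f ` X"] assms(2) by auto
  then have "x = (\<Sum>t\<in>X. psc (u (f t)) (f t))" by (simp add: sum.reindex[OF assms(1)])
  then show thesis by (rule that)
qed

text \<open>By \<open>rel_ideal_iff\<close>, \<open>qmap\<close> and \<open>rho\<close> after
  \<open>phi\<close> identify the same elements of \<open>deg_space n\<close>. A basis found in A
  therefore transfers to the component of P.\<close>

theorem root_mult_card:
  assumes n: "set_mset n \<subseteq> verts G" and X: "finite X" "X \<subseteq> {t. mdeg t = n}"
    and inj: "inj_on (\<lambda>t. rho (lie t)) X" and ind: "pm.independent ((\<lambda>t. rho (lie t)) ` X)"
    and span: "\<And>t. mdeg t = n \<Longrightarrow> rho (lie t) \<in> pm.span ((\<lambda>t. rho (lie t)) ` X)"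
  shows "root_mult G (count n) = card X"
proof -
  let ?f = "\<lambda>t. rho (lie t)" and ?e = "\<lambda>t. single t (1 :: complex)"
  let ?V = "PL\<lparr>carrier := qmap ` deg_space n\<rparr>"
  define g where "g t = qmap (?e t)" for t
  have e: "?e t \<in> deg_space n" if "mdeg t = n" for t
    using that n set_mdeg[of t] by (auto simp: deg_space_def single_Car)
  have iff: "qmap x = qmap y \<longleftrightarrow> rho (phi x) = rho (phi y)" if "x \<in> deg_space n" "y \<in> deg_space n" for x y
  proof -
    have d: "x - y \<in> deg_space n" using that by (rule deg_space_diff)
    have "qmap x = qmap y \<longleftrightarrow> x - y \<in> rel_ideal" using that by (intro qmap_eq_iff deg_space_Car)
    also have "\<dots> \<longleftrightarrow> phi (x - y) \<in> K" using d by (intro rel_ideal_iff[where n = n]) (auto simp: deg_space_def)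
    finally show ?thesis by (simp add: K_def phi_minus rho_minus)
  qed
  have PLb: "bilinear_algebra PL"
    by (intro algebra_quotient.Q_bilinear algebra_quotient.intro algebra_quotient_axioms.intro
        A0_bilinear J1_ideal J2_ideal)
  interpret PL: bilinear_algebra PL by (rule PLb)
  have "Module.submodule (qmap ` deg_space n) class_ring PL"
  proof (rule PL.submoduleI)
    show "qmap ` deg_space n \<subseteq> carrier PL" using qmap_carrier deg_space_Car by auto
    show "\<zero>\<^bsub>PL\<^esub> \<in> qmap ` deg_space n"
      using deg_space_0 qmap_zero by (metis image_eqI)
    show "\<ominus>\<^bsub>PL\<^esub> a \<in> qmap ` deg_space n" if a: "a \<in> qmap ` deg_space n" for a
    proof -
      obtain x where x: "x \<in> deg_space n" "a = qmap x" using a by blast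
      have n: "- x \<in> deg_space n" using x(1) by (rule deg_space_neg)
      have "qmap (- x) \<oplus>\<^bsub>PL\<^esub> qmap x = \<zero>\<^bsub>PL\<^esub>"
        using x n deg_space_Car by (simp add: qmap_add qmap_zero)
      then have "\<ominus>\<^bsub>PL\<^esub> a = qmap (- x)"
        using x n deg_space_Car qmap_carrier by (intro PL.minus_equality) auto
      then show ?thesis using n by blast
    qed
    show "a \<oplus>\<^bsub>PL\<^esub> b \<in> qmap ` deg_space n" if "a \<in> qmap ` deg_space n" "b \<in> qmap ` deg_space n" for a b
      using that deg_space_Car deg_space_add by (auto simp: qmap_add)
    show "c \<odot>\<^bsub>PL\<^esub> a \<in> qmap ` deg_space n" if "a \<in> qmap ` deg_space n" for a c
      using that deg_space_Car deg_space_scale by (auto simp: qmap_smult)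
  qed
  then have "Module.module class_ring ?V"
    using PL.is_module by (rule submodule.submodule_is_module)
  then interpret V: vectorspace class_ring ?V
    by (intro vectorspace.intro class_field.field_axioms)
  have gM: "g t \<in> carrier ?V" if "t \<in> X" for t
    using that X(2) e by (auto simp: g_def)
  have injg: "inj_on g X"
  proof (rule inj_onI)
    fix s t assume st: "s \<in> X" "t \<in> X" "g s = g t"
    then have "rho (lie s) = rho (lie t)"
      using iff[of "?e s" "?e t"] e X(2) by (auto simp: g_def phi_single)
    then show "s = t" using inj st by (auto simp: inj_on_def)
  qed
  have sumM: "(\<Sum>t\<in>T. psc (c t) (?e t)) \<in> deg_space n" if "T \<subseteq> X" for T c
    using that X(2) e by (intro deg_space_sum deg_space_scale) auto
  \<comment> \<open>Translates linear combinations in the record-based vector space of P into formal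
    sums of words, where the facts about A apply.\<close>
  have lc: "V.lincomb a (g ` T) = qmap (\<Sum>t\<in>T. psc (a (g t)) (?e t))" if T: "T \<subseteq> X" for T a
  proof -
    have "finite T" using T X(1) by (rule finite_subset)
    then show ?thesis using T
    proof (induction T)
      case empty
      then show ?case by (simp add: V.lincomb_def qmap_zero)
    next
      case (insert t T)
      have nin: "g t \<notin> g ` T" using insert injg by (auto simp: inj_on_def)
      have sm: "a (g t) \<odot>\<^bsub>PL\<^esub> g t = qmap (psc (a (g t)) (?e t))" if "t \<in> X" for t
      proof -
        have "?e t \<in> Car" using that X(2) e deg_space_Car by blast
        then show ?thesis unfolding g_def by (rule qmap_smult)
      qed
      have cl: "a v \<odot>\<^bsub>PL\<^esub> v \<in> qmap ` deg_space n" if "v \<in> insert (g t) (g ` T)" for v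
      proof -
        obtain t' where t': "t' \<in> X" "v = g t'" using \<open>v \<in> insert (g t) (g ` T)\<close> insert.prems by blast
        have "psc (a (g t')) (?e t') \<in> deg_space n" using t'(1) X(2) e by (intro deg_space_scale) auto
        then show ?thesis using sm[OF t'(1)] t'(2) by simp
      qed
      have "V.lincomb a (g ` insert t T) = (a (g t) \<odot>\<^bsub>PL\<^esub> g t) \<oplus>\<^bsub>PL\<^esub> V.lincomb a (g ` T)"
        unfolding V.lincomb_def image_insert
        by (subst abelian_monoid.finsum_insert[OF V.M.abelian_monoid_axioms])
          (use insert nin cl in auto)
      also have "\<dots> = qmap (psc (a (g t)) (?e t)) \<oplus>\<^bsub>PL\<^esub> qmap (\<Sum>t\<in>T. psc (a (g t)) (?e t))"
        using insert sm by simp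
      also have "\<dots> = qmap (psc (a (g t)) (?e t) + (\<Sum>t\<in>T. psc (a (g t)) (?e t)))"
      proof (rule qmap_add)
        show "psc (a (g t)) (?e t) \<in> Car"
          using insert.prems X(2) e by (intro deg_space_Car[of _ n] deg_space_scale) auto
        show "(\<Sum>t\<in>T. psc (a (g t)) (?e t)) \<in> Car"
          using insert.prems by (intro deg_space_Car[of _ n] sumM) auto
      qed
      finally show ?case using insert by simp
    qed
  qed
  have rp: "rho (phi (\<Sum>t\<in>T. psc (c t) (?e t))) = (\<Sum>t\<in>T. psc (c t) (?f t))" for T c
    by (simp add: phi_def lin_sum rho_sum rho_psc)
  have "V.basis (g ` X)"
    unfolding V.basis_def
  proof (intro conjI)
    show sub: "g ` X \<subseteq> carrier ?V" using gM by blast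
    show "V.lin_indpt (g ` X)"
    proof
      assume "V.lin_dep (g ` X)"
      then obtain A a v where A: "finite A" "A \<subseteq> g ` X" "V.lincomb a A = \<zero>\<^bsub>PL\<^esub>" "v \<in> A" "a v \<noteq> 0"
        unfolding V.lin_dep_def by auto
      obtain T where T: "T \<subseteq> X" "finite T" "A = g ` T" using finite_subset_image[OF A(1,2)] by blast
      obtain t where t: "t \<in> T" "v = g t" using A(4) T by blast
      have "qmap (\<Sum>t\<in>T. psc (a (g t)) (?e t)) = qmap 0" using lc[OF T(1)] A(3) T(3) qmap_zero by simp
      then have "rho (phi (\<Sum>t\<in>T. psc (a (g t)) (?e t))) = 0"
        using iff[OF sumM[OF T(1)] deg_space_0] by simp
      then have "(\<Sum>t\<in>T. psc (a (g t)) (?f t)) = 0" by (simp only: rp)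
      then have "a (g t) = 0"
        by (rule independent_family[OF inj ind T(2,1) _ t(1), where c = "\<lambda>t. a (g t)"])
      then show False using A(5) t by simp
    qed
    show "V.span (g ` X) = carrier ?V"
    proof
      show "V.span (g ` X) \<subseteq> carrier ?V" by (rule V.span_is_subset2[OF sub])
      show "carrier ?V \<subseteq> V.span (g ` X)"
      proof
        fix v assume "v \<in> carrier ?V"
        then obtain x where x: "x \<in> deg_space n" "v = qmap x" by auto
        have "rho (phi x) = lin ?f x" by (simp add: phi_def rho_def lin_lin)
        also have "\<dots> \<in> pm.span (?f ` X)"
          using x(1) span by (intro subspace_lin[OF pm.subspace_span]) (auto simp: deg_space_def)
        finally obtain c where c: "rho (phi x) = (\<Sum>t\<in>X. psc (c t) (?f t))"
          using span_family[OF inj X(1)] by blast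
        have "v = qmap (\<Sum>t\<in>X. psc (c t) (?e t))"
          using x(2) iff[OF x(1) sumM[OF order_refl]] c rp by simp
        also have "\<dots> = qmap (\<Sum>t\<in>X. psc (c (the_inv_into X g (g t))) (?e t))"
          using injg by (simp add: the_inv_into_f_f)
        also have "\<dots> = V.lincomb (\<lambda>v. c (the_inv_into X g v)) (g ` X)" by (simp add: lc)
        finally show "v \<in> V.span (g ` X)"
          unfolding V.span_def using X(1) by (auto simp: class_ring_simps)
      qed
    qed
  qed
  then have "V.dim = card (g ` X)" using X(1) by (intro V.dim_basis) auto
  then show ?thesis
    by (simp add: root_mult_def partial_comm_lie_PL degree_part_PL card_image[OF injg])
qed

end

section \<open>Sub-multisets and sign-reversing involutions\<close>

lemma finite_submsets: "finite {S. S \<subseteq># (n :: 'a multiset)}"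
proof (induction n)
  case (add a n)
  have "{S. S \<subseteq># add_mset a n} \<subseteq> {S. S \<subseteq># n} \<union> add_mset a ` {S. S \<subseteq># n}"
  proof
    fix S assume S: "S \<in> {S. S \<subseteq># add_mset a n}"
    show "S \<in> {S. S \<subseteq># n} \<union> add_mset a ` {S. S \<subseteq># n}"
    proof (cases "a \<in># S")
      case True
      then obtain S' where "S = add_mset a S'" by (metis insert_DiffM)
      then show ?thesis using S by auto
    next
      case False
      have "S \<subseteq># n"
      proof (rule mset_subset_eqI)
        show "count S x \<le> count n x" for x
          using mset_subset_eq_count[of S "add_mset a n" x] S False by (cases "x = a") (auto simp: not_in_iff)
      qed
      then show ?thesis by simp
    qed
  qed
  then show ?case by (rule finite_subset) (simp add: add)
qed simp

lemma sum_involution_zero: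
  fixes f :: "'x \<Rightarrow> real"
  assumes "\<And>x. x \<in> A \<Longrightarrow> i x \<in> A \<and> i (i x) = x \<and> f (i x) = - f x"
  shows "sum f A = 0"
proof -
  have "bij_betw i A A" by (rule bij_betw_byWitness[where f' = i]) (use assms in auto)
  then have "sum f A = (\<Sum>x\<in>A. f (i x))" by (rule sum.reindex_bij_betw[symmetric])
  also have "\<dots> = - sum f A" using assms by (simp add: sum_negf)
  finally show ?thesis by simp
qed

context trace_graph begin

section \<open>Cartier-Foata inversion\<close>

text \<open>The possible contents of one colour class, and also the terms of 1 / H(-X) for the
  Hilbert series H of A. A letter with a a = 0 has series 1 + X, with inverse the sum of all (-X)^k;
  this is why isotropic letters may repeat.\<close>

definition iset :: "'i multiset \<Rightarrow> bool" where
  "iset S \<longleftrightarrow> (\<forall>a\<in>#S. \<forall>b\<in>#S. a \<noteq> b \<longrightarrow> \<not> dep a b) \<and> (\<forall>a. a \<notin> iso_verts G \<longrightarrow> count S a \<le> 1)"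

definition act :: "'i multiset \<times> 'i list \<Rightarrow> 'i set" where
  "act = (\<lambda>(S, r). set_mset S \<union> {a. ini a r \<and> (\<forall>b\<in>#S. b \<noteq> a \<longrightarrow> \<not> dep a b)})"

text \<open>Suppose a is both in S and initial in r. If a is isotropic, a further copy on r would
  make the trace vanish, so a moves into S, where it may repeat. Otherwise S admits no second copy,
  so a moves onto r.\<close>

definition toggle :: "'i \<Rightarrow> 'i multiset \<times> 'i list \<Rightarrow> 'i multiset \<times> 'i list" where
  "toggle a = (\<lambda>(S, r). if ini a r \<and> (a \<notin># S \<or> a \<in> iso_verts G)
     then (add_mset a S, rep (remove1 a r)) else (S - {#a#}, rep (a # r)))"

text \<open>A pivot is moved between the independent multiset \<open>S\<close> and the trace \<open>r\<close>; since this does not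
  change the set of candidates, the same pivot is chosen on the way back.\<close>

definition flip :: "'i multiset \<times> 'i list \<Rightarrow> 'i multiset \<times> 'i list" where
  "flip p = toggle (SOME a. a \<in> act p) p"

definition pairs :: "'i multiset \<Rightarrow> ('i multiset \<times> 'i list) set" where
  "pairs n = {(S, r). S \<subseteq># n \<and> iset S \<and> rep r = r \<and> mset r = n - S \<and> \<not> nil r}"

lemma eqt_remove1: "ini a r \<Longrightarrow> eqt (a # remove1 a r) r"
proof -
  assume "ini a r"
  then obtain u v where r: "r = u @ a # v" and u: "\<forall>x\<in>set u. \<not> dep a x" by (rule ini_split)
  have "a \<notin> set u" using u by auto
  then have "remove1 a r = u @ v" by (simp add: r remove1_append)
  then show ?thesis unfolding r using eqt_move_front'[OF u, of "[]" v] by simp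
qed

lemma toggle_pairs:
  assumes p: "(S, r) \<in> pairs n" and a: "a \<in> act (S, r)"
  shows "toggle a (S, r) \<in> pairs n" "act (toggle a (S, r)) = act (S, r)" "toggle a (toggle a (S, r)) = (S, r)"
    "(-1 :: real) ^ size (fst (toggle a (S, r))) = - ((-1) ^ size S)"
proof -
  have Sn: "S \<subseteq># n" and S: "iset S" and r: "rep r = r" "mset r = n - S" "\<not> nil r"
    using p by (auto simp: pairs_def)
  have ind: "\<And>x y. x \<in># S \<Longrightarrow> y \<in># S \<Longrightarrow> x \<noteq> y \<Longrightarrow> \<not> dep x y" and nmons: "\<And>x. x \<notin> iso_verts G \<Longrightarrow> count S x \<le> 1"
    using S by (auto simp: iset_def)
  have "toggle a (S, r) \<in> pairs n \<and> act (toggle a (S, r)) = act (S, r) \<and> toggle a (toggle a (S, r)) = (S, r)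
    \<and> (-1 :: real) ^ size (fst (toggle a (S, r))) = - ((-1) ^ size S)"
  proof (cases "ini a r \<and> (a \<notin># S \<or> a \<in> iso_verts G)")
    case True
    define r' where "r' = rep (remove1 a r)"
    have t: "toggle a (S, r) = (add_mset a S, r')" using True by (simp add: toggle_def r'_def)
    have e: "eqt (a # r') r"
      using eqt_remove1[of a r] True eqt_rep[of "remove1 a r"] eqt_trans[OF _ eqt_remove1[of a r]] eqt_sym
      unfolding r'_def by (metis eqt_Cons)
    have i: "ini x r \<longleftrightarrow> x = a \<or> \<not> dep x a \<and> ini x r'" for x
      using ini_eqt[OF e, of x] by (simp add: ini_Cons)
    \<comment> \<open>Were an isotropic a still initial after its removal, r would contain an
      isotropic square. So the return toggle takes the other branch.\<close>
    have nl: "\<not> nil r'" "a \<in> iso_verts G \<Longrightarrow> \<not> ini a r'"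
      using nil_eqt[OF e] r(3) by auto
    have ms: "add_mset a (mset r') = n - S" using eqt_mset[OF e] r(2) by simp
    have "add_mset a S \<subseteq># n"
    proof -
      have "a \<in># n - S" by (simp add: ms[symmetric])
      then have a: "count S a < count n a" by (simp add: in_diff_count)
      show ?thesis
      proof (rule mset_subset_eqI)
        show "count (add_mset a S) x \<le> count n x" for x
          using mset_subset_eq_count[OF Sn, of x] a by (cases "x = a") auto
      qed
    qed
    moreover have ad: "\<forall>b\<in>#S. b \<noteq> a \<longrightarrow> \<not> dep a b"
      using a ind by (auto simp: act_def)
    have "iset (add_mset a S)"
      unfolding iset_def
    proof (intro conjI ballI allI impI)
      fix x y assume "x \<in># add_mset a S" "y \<in># add_mset a S" "x \<noteq> y"
      then show "\<not> dep x y" using ad ind dep_sym by auto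
    next
      fix x assume "x \<notin> iso_verts G"
      then show "count (add_mset a S) x \<le> 1" using True nmons[of x] by (auto simp: not_in_iff)
    qed
    moreover have "rep r' = r'" by (simp add: r'_def)
    moreover have "mset r' = n - add_mset a S"
      using ms by (metis add_mset_add_single add_mset_remove_trivial diff_diff_add_mset)
    ultimately have "(add_mset a S, r') \<in> pairs n" using nl by (simp add: pairs_def)
    moreover have "act (add_mset a S, r') = act (S, r)"
      using a ad by (auto simp: act_def i)
    moreover have "toggle a (add_mset a S, r') = (S, r)"
      using nl(2) rep_eqt[OF e] r(1) by (auto simp: toggle_def)
    ultimately show ?thesis unfolding t by simp
  next
    case False
    have aS: "a \<in># S" using a False by (auto simp: act_def)
    define r' where "r' = rep (a # r)"
    have t: "toggle a (S, r) = (S - {#a#}, r')" using False by (auto simp: toggle_def r'_def)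
    have e: "eqt (a # r) r'" unfolding r'_def by (rule eqt_rep)
    have i: "ini x r' \<longleftrightarrow> x = a \<or> \<not> dep x a \<and> ini x r" for x
      using ini_eqt[OF e, of x] by (simp add: ini_Cons)
    have "\<not> nil r'" using nil_eqt[OF e] r(3) False aS by auto
    moreover have "S - {#a#} \<subseteq># n" using Sn diff_subset_eq_self subset_mset.order_trans by blast
    moreover have "iset (S - {#a#})"
      unfolding iset_def
    proof (intro conjI ballI allI impI)
      fix x y assume "x \<in># S - {#a#}" "y \<in># S - {#a#}" "x \<noteq> y"
      then show "\<not> dep x y" using ind in_diffD by metis
    next
      fix x assume "x \<notin> iso_verts G"
      then show "count (S - {#a#}) x \<le> 1" using nmons[of x] by simp
    qed
    moreover have "rep r' = r'" by (simp add: r'_def)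
    moreover have "mset r' = n - (S - {#a#})"
    proof -
      have "mset r' = add_mset a (n - S)" using eqt_mset[OF e] r(2) by simp
      moreover obtain S' where "S = add_mset a S'" using aS by (metis insert_DiffM)
      moreover have "add_mset a S' \<subseteq># n" using Sn calculation by simp
      ultimately show ?thesis
        by (simp add: multiset_eq_iff) (metis Suc_diff_le Suc_diff_Suc count_add_mset mset_subset_eq_count Suc_le_lessD)
    qed
    ultimately have "(S - {#a#}, r') \<in> pairs n" by (simp add: pairs_def)
    moreover have "act (S - {#a#}, r') = act (S, r)"
    proof -
      have m: "x \<in># S - {#a#} \<longleftrightarrow> x \<in># S" if "x \<noteq> a" for x
        using that by (simp add: in_diff_count)
      have "x \<in> act (S - {#a#}, r') \<longleftrightarrow> x \<in> act (S, r)" for x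
      proof (cases "x = a")
        case True
        then show ?thesis using a ind aS by (auto simp: act_def i dest: in_diffD)
      next
        case False
        have "(\<forall>b\<in>#S - {#a#}. b \<noteq> x \<longrightarrow> \<not> dep x b) \<and> \<not> dep x a \<longleftrightarrow> (\<forall>b\<in>#S. b \<noteq> x \<longrightarrow> \<not> dep x b)"
        proof (intro iffI conjI ballI impI)
          fix b
          assume h: "(\<forall>b\<in>#S - {#a#}. b \<noteq> x \<longrightarrow> \<not> dep x b) \<and> \<not> dep x a" "b \<in># S" "b \<noteq> x"
          show "\<not> dep x b" by (cases "b = a") (use h m in auto)
        next
          fix b
          assume h: "\<forall>b\<in>#S. b \<noteq> x \<longrightarrow> \<not> dep x b"
          show "\<not> dep x a" using h aS False by auto
          show "\<not> dep x b" if "b \<in># S - {#a#}" "b \<noteq> x" using h that by (blast dest: in_diffD)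
        qed
        then show ?thesis using False m by (auto simp: act_def i)
      qed
      then show ?thesis by blast
    qed
    moreover have "toggle a (S - {#a#}, r') = (S, r)"
    proof -
      have "a \<notin># S - {#a#} \<or> a \<in> iso_verts G"
        using nmons[of a] by (auto simp: not_in_iff)
      moreover have "rep (remove1 a r') = r"
      proof -
        have "ini a r'" by (simp add: i)
        then have "eqt (a # remove1 a r') r'" by (rule eqt_remove1)
        then have "eqt (a # remove1 a r') (a # r)" using e eqt_sym eqt_trans by blast
        then show ?thesis using rep_eqt[of "remove1 a r'" r] r(1) by simp
      qed
      ultimately show ?thesis using aS by (simp add: toggle_def i)
    qed
    moreover have "(-1 :: real) ^ size (S - {#a#}) = - ((-1) ^ size S)"
      using aS by (metis insert_DiffM minus_minus mult_minus1 power_Suc size_add_mset)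
    ultimately show ?thesis unfolding t by simp
  qed
  then show "toggle a (S, r) \<in> pairs n" "act (toggle a (S, r)) = act (S, r)" "toggle a (toggle a (S, r)) = (S, r)"
    "(-1 :: real) ^ size (fst (toggle a (S, r))) = - ((-1) ^ size S)" by blast+
qed

lemma act_nonempty: "(S, r) \<in> pairs n \<Longrightarrow> n \<noteq> {#} \<Longrightarrow> act (S, r) \<noteq> {}"
proof (cases "S = {#}")
  case True
  assume "(S, r) \<in> pairs n" "n \<noteq> {#}"
  then obtain a w where "r = a # w" using True by (cases r) (auto simp: pairs_def)
  then show ?thesis using True by (auto simp: act_def ini_Cons)
qed (auto simp: act_def)

definition isets :: "'i multiset \<Rightarrow> 'i multiset set" where
  "isets n = {S. S \<subseteq># n \<and> iset S}"

lemma finite_isets: "finite (isets n)"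
  unfolding isets_def by (rule finite_subset[OF _ finite_submsets[of n]]) auto

theorem cartier_foata:
  "(\<Sum>S\<in>isets n. (-1) ^ size S * real (ntraces (n - S))) = (if n = {#} then 1 else 0)"
proof -
  have reps: "rep ` {w. mset w = n \<and> \<not> nil w} = {r. rep r = r \<and> mset r = n \<and> \<not> nil r}" for n
    by force
  have "(\<Sum>S\<in>isets n. (-1) ^ size S * real (ntraces (n - S)))
     = (\<Sum>S\<in>isets n. \<Sum>r\<in>{r. rep r = r \<and> mset r = n - S \<and> \<not> nil r}. (-1) ^ size S)"
    by (simp add: ntraces_def reps mult.commute)
  also have "\<dots> = (\<Sum>(S, r)\<in>Sigma (isets n) (\<lambda>S. {r. rep r = r \<and> mset r = n - S \<and> \<not> nil r}). (-1) ^ size S)"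
    by (rule sum.Sigma) (auto simp: finite_isets intro: finite_subset[OF _ finite_words])
  also have "Sigma (isets n) (\<lambda>S. {r. rep r = r \<and> mset r = n - S \<and> \<not> nil r}) = pairs n"
    by (auto simp: pairs_def isets_def)
  also have "(\<Sum>(S, r)\<in>pairs n. (-1 :: real) ^ size S) = (if n = {#} then 1 else 0)"
  proof (cases "n = {#}")
    case True
    have "rep [] = []" using mset_rep[of "[]"] by (simp del: mset_rep)
    then have "pairs n = {({#}, [])}" using True by (auto simp: pairs_def iset_def)
    then show ?thesis using True by simp
  next
    case False
    have "sum (\<lambda>(S, r). (-1 :: real) ^ size S) (pairs n) = 0"
    proof (rule sum_involution_zero[where i = flip])
      fix p assume p: "p \<in> pairs n"
      obtain S r where Sr: "p = (S, r)" by (cases p)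
      define a where "a = (SOME a. a \<in> act p)"
      have a: "a \<in> act (S, r)"
        using act_nonempty[of S r n] p False Sr some_in_eq[of "act p"] by (simp add: a_def)
      note t = toggle_pairs[OF p[unfolded Sr] a]
      have f: "flip p = toggle a (S, r)" by (simp add: flip_def a_def Sr)
      have "flip (flip p) = toggle a (toggle a (S, r))"
        using t(2) by (simp add: f flip_def[of "toggle a (S, r)"]) (simp add: a_def Sr)
      then show "flip p \<in> pairs n \<and> flip (flip p) = p \<and>
        (case flip p of (S, r) \<Rightarrow> (-1 :: real) ^ size S) = - (case p of (S, r) \<Rightarrow> (-1) ^ size S)"
        using t f[unfolded Sr] by (simp add: Sr case_prod_beta)
    qed
    then show ?thesis using False by simp
  qed
  finally show ?thesis .
qed

section \<open>Marked colourings\<close>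

definition add_colour :: "nat \<Rightarrow> 'i multiset \<times> ('i \<Rightarrow> nat multiset) \<Rightarrow> 'i \<Rightarrow> nat multiset" where
  "add_colour c = (\<lambda>(S, \<Gamma>) i. \<Gamma> i + replicate_mset (count S i) c)"

lemma edge_verts: "{i, j} \<in> edges G \<Longrightarrow> i \<in> verts G \<and> j \<in> verts G \<and> i \<noteq> j"
  using simple by (auto simp: marked_simple_graph_def doubleton_eq_iff)

lemma colourings_0:
  assumes "set_mset n \<subseteq> verts G"
  shows "card (marked_colourings G (count n) 0) = (if n = {#} then 1 else 0)"
proof (cases "n = {#}")
  case True
  have "marked_colourings G (count n) 0 = {\<lambda>i. {#}}"
    using True by (auto simp: marked_colourings_def fun_eq_iff)
  then show ?thesis using True by simp
next
  case False
  then obtain i where i: "i \<in># n" by (meson multiset_nonemptyE)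
  have "marked_colourings G (count n) 0 = {}"
  proof -
    have False if "\<Gamma> \<in> marked_colourings G (count n) 0" for \<Gamma>
    proof -
      have "i \<in> verts G" using i assms by auto
      then have "set_mset (\<Gamma> i) \<subseteq> {1..0}" "size (\<Gamma> i) = count n i"
        using that by (auto simp: marked_colourings_def)
      moreover have "0 < count n i" using i by (simp only: count_greater_zero_iff)
      ultimately show False by auto
    qed
    then show ?thesis by blast
  qed
  then show ?thesis using False by simp
qed

text \<open>The vertices using the last colour form an independent multiset S; deleting that colour
  leaves a colouring of the remaining content with q colours.\<close>

lemma colourings_Suc_bij:
  assumes n: "set_mset n \<subseteq> verts G"
  shows "bij_betw (add_colour (Suc q)) (Sigma (isets n) (\<lambda>S. marked_colourings G (count (n - S)) q))
    (marked_colourings G (count n) (Suc q))"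
proof -
  let ?split = "\<lambda>\<Gamma>. (Abs_multiset (\<lambda>i. count (\<Gamma> i) (Suc q)), \<lambda>i. filter_mset (\<lambda>c. c \<noteq> Suc q) (\<Gamma> i))"
  let ?D = "Sigma (isets n) (\<lambda>S. marked_colourings G (count (n - S)) q)"
  have notin: "Suc q \<notin># \<Gamma> i" if "\<Gamma> \<in> marked_colourings G m q" for \<Gamma> m i
    using that by (cases "i \<in> verts G") (force simp: marked_colourings_def)+
  show ?thesis
  proof (rule bij_betw_byWitness[where f' = ?split])
    show "\<forall>p\<in>?D. ?split (add_colour (Suc q) p) = p"
    proof
      fix p assume "p \<in> ?D"
      then obtain S \<Gamma> where p: "p = (S, \<Gamma>)" and \<Gamma>: "\<Gamma> \<in> marked_colourings G (count (n - S)) q" by blast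
      have "count (\<Gamma> i) (Suc q) = 0" for i using notin[OF \<Gamma>] by (simp add: not_in_iff)
      moreover have "filter_mset (\<lambda>c. c \<noteq> Suc q) (\<Gamma> i + replicate_mset (count S i) (Suc q)) = \<Gamma> i" for i
        using notin[OF \<Gamma>, of i] by (intro multiset_eqI) (auto simp: not_in_iff)
      ultimately show "?split (add_colour (Suc q) p) = p"
        by (simp add: p add_colour_def count_inverse)
    qed
    have split: "?split \<Gamma> \<in> ?D \<and> add_colour (Suc q) (?split \<Gamma>) = \<Gamma>"
      if \<Gamma>: "\<Gamma> \<in> marked_colourings G (count n) (Suc q)" for \<Gamma>
    proof -
      have out: "\<Gamma> i = {#}" if "i \<notin> verts G" for i using \<Gamma> that by (simp add: marked_colourings_def)
      have col: "set_mset (\<Gamma> i) \<subseteq> {1..Suc q}" "size (\<Gamma> i) = count n i" if "i \<in> verts G" for i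
        using \<Gamma> that by (auto simp: marked_colourings_def)
      have one: "count (\<Gamma> i) c \<le> 1" if "i \<in> verts G" "i \<notin> iso_verts G" for i c
        using \<Gamma> that by (auto simp: marked_colourings_def)
      have dis: "set_mset (\<Gamma> i) \<inter> set_mset (\<Gamma> j) = {}" if "{i, j} \<in> edges G" for i j
        using \<Gamma> that by (auto simp: marked_colourings_def)
      have le: "count (\<Gamma> i) (Suc q) \<le> count n i" for i
        using col(2)[of i] out[of i] count_le_size[of "\<Gamma> i" "Suc q"] by (cases "i \<in> verts G") auto
      have "finite {i. 0 < count (\<Gamma> i) (Suc q)}"
      proof (rule finite_subset)
        show "{i. 0 < count (\<Gamma> i) (Suc q)} \<subseteq> set_mset n"
        proof
          fix i assume i: "i \<in> {i. 0 < count (\<Gamma> i) (Suc q)}"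
          have "0 < count n i" using less_le_trans[OF CollectD[OF i] le[of i]] .
          then show "i \<in># n" by simp
        qed
      qed simp
      then have S: "count (Abs_multiset (\<lambda>i. count (\<Gamma> i) (Suc q))) i = count (\<Gamma> i) (Suc q)" for i
        by (simp add: Abs_multiset_inverse)
      let ?S = "Abs_multiset (\<lambda>i. count (\<Gamma> i) (Suc q))"
      have "?S \<in> isets n"
        unfolding isets_def iset_def mem_Collect_eq
      proof (intro conjI ballI allI impI)
        show "?S \<subseteq># n" by (simp add: subseteq_mset_def S le)
        show "\<not> dep a b" if "a \<in># ?S" "b \<in># ?S" "a \<noteq> b" for a b
        proof -
          have "0 < count ?S a" "0 < count ?S b" using that by simp_all
          then have "Suc q \<in># \<Gamma> a" "Suc q \<in># \<Gamma> b" by (simp_all add: S)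
          then show ?thesis using dis[of a b] that(3) by (auto simp: dep_def)
        qed
        show "count ?S a \<le> 1" if "a \<notin> iso_verts G" for a
          using one[OF _ that, of "Suc q"] out[of a] by (cases "a \<in> verts G") (simp_all add: S)
      qed
      moreover have "(\<lambda>i. filter_mset (\<lambda>c. c \<noteq> Suc q) (\<Gamma> i)) \<in> marked_colourings G (count (n - ?S)) q"
        unfolding marked_colourings_def mem_Collect_eq
      proof (intro conjI ballI allI impI)
        fix i assume i: "i \<in> verts G"
        show "set_mset (filter_mset (\<lambda>c. c \<noteq> Suc q) (\<Gamma> i)) \<subseteq> {1..q}"
          using col(1)[OF i] by (auto simp: le_Suc_eq)
        have "size (\<Gamma> i) = size (filter_mset (\<lambda>c. c \<noteq> Suc q) (\<Gamma> i)) + count (\<Gamma> i) (Suc q)"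
          by (subst multiset_partition[of "\<Gamma> i" "\<lambda>c. c \<noteq> Suc q"]) (simp add: filter_eq_replicate_mset)
        then show "size (filter_mset (\<lambda>c. c \<noteq> Suc q) (\<Gamma> i)) = count (n - ?S) i"
          using col(2)[OF i] by (simp add: S)
      next
        fix i c assume "i \<in> verts G - iso_verts G"
        then show "count (filter_mset (\<lambda>c. c \<noteq> Suc q) (\<Gamma> i)) c \<le> 1" using one[of i c] by simp
      next
        fix i j assume "{i, j} \<in> edges G"
        then show "set_mset (filter_mset (\<lambda>c. c \<noteq> Suc q) (\<Gamma> i)) \<inter> set_mset (filter_mset (\<lambda>c. c \<noteq> Suc q) (\<Gamma> j)) = {}"
          using dis[of i j] by auto
      qed (simp add: out)
      moreover have "add_colour (Suc q) (?split \<Gamma>) = \<Gamma>"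
      proof
        fix i
        show "add_colour (Suc q) (?split \<Gamma>) i = \<Gamma> i"
          by (simp add: add_colour_def S multiset_eq_iff)
      qed
      ultimately show ?thesis by simp
    qed
    then show "\<forall>\<Gamma>\<in>marked_colourings G (count n) (Suc q). add_colour (Suc q) (?split \<Gamma>) = \<Gamma>"
      and "?split ` marked_colourings G (count n) (Suc q) \<subseteq> ?D" by blast+
    show "add_colour (Suc q) ` ?D \<subseteq> marked_colourings G (count n) (Suc q)"
    proof clarify
      fix S \<Gamma> assume S: "S \<in> isets n" and \<Gamma>: "\<Gamma> \<in> marked_colourings G (count (n - S)) q"
      have Sn: "count S i \<le> count n i" for i using S by (simp add: isets_def mset_subset_eq_count)
      show "add_colour (Suc q) (S, \<Gamma>) \<in> marked_colourings G (count n) (Suc q)"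
        unfolding marked_colourings_def mem_Collect_eq
      proof (intro conjI ballI allI impI)
        fix i assume i: "i \<notin> verts G"
        then have "count n i = 0" using n by (auto simp: not_in_iff[symmetric])
        then show "add_colour (Suc q) (S, \<Gamma>) i = {#}"
          using Sn[of i] \<Gamma> i by (simp add: add_colour_def marked_colourings_def)
      next
        fix i assume i: "i \<in> verts G"
        show "set_mset (add_colour (Suc q) (S, \<Gamma>) i) \<subseteq> {1..Suc q}"
          using \<Gamma> i by (force simp: add_colour_def marked_colourings_def split: if_splits)
        show "size (add_colour (Suc q) (S, \<Gamma>) i) = count n i"
          using \<Gamma> i Sn[of i] by (simp add: add_colour_def marked_colourings_def)
      next
        fix i c assume i: "i \<in> verts G - iso_verts G"
        have "count (\<Gamma> i) c \<le> 1" using \<Gamma> i by (auto simp: marked_colourings_def)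
        moreover have "count S i \<le> 1" using S i by (auto simp: isets_def iset_def)
        moreover have "count (\<Gamma> i) (Suc q) = 0" using notin[OF \<Gamma>, of i] by (simp add: not_in_iff)
        ultimately show "count (add_colour (Suc q) (S, \<Gamma>) i) c \<le> 1" by (auto simp: add_colour_def)
      next
        fix i j assume ij: "{i, j} \<in> edges G"
        have "set_mset (\<Gamma> i) \<inter> set_mset (\<Gamma> j) = {}" using \<Gamma> ij by (auto simp: marked_colourings_def)
        moreover have "\<not> (i \<in># S \<and> j \<in># S)"
          using S ij edge_verts[OF ij] by (auto simp: isets_def iset_def dep_def)
        ultimately show "set_mset (add_colour (Suc q) (S, \<Gamma>) i) \<inter> set_mset (add_colour (Suc q) (S, \<Gamma>) j) = {}"
          using notin[OF \<Gamma>, of i] notin[OF \<Gamma>, of j] by (auto simp: add_colour_def split: if_splits)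
      qed
    qed
  qed
qed

lemma colourings_Suc:
  assumes "set_mset n \<subseteq> verts G"
  shows "card (marked_colourings G (count n) (Suc q)) = (\<Sum>S\<in>isets n. card (marked_colourings G (count (n - S)) q))"
proof -
  have fin: "finite (marked_colourings G (count n) q)" if "set_mset n \<subseteq> verts G" for n q
    using that
  proof (induction q arbitrary: n)
    case 0
    have "marked_colourings G (count n) 0 \<subseteq> {\<lambda>i. {#}}"
      by (auto simp: marked_colourings_def fun_eq_iff)
    then show ?case by (rule finite_subset) simp
  next
    case (Suc q)
    have "finite (marked_colourings G (count (n - S)) q)" for S
      by (rule Suc.IH) (use Suc.prems in \<open>auto dest: in_diffD\<close>)
    then have "finite (Sigma (isets n) (\<lambda>S. marked_colourings G (count (n - S)) q))"
      by (intro finite_SigmaI finite_isets)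
    then show ?case using bij_betw_finite[OF colourings_Suc_bij[OF Suc.prems, of q]] by simp
  qed
  have "finite (marked_colourings G (count (n - S)) q)" for S
    by (rule fin) (use assms in \<open>auto dest: in_diffD\<close>)
  then show ?thesis
    using bij_betw_same_card[OF colourings_Suc_bij[OF assms, of q]]
    by (simp add: finite_isets)
qed

end

section \<open>Power series in multiset exponents\<close>

text \<open>Multisets are finitely supported exponents, so every convolution is a finite sum even
  over infinitely many letters.\<close>

typedef 'a mser = "UNIV :: ('a multiset \<Rightarrow> real) set"
  morphisms mcoeff Mser ..

setup_lifting type_definition_mser

lemma mcoeff_Mser [simp]: "mcoeff (Mser f) = f"
  by (simp add: Mser_inverse)

lemma mser_eqI: "(\<And>n. mcoeff F n = mcoeff H n) \<Longrightarrow> F = H"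
  by (simp add: mcoeff_inject[symmetric] fun_eq_iff)

abbreviation sub :: "'a multiset \<Rightarrow> 'a multiset set" where
  "sub n \<equiv> {a. a \<subseteq># n}"

lemma conv_assoc:
  fixes f g h :: "'a multiset \<Rightarrow> real"
  shows "(\<Sum>a\<in>sub n. (\<Sum>b\<in>sub a. f b * g (a - b)) * h (n - a)) = (\<Sum>b\<in>sub n. f b * (\<Sum>c\<in>sub (n - b). g c * h (n - b - c)))"
proof -
  have "(\<Sum>a\<in>sub n. (\<Sum>b\<in>sub a. f b * g (a - b)) * h (n - a))
     = (\<Sum>(a, b)\<in>Sigma (sub n) sub. f b * g (a - b) * h (n - a))"
    by (simp add: sum_distrib_right sum.Sigma finite_submsets)
  also have "\<dots> = (\<Sum>(b, c)\<in>Sigma (sub n) (\<lambda>b. sub (n - b)). f b * (g c * h (n - b - c)))"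
  proof (rule sum.reindex_bij_witness[where i = "\<lambda>(b, c). (b + c, b)" and j = "\<lambda>(a, b). (b, a - b)"])
    fix p assume "p \<in> Sigma (sub n) sub"
    then obtain a b where p: "p = (a, b)" "a \<subseteq># n" "b \<subseteq># a" by auto
    obtain a' where a: "a = b + a'" using p(3) by (metis mset_subset_eq_exists_conv)
    obtain n' where n: "n = b + a' + n'" using p(2) a by (metis mset_subset_eq_exists_conv)
    show "(case case p of (a, b) \<Rightarrow> (b, a - b) of (b, c) \<Rightarrow> (b + c, b)) = p"
      "(case p of (a, b) \<Rightarrow> (b, a - b)) \<in> Sigma (sub n) (\<lambda>b. sub (n - b))"
      "(case case p of (a, b) \<Rightarrow> (b, a - b) of (b, c) \<Rightarrow> f b * (g c * h (n - b - c))) = (case p of (a, b) \<Rightarrow> f b * g (a - b) * h (n - a))"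
      by (simp_all add: p(1) a n add.assoc)
  next
    fix p assume "p \<in> Sigma (sub n) (\<lambda>b. sub (n - b))"
    then obtain b c where p: "p = (b, c)" "b \<subseteq># n" "c \<subseteq># n - b" by auto
    obtain n' where n: "n = b + n'" using p(2) by (metis mset_subset_eq_exists_conv)
    have "c \<subseteq># n'" using p(3) n by simp
    then obtain n'' where n'': "n' = c + n''" by (metis mset_subset_eq_exists_conv)
    show "(case case p of (b, c) \<Rightarrow> (b + c, b) of (a, b) \<Rightarrow> (b, a - b)) = p"
      "(case p of (b, c) \<Rightarrow> (b + c, b)) \<in> Sigma (sub n) sub"
      by (simp_all add: p(1) n n'')
  qed
  also have "\<dots> = (\<Sum>b\<in>sub n. f b * (\<Sum>c\<in>sub (n - b). g c * h (n - b - c)))"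
    by (simp add: sum_distrib_left sum.Sigma finite_submsets)
  finally show ?thesis .
qed

lemma conv_comm:
  fixes f g :: "'a multiset \<Rightarrow> real"
  shows "(\<Sum>a\<in>sub n. f a * g (n - a)) = (\<Sum>a\<in>sub n. g a * f (n - a))"
  by (rule sum.reindex_bij_witness[where i = "\<lambda>a. n - a" and j = "\<lambda>a. n - a"])
    (auto simp: subset_mset.diff_diff_right)

lemma conv_one:
  fixes f :: "'a multiset \<Rightarrow> real"
  shows "(\<Sum>a\<in>sub n. (if a = {#} then 1 else 0) * f (n - a)) = f n"
proof -
  have "(\<Sum>a\<in>sub n. (if a = {#} then 1 else 0) * f (n - a)) = (\<Sum>a\<in>sub n. if a = {#} then f n else 0)"
    by (intro sum.cong) auto
  then show ?thesis by (simp add: finite_submsets)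
qed

instantiation mser :: (type) comm_ring_1
begin

lift_definition zero_mser :: "'a mser" is "\<lambda>n. 0" .
lift_definition one_mser :: "'a mser" is "\<lambda>n. if n = {#} then 1 else 0" .
lift_definition plus_mser :: "'a mser \<Rightarrow> 'a mser \<Rightarrow> 'a mser" is "\<lambda>f g n. f n + g n" .
lift_definition minus_mser :: "'a mser \<Rightarrow> 'a mser \<Rightarrow> 'a mser" is "\<lambda>f g n. f n - g n" .
lift_definition uminus_mser :: "'a mser \<Rightarrow> 'a mser" is "\<lambda>f n. - f n" .
lift_definition times_mser :: "'a mser \<Rightarrow> 'a mser \<Rightarrow> 'a mser" is "\<lambda>f g n. \<Sum>a\<in>sub n. f a * g (n - a)" .

instance
proof
  fix a b c :: "'a mser"
  show "a * b * c = a * (b * c)" by transfer (rule ext, rule conv_assoc)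
  show "a * b = b * a" by transfer (rule ext, rule conv_comm)
  show "1 * a = a" by transfer (rule ext, rule conv_one)
  show "(a + b) * c = a * c + b * c" by transfer (simp add: distrib_right sum.distrib)
  show "(0 :: 'a mser) \<noteq> 1" by transfer (auto simp: fun_eq_iff)
qed (transfer; simp add: fun_eq_iff algebra_simps)+

end

lemmas mcoeff_simps [simp] = zero_mser.rep_eq plus_mser.rep_eq minus_mser.rep_eq uminus_mser.rep_eq
lemmas mcoeff_one = one_mser.rep_eq
lemmas mcoeff_times = times_mser.rep_eq

lemma mcoeff_sum: "mcoeff (sum F A) n = (\<Sum>x\<in>A. mcoeff (F x) n)"
  by (induction A rule: infinite_finite_induct) auto

lemma mcoeff_of_nat_mult: "mcoeff (of_nat k * F) n = of_nat k * mcoeff F n"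
  by (induction k) (simp_all add: distrib_right)

text \<open>The Euler derivation, which replaces logarithms by quotients. One derivation is enough:
  its eigenvalue \<open>size n\<close> vanishes at n = {#} only, so dividing by it recovers every
  other coefficient.\<close>

lift_definition euler :: "'a mser \<Rightarrow> 'a mser" is "\<lambda>f n. real (size n) * f n" .

lemmas mcoeff_euler [simp] = euler.rep_eq

lemma euler_minus: "euler (F - H) = euler F - euler H"
  and euler_one: "euler 1 = 0"
  by (rule mser_eqI; simp add: algebra_simps mcoeff_one)+

lemma euler_mult: "euler (F * H) = euler F * H + F * euler H"
proof (rule mser_eqI)
  fix n
  have "real (size n) * (mcoeff F a * mcoeff H (n - a)) = real (size a) * mcoeff F a * mcoeff H (n - a)
      + mcoeff F a * (real (size (n - a)) * mcoeff H (n - a))" if "a \<subseteq># n" for a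
    using that size_mset_mono[OF that] by (simp add: size_Diff_submset of_nat_diff algebra_simps)
  then show "mcoeff (euler (F * H)) n = mcoeff (euler F * H + F * euler H) n"
    by (simp only: mcoeff_euler mcoeff_times mcoeff_simps sum_distrib_left sum.distrib[symmetric])
      (intro sum.cong refl, simp only: mem_Collect_eq)
qed

lemma euler_power: "euler (F ^ Suc k) = of_nat (Suc k) * (F ^ k * euler F)"
  by (induction k) (simp_all add: euler_mult algebra_simps)

lemma mcoeff_power_0:
  assumes "mcoeff F {#} = 0" "size n < k"
  shows "mcoeff (F ^ k) n = 0"
  using assms(2)
proof (induction k arbitrary: n)
  case (Suc k)
  have "mcoeff F a * mcoeff (F ^ k) (n - a) = 0" if "a \<subseteq># n" for a
  proof (cases "a = {#}")
    case False
    then have "size (n - a) < k"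
      using that Suc.prems size_mset_mono[OF that] size_Diff_submset[OF that]
      by (simp add: nonempty_has_size)
    then show ?thesis using Suc.IH by simp
  qed (use assms in simp)
  then show ?case by (simp only: power_Suc mcoeff_times) (intro sum.neutral ballI, simp only: mem_Collect_eq)
qed simp

text \<open>The substitution of -X for X.\<close>

definition twist :: "'a mser \<Rightarrow> 'a mser" where
  "twist F = Mser (\<lambda>n. (-1) ^ size n * mcoeff F n)"

lemma twist_mult: "twist (F * H) = twist F * twist H"
proof (rule mser_eqI)
  fix n
  have "(-1) ^ size n * (mcoeff F a * mcoeff H (n - a)) = (-1) ^ size a * mcoeff F a * ((-1) ^ size (n - a) * mcoeff H (n - a))"
    if "a \<subseteq># n" for a
  proof -
    have "size n = size a + size (n - a)" using that size_mset_mono[OF that] by (simp add: size_Diff_submset)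
    then show ?thesis by (simp add: power_add)
  qed
  then show "mcoeff (twist (F * H)) n = mcoeff (twist F * twist H) n"
    by (simp only: twist_def mcoeff_Mser mcoeff_times sum_distrib_left)
      (intro sum.cong refl, simp only: mem_Collect_eq)
qed

lemma twist_one: "twist 1 = 1"
  by (rule mser_eqI) (simp add: twist_def mcoeff_one)

lemma twist_twist: "twist (twist F) = F"
  by (rule mser_eqI) (simp add: twist_def power_mult_distrib[symmetric] mult.assoc[symmetric])

lemma twist_euler: "twist (euler F) = euler (twist F)"
  by (rule mser_eqI) (simp add: twist_def)

section \<open>The linear coefficient of a binomial polynomial\<close>

definition binpoly :: "nat \<Rightarrow> real poly" where
  "binpoly k = Polynomial.smult (1 / fact k) (\<Prod>i<k. [:- real i, 1:])"

lemma poly_binpoly: "poly (binpoly k) (real q) = real (q choose k)"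
  by (simp add: binpoly_def poly_prod binomial_gbinomial gbinomial_prod_rev atLeast0LessThan)

text \<open>The product q (q - 1) ... (q - k + 1) has linear coefficient (-1)^(k-1) (k-1)!; divided
  by k! this gives the coefficients of log (1 + x).\<close>

lemma coeff_binpoly: "coeff (binpoly k) 1 = (if k = 0 then 0 else (-1) ^ (k - 1) / real k)"
proof (cases k)
  case (Suc j)
  have "(\<Prod>i<j. - real (Suc i)) = (-1) ^ j * fact j"
    by (induction j) (simp_all add: algebra_simps)
  moreover have "(\<Prod>i<k. [:- real i, 1:]) = pCons 0 (\<Prod>i<j. [:- real (Suc i), 1:])"
    unfolding Suc prod.lessThan_Suc_shift by simp
  moreover have "coeff (\<Prod>i<j. [:- real (Suc i), 1:]) 0 = (\<Prod>i<j. - real (Suc i))"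
    by (simp add: poly_0_coeff_0[symmetric] poly_prod)
  ultimately show ?thesis by (simp add: binpoly_def Suc)
qed (simp add: binpoly_def)

lemma poly_eq_of_nat:
  fixes P R :: "real poly"
  assumes "\<And>q. poly P (real q) = poly R (real q)"
  shows "P = R"
proof (rule ccontr)
  assume "P \<noteq> R"
  then have "finite {x. poly (P - R) x = 0}" by (intro poly_roots_finite) simp
  moreover have "range real \<subseteq> {x. poly (P - R) x = 0}" using assms by auto
  ultimately have "finite (range real)" by (rule finite_subset[rotated])
  then show False by (simp add: finite_image_iff inj_on_def)
qed

section \<open>Moebius inversion\<close>

text \<open>For a prime p dividing d, multiplying or dividing by p pairs the squarefree divisors of
  d with opposite signs.\<close>

lemma sum_moebius:
  assumes "d > 0"
  shows "(\<Sum>l | l dvd d. moebius l) = (if d = 1 then 1 else 0)"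
proof (cases "d = 1")
  case True
  then show ?thesis by (simp add: moebius_def)
next
  case False
  then obtain p where p: "prime p" "p dvd d" using prime_factor_nat by blast
  have fin: "finite {l. l dvd d}" using assms by simp
  let ?A = "{l. l dvd d \<and> squarefree l}"
  let ?i = "\<lambda>l. if p dvd l then l div p else l * p"
  have flip: "squarefree (l * p) \<and> l * p dvd d \<and> card (prime_factors (l * p)) = Suc (card (prime_factors l))"
    if l: "l dvd d" "squarefree l" "\<not> p dvd l" for l
  proof -
    have cop: "coprime l p" using l(3) p(1) by (metis coprime_commute prime_imp_coprime)
    have l0: "l \<noteq> 0" using l(1) assms by auto
    have "prime_factors (l * p) = insert p (prime_factors l)"
      using p(1) l0 by (simp add: prime_factors_product prime_prime_factors)
    moreover have "p \<notin> prime_factors l" using l(3) by (simp add: in_prime_factors_iff)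
    ultimately have "card (prime_factors (l * p)) = Suc (card (prime_factors l))" by simp
    moreover have "squarefree (l * p)"
      using squarefree_mult_coprime[OF cop l(2) squarefree_prime[OF p(1)]] .
    moreover have "l * p dvd d" using l(1) p(2) cop by (rule divides_mult)
    ultimately show ?thesis by blast
  qed
  have down: "l div p dvd d \<and> squarefree (l div p) \<and> \<not> p dvd l div p \<and> l div p * p = l"
    if l: "l dvd d" "squarefree l" "p dvd l" for l
  proof -
    have lp: "l div p * p = l" using l(3) by simp
    moreover have "l div p dvd l" using lp by (metis dvd_triv_left)
    then have "squarefree (l div p)" "l div p dvd d" using l squarefree_mono dvd_trans by blast+
    moreover have "\<not> p dvd l div p"
    proof
      assume "p dvd l div p"
      then have "p ^ 2 dvd l" using lp by (metis mult_dvd_mono dvd_refl power2_eq_square)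
      then have "p dvd 1" using l(2) squarefreeD by blast
      then show False using p(1) by simp
    qed
    ultimately show ?thesis by blast
  qed
  have "(\<Sum>l\<in>?A. real_of_int (moebius l)) = 0"
  proof (rule sum_involution_zero[where i = ?i])
    fix l assume "l \<in> ?A"
    then have l: "l dvd d" "squarefree l" by auto
    have p0: "p \<noteq> 0" using p(1) by auto
    show "?i l \<in> ?A \<and> ?i (?i l) = l \<and> real_of_int (moebius (?i l)) = - real_of_int (moebius l)"
    proof (cases "p dvd l")
      case True
      have d: "l div p dvd d" "squarefree (l div p)" "\<not> p dvd l div p" "l div p * p = l"
        using down[OF l True] by auto
      have "card (prime_factors l) = Suc (card (prime_factors (l div p)))"
        using flip[OF d(1-3)] unfolding d(4) by simp
      then show ?thesis using d l True by (simp add: moebius_def)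
    next
      case False
      then show ?thesis using flip[OF l False] l p0 by (simp add: moebius_def)
    qed
  qed
  then have "real_of_int (\<Sum>l\<in>?A. moebius l) = 0" by simp
  then have "(\<Sum>l\<in>?A. moebius l) = 0" by (simp only: of_int_eq_0_iff)
  moreover have "(\<Sum>l\<in>?A. moebius l) = (\<Sum>l | l dvd d. moebius l)"
    by (rule sum.mono_neutral_left) (use fin in \<open>auto simp: moebius_def\<close>)
  ultimately show ?thesis using False by simp
qed

text \<open>The weights 1 / l and 1 / k merge into 1 / (l k). Grouping by d = l k leaves the sum of
  \<open>moebius\<close> over the divisors of d, which vanishes unless d = 1.\<close>

lemma moebius_inversion:
  fixes A b :: "nat \<Rightarrow> real"
  assumes g: "g > 0" and A: "\<And>l. l dvd g \<Longrightarrow> A l = (\<Sum>k | k dvd g div l. b (l * k) / real k)"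
  shows "(\<Sum>l | l dvd g. real_of_int (moebius l) / real l * A l) = b 1"
proof -
  have fin: "finite {l. l dvd d}" if "d > 0" for d :: nat using that by simp
  have pos: "l > 0" if "l dvd g" for l using that g by (auto intro: Nat.gr0I)
  have "(\<Sum>l | l dvd g. real_of_int (moebius l) / real l * A l)
      = (\<Sum>l\<in>{l. l dvd g}. \<Sum>k\<in>{k. k dvd g div l}. real_of_int (moebius l) * b (l * k) / real (l * k))"
    by (intro sum.cong refl) (simp add: A sum_distrib_left)
  also have "\<dots> = (\<Sum>(l, k)\<in>Sigma {l. l dvd g} (\<lambda>l. {k. k dvd g div l}). real_of_int (moebius l) * b (l * k) / real (l * k))"
  proof (rule sum.Sigma)
    show "\<forall>l\<in>{l. l dvd g}. finite {k. k dvd g div l}"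
      using g by (auto intro!: fin simp: div_greater_zero_iff dvd_imp_le)
  qed (use g in simp)
  also have "\<dots> = (\<Sum>(d, l)\<in>Sigma {d. d dvd g} (\<lambda>d. {l. l dvd d}). real_of_int (moebius l) * b d / real d)"
  proof (rule sum.reindex_bij_witness[where i = "\<lambda>(d, l). (l, d div l)" and j = "\<lambda>(l, k). (l * k, l)"])
    fix p assume "p \<in> Sigma {l. l dvd g} (\<lambda>l. {k. k dvd g div l})"
    then obtain l k where p: "p = (l, k)" "l dvd g" "k dvd g div l" by auto
    have "l * k dvd g" using p(2,3) by (metis dvd_mult_div_cancel mult_dvd_mono dvd_refl)
    then show "(case case p of (l, k) \<Rightarrow> (l * k, l) of (d, l) \<Rightarrow> (l, d div l)) = p"
      "(case p of (l, k) \<Rightarrow> (l * k, l)) \<in> Sigma {d. d dvd g} (\<lambda>d. {l. l dvd d})"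
      "(case case p of (l, k) \<Rightarrow> (l * k, l) of (d, l) \<Rightarrow> real_of_int (moebius l) * b d / real d)
        = (case p of (l, k) \<Rightarrow> real_of_int (moebius l) * b (l * k) / real (l * k))"
      using pos[OF p(2)] by (auto simp: p(1))
  next
    fix p assume "p \<in> Sigma {d. d dvd g} (\<lambda>d. {l. l dvd d})"
    then obtain d l where p: "p = (d, l)" "d dvd g" "l dvd d" by auto
    have l: "l dvd g" using p dvd_trans by blast
    have "d div l dvd g div l" using p(2,3) pos[OF l] by (auto elim!: dvdE simp: mult.assoc)
    then show "(case case p of (d, l) \<Rightarrow> (l, d div l) of (l, k) \<Rightarrow> (l * k, l)) = p"
      "(case p of (d, l) \<Rightarrow> (l, d div l)) \<in> Sigma {l. l dvd g} (\<lambda>l. {k. k dvd g div l})"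
      using p l by auto
  qed
  also have "\<dots> = (\<Sum>d\<in>{d. d dvd g}. \<Sum>l\<in>{l. l dvd d}. real_of_int (moebius l) * b d / real d)"
    by (rule sum.Sigma[symmetric]) (use g pos in \<open>auto intro!: fin\<close>)
  also have "\<dots> = (\<Sum>d\<in>{d. d dvd g}. if d = 1 then b 1 else 0)"
  proof (rule sum.cong[OF refl])
    fix d assume "d \<in> {d. d dvd g}"
    then have "d > 0" using pos by simp
    have "(\<Sum>l\<in>{l. l dvd d}. real_of_int (moebius l) * b d / real d) = real_of_int (\<Sum>l | l dvd d. moebius l) * (b d / real d)"
      by (simp add: sum_distrib_right sum_divide_distrib)
    then show "(\<Sum>l\<in>{l. l dvd d}. real_of_int (moebius l) * b d / real d) = (if d = 1 then b 1 else 0)"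
      using sum_moebius[OF \<open>d > 0\<close>] by simp
  qed
  also have "\<dots> = b 1" using g by simp
  finally show ?thesis .
qed

context trace_graph begin

section \<open>Generating functions\<close>

definition ser_I :: "'i mser" where "ser_I = Mser (\<lambda>S. if iset S then 1 else 0)"
definition ser_H :: "'i mser" where "ser_H = Mser (\<lambda>n. real (ntraces n))"
definition ser_C :: "'i magma list \<Rightarrow> 'i mser" where "ser_C ts = Mser (\<lambda>n. real (nmons ts n))"
definition ser_J :: "'i mser" where "ser_J = ser_I - 1"

lemma sum_isets: "(\<Sum>a\<in>sub n. (if iset a then 1 else 0) * f a) = (\<Sum>S\<in>isets n. f S)" for f :: "'i multiset \<Rightarrow> real"
proof -
  have "(\<Sum>a\<in>sub n. (if iset a then 1 else 0) * f a) = (\<Sum>a\<in>sub n. if iset a then f a else 0)"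
    by (intro sum.cong) auto
  also have "\<dots> = (\<Sum>S\<in>isets n. f S)"
    by (subst sum.inter_filter[symmetric]) (auto simp: finite_submsets isets_def)
  finally show ?thesis .
qed

lemma twist_I_H: "twist ser_I * ser_H = 1"
proof (rule mser_eqI)
  fix n
  have "mcoeff (twist ser_I * ser_H) n = (\<Sum>a\<in>sub n. (if iset a then 1 else 0) * ((-1) ^ size a * real (ntraces (n - a))))"
    by (simp add: mcoeff_times twist_def ser_I_def ser_H_def mult.assoc mult.left_commute)
  also have "\<dots> = mcoeff 1 n" by (simp add: sum_isets cartier_foata mcoeff_one)
  finally show "mcoeff (twist ser_I * ser_H) n = mcoeff 1 n" .
qed

lemma I_twist_H: "ser_I * twist ser_H = 1"
  using arg_cong[OF twist_I_H, of twist] by (simp add: twist_mult twist_twist twist_one)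

text \<open>Each colour contributes one factor \<open>ser_I\<close>.\<close>

lemma card_colourings:
  "set_mset n \<subseteq> verts G \<Longrightarrow> real (card (marked_colourings G (count n) q)) = mcoeff (ser_I ^ q) n"
proof (induction q arbitrary: n)
  case 0
  then show ?case by (simp add: colourings_0 mcoeff_one)
next
  case (Suc q)
  have "real (card (marked_colourings G (count (n - S)) q)) = mcoeff (ser_I ^ q) (n - S)" for S
    by (rule Suc.IH) (use Suc.prems in \<open>auto dest: in_diffD\<close>)
  then show ?case
    by (simp add: colourings_Suc[OF Suc.prems] mcoeff_times ser_I_def sum_isets)
qed

lemma ser_J_0: "mcoeff ser_J {#} = 0"
  by (simp add: ser_J_def ser_I_def mcoeff_one iset_def)

text \<open>The coefficient at \<open>n\<close> of the logarithm of the independence series \<open>ser_I = 1 + ser_J\<close>.\<close>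

definition log_coeff :: "'i multiset \<Rightarrow> real" where
  "log_coeff n = (\<Sum>j<size n. (-1) ^ j / real (Suc j) * mcoeff (ser_J ^ Suc j) n)"

text \<open>The binomial expansion of (1 + J)^q is polynomial in q because J has no constant term,
  so powers beyond \<open>size n\<close> do not reach n. Its values at natural numbers determine it,
  which resolves the definite description.\<close>

lemma coeff_chromatic:
  assumes "set_mset n \<subseteq> verts G"
  shows "coeff (marked_chromatic_poly G (count n)) 1 = log_coeff n"
proof -
  define P where "P = (\<Sum>k\<le>size n. Polynomial.smult (mcoeff (ser_J ^ k) n) (binpoly k))"
  have P: "poly P (real q) = real (card (marked_colourings G (count n) q))" for q
  proof -
    have "ser_I ^ q = (ser_J + 1) ^ q" by (simp add: ser_J_def)
    also have "\<dots> = (\<Sum>k\<le>q. of_nat (q choose k) * ser_J ^ k)" by (simp add: binomial_ring)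
    finally have "mcoeff (ser_I ^ q) n = (\<Sum>k\<le>q. real (q choose k) * mcoeff (ser_J ^ k) n)"
      by (simp add: mcoeff_sum mcoeff_of_nat_mult)
    \<comment> \<open>The range is enlarged to contain both cut-offs: binomial coefficients vanish
      beyond q, coefficients of the powers of J beyond \<open>size n\<close>.\<close>
    also have "\<dots> = (\<Sum>k\<le>q + size n. real (q choose k) * mcoeff (ser_J ^ k) n)"
      by (rule sum.mono_neutral_left) (auto simp: binomial_eq_0)
    also have "\<dots> = (\<Sum>k\<le>size n. real (q choose k) * mcoeff (ser_J ^ k) n)"
      by (rule sum.mono_neutral_right) (auto simp: mcoeff_power_0[OF ser_J_0])
    finally show ?thesis
      by (simp add: P_def poly_sum poly_binpoly card_colourings[OF assms] mult.commute)
  qed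
  have "marked_chromatic_poly G (count n) = P"
    unfolding marked_chromatic_poly_def
  proof (rule the_equality)
    show "\<forall>q. poly P (real q) = real (card (marked_colourings G (count n) q))" using P by blast
    show "R = P" if "\<forall>q. poly R (real q) = real (card (marked_colourings G (count n) q))" for R
      using that P by (intro poly_eq_of_nat) simp
  qed
  moreover have "coeff P 1 = (\<Sum>k\<le>size n. mcoeff (ser_J ^ k) n * coeff (binpoly k) 1)"
    by (simp add: P_def coeff_sum)
  moreover have "\<dots> = log_coeff n"
    unfolding log_coeff_def coeff_binpoly lessThan_Suc_atMost[symmetric] sum.lessThan_Suc_shift
    by (simp add: mult.commute)
  ultimately show ?thesis by simp
qed

lemma mcoeff_power_mult_0:
  assumes "mcoeff J {#} = 0" "mcoeff F {#} = 0" "size n \<le> k"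
  shows "mcoeff (J ^ k * F) n = 0"
proof -
  have "mcoeff (J ^ k) a * mcoeff F (n - a) = 0" if "a \<subseteq># n" for a
  proof (cases "size a < k")
    case True
    then show ?thesis using mcoeff_power_0[OF assms(1)] by simp
  next
    case False
    then have "size (n - a) = 0" using assms(3) size_Diff_submset[OF that] by simp
    then show ?thesis using assms(2) by simp
  qed
  then show ?thesis by (simp only: mcoeff_times) (intro sum.neutral ballI, simp only: mem_Collect_eq)
qed

lemma mcoeff_uminus_one_power: "mcoeff ((-1) ^ j * F) n = (-1) ^ j * mcoeff F n"
  by (induction j) (simp_all add: mult.assoc)

text \<open>Euler differentiation turns log I into (euler I) / I. The finite geometric sum in -J
  equals 1 / I up to a multiple of (-J)^N with N = \<open>size n\<close>, which does not reach n
  because \<open>euler ser_I\<close> has no constant term.\<close>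

lemma size_log_coeff: "real (size n) * log_coeff n = mcoeff (euler ser_I * twist ser_H) n"
proof -
  let ?J = "ser_J" and ?N = "size n"
  have eJ: "euler ?J = euler ser_I" by (simp add: ser_J_def euler_minus euler_one)
  have "real ?N * ((-1) ^ j / real (Suc j) * mcoeff (?J ^ Suc j) n) = mcoeff ((- ?J) ^ j * euler ?J) n" for j
  proof -
    have "real ?N * mcoeff (?J ^ Suc j) n = real (Suc j) * mcoeff (?J ^ j * euler ?J) n"
      using arg_cong[OF euler_power[of ?J j], of "\<lambda>F. mcoeff F n"] by (simp only: mcoeff_euler mcoeff_of_nat_mult)
    then have "real ?N * ((-1) ^ j / real (Suc j) * mcoeff (?J ^ Suc j) n) = (-1) ^ j * mcoeff (?J ^ j * euler ?J) n"
      by (simp add: field_simps del: power_Suc of_nat_Suc)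
    also have "\<dots> = mcoeff ((-1) ^ j * (?J ^ j * euler ?J)) n" by (simp only: mcoeff_uminus_one_power)
    also have "(-1) ^ j * (?J ^ j * euler ?J) = (- ?J) ^ j * euler ?J"
      by (simp only: power_minus[of ?J j] mult.assoc)
    finally show ?thesis .
  qed
  then have "real ?N * log_coeff n = mcoeff ((\<Sum>j<?N. (- ?J) ^ j) * euler ?J) n"
    by (simp only: log_coeff_def sum_distrib_left sum_distrib_right mcoeff_sum)
  moreover have "(\<Sum>j<?N. (- ?J) ^ j) * ser_I = 1 - (- ?J) ^ ?N"
    using one_diff_power_eq[of "- ?J" ?N] by (simp add: ser_J_def mult.commute)
  then have "(\<Sum>j<?N. (- ?J) ^ j) * ser_I * twist ser_H = (1 - (- ?J) ^ ?N) * twist ser_H" by simp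
  then have geo: "(\<Sum>j<?N. (- ?J) ^ j) = (1 - (- ?J) ^ ?N) * twist ser_H"
    by (simp add: mult.assoc I_twist_H)
  have "(\<Sum>j<?N. (- ?J) ^ j) * euler ?J = euler ser_I * twist ser_H - (- ?J) ^ ?N * (twist ser_H * euler ser_I)"
    unfolding geo eJ by (simp add: algebra_simps)
  moreover have "mcoeff ((- ?J) ^ ?N * (twist ser_H * euler ser_I)) n = 0"
    by (rule mcoeff_power_mult_0) (simp_all add: ser_J_0 mcoeff_times)
  ultimately show ?thesis by simp
qed

text \<open>The logarithmic derivative of \<open>ser_H\<close>, the inverse of
  \<open>twist ser_I\<close>.\<close>

definition ser_Q :: "'i mser" where "ser_Q = - euler (twist ser_I) * ser_H"

lemma euler_H: "euler ser_H = ser_H * ser_Q"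
proof -
  have "euler (twist ser_I) * ser_H + twist ser_I * euler ser_H = 0"
    using arg_cong[OF twist_I_H, of euler] by (simp add: euler_mult euler_one)
  then have e: "twist ser_I * euler ser_H = - (euler (twist ser_I) * ser_H)"
    by (simp add: eq_neg_iff_add_eq_0 add.commute)
  have "euler ser_H = (twist ser_I * ser_H) * euler ser_H" by (simp add: twist_I_H)
  also have "\<dots> = ser_H * (twist ser_I * euler ser_H)" by (simp add: mult_ac)
  also have "\<dots> = ser_H * ser_Q" unfolding e by (simp add: ser_Q_def)
  finally show ?thesis .
qed

lemma mcoeff_Q: "mcoeff ser_Q n = - ((-1) ^ size n) * (real (size n) * log_coeff n)"
proof -
  have "euler (twist ser_I) * ser_H = twist (euler ser_I * twist ser_H)"
    by (simp add: twist_mult twist_twist twist_euler)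
  then have "mcoeff ser_Q n = - mcoeff (twist (euler ser_I * twist ser_H)) n"
    by (simp add: ser_Q_def)
  then show ?thesis by (simp add: twist_def size_log_coeff)
qed

section \<open>The counting series of ordered monomials\<close>

definition monom_ser :: "'i multiset \<Rightarrow> real \<Rightarrow> 'i mser" where
  "monom_ser d c = Mser (\<lambda>n. if n = d then c else 0)"

lemma mcoeff_monom_mult:
  "mcoeff (monom_ser d c * F) n = (if d \<subseteq># n then c * mcoeff F (n - d) else 0)"
proof -
  have "mcoeff (monom_ser d c * F) n = (\<Sum>a\<in>sub n. if a = d then c * mcoeff F (n - d) else 0)"
    unfolding mcoeff_times monom_ser_def by (intro sum.cong) auto
  then show ?thesis by (simp add: finite_submsets)
qed

definition psign :: "'i multiset \<Rightarrow> real" where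
  "psign n = (-1) ^ size (filter_mset odd_letter n)"

lemma psign_sq [simp]: "psign n * psign n = 1" "psign n * (psign n * x) = x"
  by (simp_all add: psign_def mult.assoc[symmetric] power_mult_distrib[symmetric])

lemma psign_mdeg: "psign (mdeg t) = (if odd_word t then -1 else 1)"
  by (simp add: psign_def odd_word_mdeg)

text \<open>The geometric series 1 / (1 - \<open>psign d\<close> X^d); the exponent
  \<open>size n div size d\<close> recovers k from n = \<open>repeat_mset k d\<close>.\<close>

definition ser_E :: "'i multiset \<Rightarrow> 'i mser" where
  "ser_E d = Mser (\<lambda>n. if \<exists>k. n = repeat_mset k d then psign d ^ (size n div size d) else 0)"

lemma size_repeat: "size (repeat_mset k d) = k * size d"
  by (induction k) auto

lemma repeat_diff: "d \<subseteq># n \<Longrightarrow> n - d = repeat_mset k d \<longleftrightarrow> n = repeat_mset (Suc k) d"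
  by (auto simp: subset_mset.diff_add_assoc2 subset_mset.add_diff_assoc)
    (metis subset_mset.add_diff_inverse)

lemma mcoeff_E: "d \<noteq> {#} \<Longrightarrow> mcoeff (ser_E d) (repeat_mset k d) = psign d ^ k"
  by (auto simp: ser_E_def size_repeat)

lemma ser_E_inverse:
  assumes "d \<noteq> {#}"
  shows "ser_E d * (1 - monom_ser d (psign d)) = 1"
proof -
  have "ser_E d = 1 + monom_ser d (psign d) * ser_E d"
  proof (rule mser_eqI)
    fix n
    show "mcoeff (ser_E d) n = mcoeff (1 + monom_ser d (psign d) * ser_E d) n"
    proof (cases "\<exists>k. n = repeat_mset k d")
      case True
      then obtain k where n: "n = repeat_mset k d" by blast
      show ?thesis
      proof (cases k)
        case 0
        then have "n = {#}" using n by simp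
        then show ?thesis using mcoeff_E[OF assms, of 0] assms by (simp add: mcoeff_monom_mult mcoeff_one)
      next
        case (Suc j)
        then have "n - d = repeat_mset j d" "d \<subseteq># n" "n \<noteq> {#}" using n assms by auto
        then show ?thesis using mcoeff_E[OF assms, of k] mcoeff_E[OF assms, of j] n Suc by (simp add: mcoeff_monom_mult mcoeff_one)
      qed
    next
      case False
      then have "n \<noteq> {#}" by (metis repeat_mset_0)
      moreover have "mcoeff (ser_E d) (n - d) = 0" if "d \<subseteq># n"
      proof -
        have "\<nexists>k. n - d = repeat_mset k d" using False repeat_diff[OF that] by blast
        then show ?thesis by (simp add: ser_E_def)
      qed
      ultimately show ?thesis using False by (simp add: mcoeff_monom_mult mcoeff_one) (simp add: ser_E_def)
    qed
  qed
  then show ?thesis by (simp add: algebra_simps)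
qed

text \<open>The logarithmic derivative of the factor belonging to t, namely 1 / (1 - X^d) for even
  and 1 + X^d for odd t, where d is \<open>mdeg t\<close>.\<close>

definition ser_D :: "'i magma \<Rightarrow> 'i mser" where
  "ser_D t = (if odd_word t then - 1 else 1) * (ser_E (mdeg t) * euler (monom_ser (mdeg t) (psign (mdeg t))))"

lemma mcoeff_D:
  "mcoeff (ser_D t) (repeat_mset (Suc k) (mdeg t)) = psign (mdeg t) ^ k * real (size (mdeg t))"
  "\<nexists>k. n = repeat_mset (Suc k) (mdeg t) \<Longrightarrow> mcoeff (ser_D t) n = 0"
proof -
  let ?d = "mdeg t"
  have "euler (monom_ser ?d (psign ?d)) = monom_ser ?d (real (size ?d) * psign ?d)"
    by (rule mser_eqI) (simp add: monom_ser_def)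
  \<comment> \<open>The leading sign of \<open>ser_D\<close> equals \<open>psign ?d\<close> and
    cancels the one in the numerator, so even and odd words obey one formula.\<close>
  then have "mcoeff (ser_D t) n = psign ?d * mcoeff (monom_ser ?d (real (size ?d) * psign ?d) * ser_E ?d) n" for n
    by (simp add: ser_D_def psign_mdeg mult.commute)
  then have D: "mcoeff (ser_D t) n = (if ?d \<subseteq># n then real (size ?d) * mcoeff (ser_E ?d) (n - ?d) else 0)" for n
    by (simp add: mcoeff_monom_mult mult.left_commute)
  show "mcoeff (ser_D t) (repeat_mset (Suc k) ?d) = psign ?d ^ k * real (size ?d)"
    by (simp add: D mcoeff_E)
  show "mcoeff (ser_D t) n = 0" if "\<nexists>k. n = repeat_mset (Suc k) ?d"
  proof (cases "?d \<subseteq># n")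
    case True
    have "\<nexists>k. n - ?d = repeat_mset k ?d" using that repeat_diff[OF True] by blast
    then show ?thesis by (simp add: D ser_E_def)
  qed (simp add: D)
qed

lemma finite_exps_degs: "finite {ks \<in> exps ts. degs ts ks = n}"
proof (induction ts arbitrary: n)
  case (Cons t ts)
  have "{ks \<in> exps (t # ts). degs (t # ts) ks = n}
     \<subseteq> (\<lambda>(k, r). k # r) ` ({..size n} \<times> (\<Union>a\<in>sub n. {r \<in> exps ts. degs ts r = a}))"
  proof
    fix ks assume "ks \<in> {ks \<in> exps (t # ts). degs (t # ts) ks = n}"
    then obtain k r where ks: "ks = k # r" "r \<in> exps ts" "repeat_mset k (mdeg t) + degs ts r = n" by auto
    have "size n = k * size (mdeg t) + size (degs ts r)" using ks(3) by (auto simp: size_repeat)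
    moreover have "0 < size (mdeg t)" by (simp add: nonempty_has_size[symmetric])
    ultimately have "k \<le> size n" by (metis le_add1 le_trans mult_le_mono2 Suc_leI mult.right_neutral One_nat_def)
    moreover have "degs ts r \<subseteq># n" using ks(3) by auto
    ultimately show "ks \<in> (\<lambda>(k, r). k # r) ` ({..size n} \<times> (\<Union>a\<in>sub n. {r \<in> exps ts. degs ts r = a}))"
      using ks by force
  qed
  moreover have "finite ((\<lambda>(k, r). k # r) ` ({..size n} \<times> (\<Union>a\<in>sub n. {r \<in> exps ts. degs ts r = a})))"
    using Cons finite_submsets by (intro finite_imageI finite_cartesian_product finite_UN_I) auto
  ultimately show ?case by (rule finite_subset)
qed simp

text \<open>Either t has exponent zero, or its exponent is lowered by one; for odd t it is then
  zero, so t no longer occurs.\<close>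

lemma nmons_Cons:
  "nmons (t # ts) n = nmons ts n + (if mdeg t \<subseteq># n then nmons (if odd_word t then ts else t # ts) (n - mdeg t) else 0)"
proof -
  let ?d = "mdeg t" and ?E = "\<lambda>ts n. {ks \<in> exps ts. degs ts ks = n}"
  let ?rest = "{k # r | k r. r \<in> exps ts \<and> (odd_word t \<longrightarrow> k = 0) \<and> repeat_mset (Suc k) ?d + degs ts r = n}"
  let ?inc = "\<lambda>ks. Suc (hd ks) # tl ks"
  have split: "?E (t # ts) n = (#) 0 ` ?E ts n \<union> ?inc ` ?rest"
  proof (intro equalityI subsetI)
    fix ks assume "ks \<in> ?E (t # ts) n"
    then obtain k r where ks: "ks = k # r" "r \<in> exps ts" "odd_word t \<longrightarrow> k \<le> 1" "repeat_mset k ?d + degs ts r = n" by auto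
    show "ks \<in> (#) 0 ` ?E ts n \<union> ?inc ` ?rest"
    proof (cases k)
      case 0
      then show ?thesis using ks by auto
    next
      case (Suc j)
      then have "j # r \<in> ?rest" using ks by auto
      then have "?inc (j # r) \<in> ?inc ` ?rest" by (rule imageI)
      then show ?thesis using ks Suc by simp
    qed
  next
    fix ks assume "ks \<in> (#) 0 ` ?E ts n \<union> ?inc ` ?rest"
    then show "ks \<in> ?E (t # ts) n" by auto
  qed
  have fr: "finite (?inc ` ?rest)"
    by (rule finite_subset[OF _ finite_exps_degs[of "t # ts" n]]) (use split in blast)
  have "nmons (t # ts) n = card ((#) 0 ` ?E ts n) + card (?inc ` ?rest)"
    unfolding nmons_def split using fr finite_exps_degs by (intro card_Un_disjoint) auto
  also have "card ((#) 0 ` ?E ts n) = nmons ts n"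
    unfolding nmons_def by (rule card_image) (auto simp: inj_on_def)
  also have "card (?inc ` ?rest) = card ?rest"
  proof (rule card_image, rule inj_onI)
    fix a b assume ab: "a \<in> ?rest" "b \<in> ?rest" "?inc a = ?inc b"
    obtain k r k' r' where "a = k # r" "b = k' # r'" using ab(1,2) by blast
    then show "a = b" using ab(3) by simp
  qed
  also have "card ?rest = (if ?d \<subseteq># n then nmons (if odd_word t then ts else t # ts) (n - ?d) else 0)"
  proof (cases "?d \<subseteq># n")
    case False
    then have rest: "?rest = {}" by (auto simp: add.assoc)
    show ?thesis unfolding rest using False by simp
  next
    case True
    then obtain n' where n': "n = ?d + n'" by (metis mset_subset_eq_exists_conv)
    show ?thesis
    proof (cases "odd_word t")
      case w: True
      have rest: "?rest = (#) 0 ` ?E ts n'" using w by (auto simp: n')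
      have "card ((#) 0 ` ?E ts n') = nmons ts n'"
        unfolding nmons_def by (rule card_image) (auto simp: inj_on_def)
      then show ?thesis unfolding rest using True w n' by simp
    next
      case False
      have rest: "?rest = ?E (t # ts) n'" using False by (auto simp: n' add.assoc)
      show ?thesis unfolding rest using True False n' by (simp add: nmons_def)
    qed
  qed
  finally show ?thesis .
qed

lemma ser_C_Nil: "ser_C [] = 1"
proof (rule mser_eqI)
  fix n :: "'i multiset"
  have "{ks \<in> exps []. degs [] ks = n} = (if n = {#} then {[]} else {})" by auto
  then show "mcoeff (ser_C []) n = mcoeff 1 n"
    by (simp add: ser_C_def nmons_def mcoeff_one)
qed

primrec ser_S :: "'i magma list \<Rightarrow> 'i mser" where
  "ser_S [] = 0"
| "ser_S (t # ts) = ser_S ts + ser_D t"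

text \<open>With Y = \<open>psign d\<close> X^d, the recursion \<open>nmons_Cons\<close> says C' =
  (1 - Y) C for an odd head and (1 - Y) C' = C for an even one. The logarithmic derivative turns
  both products into sums.\<close>

lemma euler_C: "euler (ser_C ts) = ser_C ts * ser_S ts"
proof (induction ts)
  case Nil
  then show ?case by (simp add: ser_C_Nil euler_one)
next
  case (Cons t ts)
  let ?Y = "monom_ser (mdeg t) (psign (mdeg t))" and ?E = "ser_E (mdeg t)" and ?C = "ser_C ts" and ?C' = "ser_C (t # ts)"
  have E: "?E * (1 - ?Y) = 1" by (rule ser_E_inverse) simp
  show ?case
  proof (cases "odd_word t")
    case True
    have "?C' = (1 - ?Y) * ?C"
    proof (rule mser_eqI)
      fix n
      show "mcoeff ?C' n = mcoeff ((1 - ?Y) * ?C) n"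
        using True by (simp add: left_diff_distrib mcoeff_monom_mult ser_C_def nmons_Cons psign_mdeg)
    qed
    then have "euler ?C' = - euler ?Y * ?C + (1 - ?Y) * (?C * ser_S ts)"
      by (simp add: euler_mult euler_minus euler_one Cons)
    also have "\<dots> = (1 - ?Y) * ?C * ser_S ts - (?E * (1 - ?Y)) * (euler ?Y * ?C)"
      unfolding E by (simp add: algebra_simps)
    also have "\<dots> = (1 - ?Y) * ?C * (ser_S ts + ser_D t)"
      using True by (simp add: ser_D_def algebra_simps)
    finally show ?thesis using \<open>?C' = (1 - ?Y) * ?C\<close> by simp
  next
    case False
    have "?C' = ?C + ?Y * ?C'"
    proof (rule mser_eqI)
      fix n
      show "mcoeff ?C' n = mcoeff (?C + ?Y * ?C') n"
        using False nmons_Cons[of t ts n] by (simp add: mcoeff_monom_mult ser_C_def psign_mdeg)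
    qed
    then have "(1 - ?Y) * ?C' = ?C" by (simp add: left_diff_distrib algebra_simps)
    then have "?E * ((1 - ?Y) * ?C') = ?E * ?C" by simp
    then have C': "?C' = ?E * ?C" by (simp add: mult.assoc[symmetric] E)
    have "euler ?E * (1 - ?Y) - ?E * euler ?Y = 0"
      using arg_cong[OF E, of euler] by (simp add: euler_mult euler_minus euler_one)
    then have "?E * (euler ?E * (1 - ?Y)) = ?E * (?E * euler ?Y)" by simp
    then have "(?E * (1 - ?Y)) * euler ?E = ?E * (?E * euler ?Y)" by (simp add: mult_ac)
    then have eE: "euler ?E = ?E * (?E * euler ?Y)" unfolding E by simp
    show ?thesis
      using False by (simp add: C' euler_mult Cons eE ser_D_def algebra_simps)
  qed
qed

lemma mcoeff_S: "distinct ts \<Longrightarrow> mcoeff (ser_S ts) n = (\<Sum>t\<in>set ts. mcoeff (ser_D t) n)"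
  by (induction ts) auto

text \<open>A coefficient of a product at b involves sub-multisets of b only, so identities valid
  below n may be multiplied.\<close>

lemma agree_mult:
  assumes "\<And>a. a \<subseteq># n \<Longrightarrow> mcoeff F a = mcoeff F' a" "b \<subseteq># n"
  shows "mcoeff (F * L) b = mcoeff (F' * L) b"
  unfolding mcoeff_times using assms subset_mset.order_trans by (intro sum.cong) auto

text \<open>By the count of ordered monomials, the product formula for the Hilbert series holds up to degree \<open>n\<close>,
  and so do its logarithmic derivatives.\<close>

lemma mcoeff_S_Q:
  assumes ts: "lie_basis (set_mset n) (size n) ts"
  shows "mcoeff (ser_S ts) n = mcoeff ser_Q n"
proof -
  have CH: "mcoeff (ser_C ts) a = mcoeff ser_H a" if "a \<subseteq># n" for a
  proof -
    have "\<not> bad (set_mset n) (size n) a"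
      using that size_mset_mono[OF that] set_mset_mono[OF that] by (auto simp: bad_def)
    then show ?thesis using nmons_eq_ntraces[OF ts] by (simp add: ser_C_def ser_H_def)
  qed
  have eCH: "mcoeff (euler (ser_C ts)) a = mcoeff (euler ser_H) a" if "a \<subseteq># n" for a
    using CH[OF that] by simp
  have one: "mcoeff (twist ser_I * ser_C ts) a = mcoeff 1 a" if "a \<subseteq># n" for a
    using agree_mult[OF CH that, of "twist ser_I"] by (simp add: mult.commute[of _ "twist ser_I"] twist_I_H)
  \<comment> \<open>Below n, \<open>twist ser_I\<close> is an inverse of \<open>ser_C ts\<close>;
    this isolates the logarithmic derivative without dividing by \<open>ser_C ts\<close>.\<close>
  have "mcoeff (ser_S ts) n = mcoeff (twist ser_I * ser_C ts * ser_S ts) n"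
    using agree_mult[OF one, of n n "ser_S ts"] by simp
  also have "\<dots> = mcoeff (euler (ser_C ts) * twist ser_I) n"
    by (simp add: euler_C mult_ac)
  also have "\<dots> = mcoeff (euler ser_H * twist ser_I) n"
    using agree_mult[OF eCH, of n n "twist ser_I"] by simp
  also have "euler ser_H * twist ser_I = (twist ser_I * ser_H) * ser_Q"
    by (simp add: euler_H mult_ac)
  finally show ?thesis by (simp add: twist_I_H)
qed

section \<open>The multiplicity formula\<close>

definition common_divs :: "'i multiset \<Rightarrow> nat set" where
  "common_divs n = {l. 0 < l \<and> (\<forall>i. l dvd count n i)}"

definition mset_div :: "'i multiset \<Rightarrow> nat \<Rightarrow> 'i multiset" where
  "mset_div n l = Abs_multiset (\<lambda>i. count n i div l)"

lemma count_mset_div: "count (mset_div n l) i = count n i div l"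
proof -
  have "{i. 0 < count n i div l} \<subseteq> set_mset n"
    by (auto simp: div_greater_zero_iff intro!: count_inI)
  then have "finite {i. 0 < count n i div l}" by (rule finite_subset) simp
  then show ?thesis by (simp add: mset_div_def Abs_multiset_inverse)
qed

lemma mset_div_set: "set_mset (mset_div n l) \<subseteq> set_mset n"
proof
  fix x assume "x \<in># mset_div n l"
  then have "count (mset_div n l) x \<noteq> 0" by simp
  then have "count n x \<noteq> 0" unfolding count_mset_div by (metis div_0)
  then show "x \<in># n" by simp
qed

lemma repeat_mset_div: "l \<in> common_divs n \<Longrightarrow> repeat_mset l (mset_div n l) = n"
  by (rule multiset_eqI) (simp add: common_divs_def count_mset_div)

lemma repeat_common_divs: "0 < l \<Longrightarrow> l \<in> common_divs (repeat_mset l d) \<and> mset_div (repeat_mset l d) l = d"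
  by (auto simp: common_divs_def count_mset_div intro!: multiset_eqI)

lemma size_mset_div: "l \<in> common_divs n \<Longrightarrow> l * size (mset_div n l) = size n"
  using arg_cong[OF repeat_mset_div, of l n size] by (simp add: size_repeat)

lemma finite_common_divs: "n \<noteq> {#} \<Longrightarrow> finite (common_divs n)"
proof -
  assume "n \<noteq> {#}"
  then obtain i where "i \<in># n" by (meson multiset_nonemptyE)
  then have "0 < count n i" by simp
  then have "common_divs n \<subseteq> {..count n i}" by (auto simp: common_divs_def intro: dvd_imp_le)
  then show ?thesis by (rule finite_subset) simp
qed

text \<open>The series \<open>ser_D t\<close> lives on multiples of \<open>mdeg t\<close>, and n = l
  \<open>mdeg t\<close> holds for at most one l. Writing this as a condition on l permits exchanging
  the sums over t and l in \<open>mult_sum\<close>.\<close>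

lemma D_sum_common_divs:
  assumes n: "n \<noteq> {#}"
  shows "mcoeff (ser_D t) n = (\<Sum>l\<in>common_divs n. if mdeg t = mset_div n l then psign (mset_div n l) ^ (l - 1) * real (size (mset_div n l)) else 0)"
proof (cases "\<exists>k. n = repeat_mset (Suc k) (mdeg t)")
  case True
  then obtain k where k: "n = repeat_mset (Suc k) (mdeg t)" by blast
  have l: "mdeg t = mset_div n l \<longleftrightarrow> l = Suc k" if "l \<in> common_divs n" for l
  proof
    assume "mdeg t = mset_div n l"
    then have "l * size (mdeg t) = Suc k * size (mdeg t)"
      using size_mset_div[OF that] arg_cong[OF k, of size] by (simp only: size_repeat)
    moreover have "size (mdeg t) \<noteq> 0" by simp
    ultimately show "l = Suc k" by (simp only: mult_cancel2 simp_thms)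
  next
    assume "l = Suc k"
    then show "mdeg t = mset_div n l" using repeat_common_divs[of "Suc k" "mdeg t"] k by simp
  qed
  have "(\<Sum>l\<in>common_divs n. if mdeg t = mset_div n l then psign (mset_div n l) ^ (l - 1) * real (size (mset_div n l)) else 0)
     = (\<Sum>l\<in>common_divs n. if l = Suc k then psign (mdeg t) ^ k * real (size (mdeg t)) else 0)"
  proof (rule sum.cong[OF refl])
    fix l' assume "l' \<in> common_divs n"
    then show "(if mdeg t = mset_div n l' then psign (mset_div n l') ^ (l' - 1) * real (size (mset_div n l')) else 0)
      = (if l' = Suc k then psign (mdeg t) ^ k * real (size (mdeg t)) else 0)"
      using l[of l'] by (cases "l' = Suc k") auto
  qed
  also have "\<dots> = psign (mdeg t) ^ k * real (size (mdeg t))"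
    using repeat_common_divs[of "Suc k" "mdeg t"] k finite_common_divs[OF n] by simp
  finally show ?thesis using mcoeff_D(1)[of t k] k by simp
next
  case False
  have "mdeg t \<noteq> mset_div n l" if lD: "l \<in> common_divs n" for l
  proof
    assume eq: "mdeg t = mset_div n l"
    obtain j where j: "l = Suc j" using lD by (cases l) (auto simp: common_divs_def)
    have "n = repeat_mset (Suc j) (mdeg t)" using repeat_mset_div[OF lD] by (simp only: eq j)
    then show "False" using False by blast
  qed
  then have "(\<Sum>l\<in>common_divs n. if mdeg t = mset_div n l then psign (mset_div n l) ^ (l - 1) * real (size (mset_div n l)) else 0) = 0"
    by (intro sum.neutral) auto
  then show ?thesis using mcoeff_D(2) False by simp
qed

text \<open>Two evaluations at n of the logarithmic derivative of the Hilbert series of A: through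
  the independence series and through ordered monomials, whose factors are grouped by degree
  n/l.\<close>

lemma mult_sum:
  assumes n: "n \<noteq> {#}" "set_mset n \<subseteq> verts G"
  shows "- ((-1) ^ size n) * (real (size n) * log_coeff n)
    = (\<Sum>l\<in>common_divs n. real (root_mult G (count (mset_div n l))) * (psign (mset_div n l) ^ (l - 1) * real (size (mset_div n l))))"
proof -
  \<comment> \<open>Truncating at the letters and the length of n suffices, as every n/l stays
    within these bounds.\<close>
  obtain ts where ts: "lie_basis (set_mset n) (size n) ts" using lie_basis_exists[of "set_mset n"] by auto
  have rm: "root_mult G (count (mset_div n l)) = card {t \<in> set ts. mdeg t = mset_div n l}" if l: "l \<in> common_divs n" for l
  proof -
    have "size (mset_div n l) \<le> size n" using size_mset_div[OF l] l by (cases l) (auto simp: common_divs_def)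
    then have "\<not> bad (set_mset n) (size n) (mset_div n l)" using mset_div_set[of n l] by (simp add: bad_def)
    then show ?thesis
      using ts mset_div_set[of n l] n(2) by (intro root_mult_card) (auto simp: lie_basis_def)
  qed
  have "- ((-1) ^ size n) * (real (size n) * log_coeff n) = mcoeff (ser_S ts) n"
    using mcoeff_S_Q[OF ts] mcoeff_Q by simp
  also have "\<dots> = (\<Sum>t\<in>set ts. \<Sum>l\<in>common_divs n. if mdeg t = mset_div n l then psign (mset_div n l) ^ (l - 1) * real (size (mset_div n l)) else 0)"
    using ts by (simp add: mcoeff_S D_sum_common_divs[OF n(1)] lie_basis_def)
  also have "\<dots> = (\<Sum>l\<in>common_divs n. \<Sum>t\<in>set ts. if mdeg t = mset_div n l then psign (mset_div n l) ^ (l - 1) * real (size (mset_div n l)) else 0)"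
    by (rule sum.swap)
  also have "\<dots> = (\<Sum>l\<in>common_divs n. real (card {t \<in> set ts. mdeg t = mset_div n l}) * (psign (mset_div n l) ^ (l - 1) * real (size (mset_div n l))))"
    by (simp add: sum.inter_filter[symmetric])
  finally show ?thesis using rm by simp
qed

lemma psign_mset_div: "l \<in> common_divs n \<Longrightarrow> psign n = psign (mset_div n l) ^ l"
proof -
  assume l: "l \<in> common_divs n"
  have "size (filter_mset P (repeat_mset k d)) = size (filter_mset P d) * k" for P k and d :: "'i multiset"
    by (induction k) auto
  then have "psign (repeat_mset l (mset_div n l)) = psign (mset_div n l) ^ l" by (simp add: psign_def power_mult)
  then show ?thesis using repeat_mset_div[OF l] by simp
qed

text \<open>Division by \<open>size n\<close> turns \<open>size (mset_div n l)\<close> into 1 / l.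
  With s the sign of n/l the signs combine to s^l s^(l-1) = s, which is the shape that Moebius
  inversion requires.\<close>

lemma signed_mult_sum:
  assumes n: "n \<noteq> {#}" "set_mset n \<subseteq> verts G"
  shows "psign n * ((-1) ^ (size n - 1) * log_coeff n) = (\<Sum>l\<in>common_divs n. psign (mset_div n l) * real (root_mult G (count (mset_div n l))) / real l)"
proof -
  have N: "0 < size n" using n(1) by (simp add: nonempty_has_size[symmetric])
  have "real (size n) * (psign n * ((-1) ^ (size n - 1) * log_coeff n)) = psign n * (- ((-1) ^ size n) * (real (size n) * log_coeff n))"
    using N by (cases "size n") simp_all
  also have "\<dots> = (\<Sum>l\<in>common_divs n. psign n * (real (root_mult G (count (mset_div n l))) * (psign (mset_div n l) ^ (l - 1) * real (size (mset_div n l)))))"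
    unfolding mult_sum[OF n] by (rule sum_distrib_left)
  also have "\<dots> = (\<Sum>l\<in>common_divs n. real (size n) * (psign (mset_div n l) * real (root_mult G (count (mset_div n l))) / real l))"
  proof (rule sum.cong[OF refl])
    fix l assume l: "l \<in> common_divs n"
    then obtain j where j: "l = Suc j" by (cases l) (auto simp: common_divs_def)
    let ?s = "psign (mset_div n l)"
    have "?s ^ j * ?s ^ j = 1" by (simp add: power_mult_distrib[symmetric])
    then have e1: "psign n * ?s ^ (l - 1) = ?s" unfolding psign_mset_div[OF l] by (simp add: j mult.assoc)
    have "real l * real (size (mset_div n l)) = real (size n)" using size_mset_div[OF l] by (metis of_nat_mult)
    then have e2: "real (size (mset_div n l)) = real (size n) / real l" using j by (simp add: field_simps)
    have "psign n * (real (root_mult G (count (mset_div n l))) * (?s ^ (l - 1) * real (size (mset_div n l))))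
       = (psign n * ?s ^ (l - 1)) * real (root_mult G (count (mset_div n l))) * real (size (mset_div n l))" by (simp only: mult_ac)
    also have "\<dots> = real (size n) * (?s * real (root_mult G (count (mset_div n l))) / real l)"
      unfolding e1 e2 by simp
    finally show "psign n * (real (root_mult G (count (mset_div n l))) * (?s ^ (l - 1) * real (size (mset_div n l))))
       = real (size n) * (?s * real (root_mult G (count (mset_div n l))) / real l)" .
  qed
  also have "\<dots> = real (size n) * (\<Sum>l\<in>common_divs n. psign (mset_div n l) * real (root_mult G (count (mset_div n l))) / real l)"
    by (rule sum_distrib_left[symmetric])
  finally show ?thesis using N n(1) by simp
qed

text \<open>Reduces inversion over multidegrees to inversion over the divisors of one natural
  number.\<close>

lemma common_divs_Gcd: "n \<noteq> {#} \<Longrightarrow> 0 < Gcd (range (count n)) \<and> common_divs n = {l. l dvd Gcd (range (count n))}"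
proof -
  assume "n \<noteq> {#}"
  then obtain i where "i \<in># n" by (meson multiset_nonemptyE)
  then have "count n i \<noteq> 0" by simp
  then have "\<not> range (count n) \<subseteq> {0}" by (metis rangeI singletonD subsetD)
  then have g: "0 < Gcd (range (count n))" by (simp only: Gcd_0_iff[symmetric] neq0_conv)
  then show ?thesis by (auto simp: common_divs_def dvd_Gcd_iff intro: Nat.gr0I)
qed

theorem multiplicity_moebius:
  assumes n: "n \<noteq> {#}" "set_mset n \<subseteq> verts G"
  shows "(\<Sum>l\<in>common_divs n. real_of_int (moebius l) / real l * (psign (mset_div n l) * ((-1) ^ (size (mset_div n l) - 1) * log_coeff (mset_div n l))))
    = psign n * real (root_mult G (count n))"
proof -
  let ?g = "Gcd (range (count n))"
  let ?A = "\<lambda>l. psign (mset_div n l) * ((-1) ^ (size (mset_div n l) - 1) * log_coeff (mset_div n l))"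
  let ?b = "\<lambda>l. psign (mset_div n l) * real (root_mult G (count (mset_div n l)))"
  have g: "0 < ?g" and D: "common_divs n = {l. l dvd ?g}" using common_divs_Gcd[OF n(1)] by auto
  have "(\<Sum>l | l dvd ?g. real_of_int (moebius l) / real l * ?A l) = ?b 1"
  proof (rule moebius_inversion[OF g])
    fix l assume l: "l dvd ?g"
    then have lD: "l \<in> common_divs n" using D by simp
    have l0: "0 < l" using lD by (simp add: common_divs_def)
    have ne: "mset_div n l \<noteq> {#}" using repeat_mset_div[OF lD] n(1) by auto
    have ver: "set_mset (mset_div n l) \<subseteq> verts G" using mset_div_set[of n l] n(2) by blast
    have "k \<in> common_divs (mset_div n l) \<longleftrightarrow> k dvd ?g div l" for k
    proof -
      have "k \<in> common_divs (mset_div n l) \<longleftrightarrow> l * k \<in> common_divs n"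
      proof -
        have "k dvd count n i div l \<longleftrightarrow> l * k dvd count n i" for i
        proof -
          have "l dvd count n i" using lD by (simp add: common_divs_def)
          then obtain c where c: "count n i = l * c" by blast
          show ?thesis using l0 by (simp add: c)
        qed
        then show ?thesis using l0 by (simp add: common_divs_def count_mset_div)
      qed
      also have "\<dots> \<longleftrightarrow> l * k dvd ?g" using D by simp
      also have "\<dots> \<longleftrightarrow> k dvd ?g div l"
      proof -
        obtain c where c: "?g = l * c" using l by blast
        show ?thesis using l0 by (simp add: c)
      qed
      finally show ?thesis .
    qed
    then have "common_divs (mset_div n l) = {k. k dvd ?g div l}" by blast
    moreover have "mset_div (mset_div n l) k = mset_div n (l * k)" for k
      by (rule multiset_eqI) (simp add: count_mset_div div_mult2_eq)
    ultimately show "?A l = (\<Sum>k | k dvd ?g div l. ?b (l * k) / real k)"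
      using signed_mult_sum[OF ne ver] by simp
  qed
  moreover have "mset_div n 1 = n" by (rule multiset_eqI) (simp add: count_mset_div)
  ultimately show ?thesis by (simp add: D)
qed

end

section \<open>Translation from multisets to multidegrees\<close>

theorem theorem4p1:
  fixes G :: "'i marked_graph" and m :: "'i \<Rightarrow> nat"
  assumes "marked_simple_graph G"
    and "countable (verts G)"
    and "m \<in> multidegrees (verts G)"
  shows "real (root_mult G m) =
           eps G m * (\<Sum>l\<in>divisors_of m.
             real_of_int (moebius l) / real l * eps G (div_deg m l)
               * (-1) powi (int (total_degree m div l) - 1)
               * coeff (marked_chromatic_poly G (div_deg m l)) 1) \<and>
         (Gcd (m ` supp m) = 1 \<longrightarrow>
           real (root_mult G m) = \<bar>coeff (marked_chromatic_poly G m) 1\<bar>)"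
proof -
  interpret trace_graph G by (unfold_locales) (use assms in auto)
  define n where "n = Abs_multiset m"
  have "finite {i. 0 < m i}" using assms(3) by (simp add: multidegrees_def supp_def)
  then have m: "m = count n" by (simp add: n_def Abs_multiset_inverse)
  have supp: "supp (count k) = set_mset k" for k :: "'i multiset"
    by (auto simp: supp_def count_eq_zero_iff)
  have ver: "set_mset n \<subseteq> verts G" using assms(3) supp[of n] by (simp add: m multidegrees_def)
  have eps: "eps G (count k) = psign k" for k
  proof -
    have "size (filter_mset odd_letter k) = (\<Sum>i\<in>set_mset k \<inter> odd_verts G. count k i)"
      unfolding size_multiset_overloaded_eq by (intro sum.cong) auto
    then show ?thesis by (simp add: eps_def psign_def supp)
  qed
  show ?thesis
  proof (cases "n = {#}")
    case True
    \<comment> \<open>Degree zero: no Lie word has empty content, so the multiplicity is 0. The sum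
      over infinitely many divisors is 0 by convention, and the gcd of the empty set is 0, so the
      second claim is vacuous.\<close>
    have "root_mult G (count n) = card ({} :: 'i magma set)"
      by (rule root_mult_card) (use True mdeg_nonempty pm.independent_empty in auto)
    moreover have "divisors_of m = {0<..}" by (auto simp: divisors_of_def m True)
    then have "infinite (divisors_of m)" by (simp add: infinite_Ioi)
    moreover have "Gcd (m ` supp m) \<noteq> 1" by (simp add: m supp True)
    ultimately show ?thesis by (simp add: m)
  next
    case False
    have contract_word: "div_deg m l = count (mset_div n l)" for l by (simp add: div_deg_def count_mset_div m fun_eq_iff)
    have D: "divisors_of m = common_divs n" by (simp add: divisors_of_def common_divs_def m)
    have td: "total_degree m = size n" by (simp add: total_degree_def m supp size_multiset_overloaded_eq)
    have cf: "coeff (marked_chromatic_poly G (count (mset_div n l))) 1 = log_coeff (mset_div n l)" for l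
      by (rule coeff_chromatic) (use mset_div_set[of n l] ver in blast)
    \<comment> \<open>The integer exponent and the truncated subtraction on naturals agree because
      n/l is not empty.\<close>
    have pw: "(-1 :: real) powi (int (total_degree m div l) - 1) = (-1) ^ (size (mset_div n l) - 1)" if l: "l \<in> common_divs n" for l
    proof -
      have "l \<noteq> 0" using l by (simp add: common_divs_def)
      then have "size n div l = size (mset_div n l)" using size_mset_div[OF l] by (metis nonzero_mult_div_cancel_left)
      moreover have "0 < size (mset_div n l)" using size_mset_div[OF l] False by (metis mult_is_0 neq0_conv size_eq_0_iff_empty)
      then have "int (size (mset_div n l)) - 1 = int (size (mset_div n l) - 1)" by simp
      ultimately show ?thesis by (simp only: td power_int_of_nat)
    qed
    have main: "real (root_mult G m) = eps G m * (\<Sum>l\<in>divisors_of m.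
             real_of_int (moebius l) / real l * eps G (div_deg m l)
               * (-1) powi (int (total_degree m div l) - 1)
               * coeff (marked_chromatic_poly G (div_deg m l)) 1)"
    proof -
      have "(\<Sum>l\<in>divisors_of m. real_of_int (moebius l) / real l * eps G (div_deg m l)
               * (-1) powi (int (total_degree m div l) - 1)
               * coeff (marked_chromatic_poly G (div_deg m l)) 1)
        = (\<Sum>l\<in>common_divs n. real_of_int (moebius l) / real l * (psign (mset_div n l) * ((-1) ^ (size (mset_div n l) - 1) * log_coeff (mset_div n l))))"
        unfolding D by (rule sum.cong[OF refl]) (simp only: pw contract_word eps cf mult.assoc)
      then show ?thesis using multiplicity_moebius[OF False ver] by (simp add: m eps)
    qed
    moreover have "real (root_mult G m) = \<bar>coeff (marked_chromatic_poly G m) 1\<bar>" if g: "Gcd (m ` supp m) = 1"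
    proof -
      have "l = 1" if "l \<in> common_divs n" for l
      proof -
        have "l dvd Gcd (m ` supp m)" using that by (auto simp: common_divs_def dvd_Gcd_iff m)
        then show ?thesis using g by simp
      qed
      moreover have "1 \<in> common_divs n" by (simp add: common_divs_def)
      ultimately have D1: "divisors_of m = {1}" using D by blast
      have d1: "div_deg m 1 = m" by (simp add: div_deg_def)
      have e: "\<bar>eps G m\<bar> = 1" by (simp add: eps_def power_abs)
      \<comment> \<open>A dimension equals its absolute value; with only l = 1 left, every factor
        besides the linear coefficient has absolute value 1.\<close>
      have "real (root_mult G m) = \<bar>real (root_mult G m)\<bar>" by simp
      also have "\<dots> = \<bar>coeff (marked_chromatic_poly G m) 1\<bar>"
        unfolding main D1 by (simp add: abs_mult e d1[unfolded One_nat_def] power_int_abs moebius_def)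
      finally show ?thesis .
    qed
    ultimately show ?thesis by blast
  qed
qed

end
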